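(* Let $P^{ij}=g^{ij}(\mathbf u)\frac{d}{dx}+b^{ij}_k(\mathbf u)u^k_x+\tilde g^{ij}(\mathbf u)\frac{d}{dy}+\tilde b^{ij}_k(\mathbf u)u^k_y$ be a non-degenerate 2D Hamiltonian operator such that the affinor $L^i_j=\tilde g^{ik}g_{kj}$ has (pointwise) diagonal Jordan normal form. Then $P$ can be reduced to constant coefficient form by a local change of the dependent variables.
   Context: $\mathbf u=(u^1,\dots,u^n)$ are functions of $x,y$. $P$ is Hamiltonian if $\{F,G\}=\int\frac{\delta F}{\delta u^i}P^{ij}\frac{\delta G}{\delta u^j}dx\,dy$ is skew-symmetric and satisfies the Jacobi identity; non-degenerate means $g$ and $\tilde g$ are non-degenerate ($g_{kj}$ is the inverse of $g^{ij}$). Constant coefficient form means all $g^{ij},\tilde g^{ij}$ constant and all $b^{ij}_k,\tilde b^{ij}_k$ zero. *)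

theory Defs
  imports "HOL-Analysis.Analysis"
begin

fun iter_dderiv :: "'a::real_normed_vector list \<Rightarrow> ('a \<Rightarrow> 'b::real_normed_vector) \<Rightarrow> 'a \<Rightarrow> 'b" where
  "iter_dderiv [] f = f"
| "iter_dderiv (v # vs) f = (\<lambda>x. frechet_derivative (iter_dderiv vs f) (at x) v)"

definition smooth_on :: "'a::real_normed_vector set \<Rightarrow> ('a \<Rightarrow> 'b::real_normed_vector) \<Rightarrow> bool" where
  "smooth_on S f \<longleftrightarrow> (\<forall>vs. \<forall>x\<in>S. iter_dderiv vs f differentiable (at x))"

type_synonym plane = "real \<times> real"

definition pdx :: "(plane \<Rightarrow> 'b::real_normed_vector) \<Rightarrow> plane \<Rightarrow> 'b" where
  "pdx f p = vector_derivative (\<lambda>t. f (t, snd p)) (at (fst p))"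

definition pdy :: "(plane \<Rightarrow> 'b::real_normed_vector) \<Rightarrow> plane \<Rightarrow> 'b" where
  "pdy f p = vector_derivative (\<lambda>t. f (fst p, t)) (at (snd p))"

definition compact_supp :: "(plane \<Rightarrow> 'b::real_normed_vector) \<Rightarrow> bool" where
  "compact_supp h \<longleftrightarrow> (\<exists>K. compact K \<and> (\<forall>p. p \<notin> K \<longrightarrow> h p = 0))"

definition config :: "(real^'n) set \<Rightarrow> (plane \<Rightarrow> real^'n) \<Rightarrow> bool" where
  "config U u \<longleftrightarrow> smooth_on UNIV u \<and> range u \<subseteq> U"

definition hop ::
  "(real^'n \<Rightarrow> real^'n^'n) \<Rightarrow> (real^'n \<Rightarrow> 'n \<Rightarrow> 'n \<Rightarrow> 'n \<Rightarrow> real) \<Rightarrow>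
   (real^'n \<Rightarrow> real^'n^'n) \<Rightarrow> (real^'n \<Rightarrow> 'n \<Rightarrow> 'n \<Rightarrow> 'n \<Rightarrow> real) \<Rightarrow>
   (plane \<Rightarrow> real^'n) \<Rightarrow> (plane \<Rightarrow> real^'n) \<Rightarrow> plane \<Rightarrow> real^'n" where
  "hop g b gt bt u xi p = (\<chi> i.
      (\<Sum>j\<in>UNIV. g (u p) $ i $ j * pdx xi p $ j)
    + (\<Sum>j\<in>UNIV. \<Sum>k\<in>UNIV. b (u p) i j k * pdx u p $ k * xi p $ j)
    + (\<Sum>j\<in>UNIV. gt (u p) $ i $ j * pdy xi p $ j)
    + (\<Sum>j\<in>UNIV. \<Sum>k\<in>UNIV. bt (u p) i j k * pdy u p $ k * xi p $ j))"

type_synonym ('n) functional = "(plane \<Rightarrow> real^'n) \<Rightarrow> real"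

definition has_var_deriv :: "('n::finite) functional \<Rightarrow> (plane \<Rightarrow> real^'n) \<Rightarrow> (plane \<Rightarrow> real^'n) \<Rightarrow> bool" where
  "has_var_deriv F u \<delta> \<longleftrightarrow> continuous_on UNIV \<delta> \<and>
     (\<forall>h. smooth_on UNIV h \<and> compact_supp h \<longrightarrow>
        ((\<lambda>\<epsilon>. F (\<lambda>p. u p + \<epsilon> *\<^sub>R h p)) has_real_derivative
           integral UNIV (\<lambda>p. \<delta> p \<bullet> h p)) (at 0))"

definition var_deriv :: "('n::finite) functional \<Rightarrow> (plane \<Rightarrow> real^'n) \<Rightarrow> plane \<Rightarrow> real^'n" where
  "var_deriv F u = (THE \<delta>. has_var_deriv F u \<delta>)"

definition pbracket ::
  "((plane \<Rightarrow> real^'n) \<Rightarrow> (plane \<Rightarrow> real^'n) \<Rightarrow> plane \<Rightarrow> real^'n) \<Rightarrow>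
   ('n::finite) functional \<Rightarrow> ('n::finite) functional \<Rightarrow> ('n::finite) functional" where
  "pbracket P F G u = integral UNIV (\<lambda>p. var_deriv F u p \<bullet> P u (var_deriv G u) p)"

definition local_functional :: "('n::finite) functional \<Rightarrow> bool" where
  "local_functional F \<longleftrightarrow> (\<exists>f :: plane \<times> (real^'n) \<Rightarrow> real.
      smooth_on UNIV f \<and> (\<exists>K. compact K \<and> (\<forall>p y. p \<notin> K \<longrightarrow> f (p, y) = 0)) \<and>
      F = (\<lambda>u. integral UNIV (\<lambda>p. f (p, u p))))"

definition hamiltonian ::
  "(real^'n) set \<Rightarrow> ((plane \<Rightarrow> real^'n) \<Rightarrow> (plane \<Rightarrow> real^'n) \<Rightarrow> plane \<Rightarrow> real^'n) \<Rightarrow> bool" where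
  "hamiltonian U P \<longleftrightarrow>
     (\<forall>F G H u. local_functional F \<and> local_functional G \<and> local_functional H \<and> config U u \<longrightarrow>
        pbracket P F G u = - pbracket P G F u \<and>
        pbracket P (pbracket P F G) H u + pbracket P (pbracket P G H) F u
          + pbracket P (pbracket P H F) G u = 0)"

definition affinor :: "real^'n^'n \<Rightarrow> real^'n^'n \<Rightarrow> real^'n^'n" where
  "affinor g gt = gt ** matrix_inv g"

definition cdiag :: "complex^'n \<Rightarrow> complex^'n^'n" where
  "cdiag d = (\<chi> i j. if i = j then d $ i else 0)"

definition diagonalizable :: "real^'n^'n \<Rightarrow> bool" where
  "diagonalizable L \<longleftrightarrow> (\<exists>S :: complex^'n^'n. \<exists>d. invertible S \<and>
      (\<chi> i j. complex_of_real (L $ i $ j)) ** S = S ** cdiag d)"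

definition jacobian :: "(real^'n \<Rightarrow> real^'n) \<Rightarrow> real^'n \<Rightarrow> real^'n^'n" where
  "jacobian \<Phi> y = matrix (frechet_derivative \<Phi> (at y))"

text \<open>In the new variables w = Phi(u), dF/du_i = (dw^a/du^i) dF/dw^a, so the operator
  becomes P'^{ab} = J^a_i o P^{ij} o J^b_j with J = dPhi/du. It has constant-coefficient
  form iff P' psi = G psi_x + Gt psi_y for constant G, Gt (all b' vanish).\<close>
definition reduces_to_constant_form ::
  "(real^'n) set \<Rightarrow> (real^'n \<Rightarrow> real^'n) \<Rightarrow>
   ((plane \<Rightarrow> real^'n) \<Rightarrow> (plane \<Rightarrow> real^'n) \<Rightarrow> plane \<Rightarrow> real^'n) \<Rightarrow> bool" where
  "reduces_to_constant_form V \<Phi> P \<longleftrightarrow>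
     (\<exists>G Gt :: real^'n^'n. \<forall>u \<psi>. config V u \<and> smooth_on UNIV \<psi> \<longrightarrow>
        (\<forall>p. jacobian \<Phi> (u p) *v P u (\<lambda>q. transpose (jacobian \<Phi> (u q)) *v \<psi> q) p
             = G *v pdx \<psi> p + Gt *v pdy \<psi> p))"

definition local_diffeo :: "(real^'n) set \<Rightarrow> (real^'n \<Rightarrow> real^'n) \<Rightarrow> bool" where
  "local_diffeo V \<Phi> \<longleftrightarrow> open V \<and> smooth_on V \<Phi> \<and> inj_on \<Phi> V \<and>
     (\<forall>y\<in>V. det (jacobian \<Phi> y) \<noteq> 0)"

end

theory Submission
  imports Defs
begin

text \<open>Test the Jacobi identity on the linear functionals \<open>F(u) = \<integral> \<phi> a \<bullet> u\<close>. Integrating by parts and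
  choosing polynomial jets at a point yields, for the coefficients \<open>g\<close>, \<open>b\<close> and their tilde versions,
  that \<open>b = - g \<Gamma>\<close> for a flat torsion-free connection \<open>\<Gamma>\<close>, and that the difference tensor \<open>T\<close> between the
  two connections satisfies: \<open>t(a,b,c) = ga \<bullet> T(b,c)\<close> is symmetric in \<open>a, b\<close>, has vanishing cyclic sum, and
  \<open>\<nabla>T\<close> is symmetric; the last property forces \<open>\<nabla>T = 0\<close>. In a flat frame the affinor becomes a matrix
  function \<open>N\<close> whose derivatives are the constant matrices \<open>- R\<^sub>c = - T(\<cdot>, c)\<close>; all values of \<open>N\<close> commute.
  Being diagonalizable they have a joint eigenbasis, which also diagonalizes all \<open>R\<^sub>c\<close>, and the cyclic identity
  then kills every weight of \<open>R\<close>. Hence \<open>T = 0\<close>, both metrics are parallel for \<open>\<Gamma>\<close>, and flat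
  coordinates of \<open>\<Gamma>\<close> do the job.\<close>

section \<open>Smooth functions\<close>

text \<open>Linear functionals suffice as tests: their variational derivatives
  \<open>\<phi> a\<close> do not depend on \<open>u\<close>, so a nested bracket only requires the
  first variation of the inner one. The main obstacle is that pointwise diagonalizability provides
  no smooth eigenframe: eigenvalues may be complex and their multiplicities may jump. Hence
  eigenvectors are never differentiated. The affinor is written in parallel covectors, where
  self-adjointness at one point, \<open>T_sym'\<close>, combined with constancy of \<open>t\<close>
  makes the matrices at any two points commute; a single constant complex eigenbasis then serves all
  points, and the derivatives \<open>R\<close> inherit it because the span of the matrices is
  closed. Constancy of \<open>t\<close> itself is pure symmetry: a four-index quantity symmetric in
  three slots and cyclic in three slots vanishes. Flat coordinates need no separate integration of
  closed forms, since a parallel covector and its potential together form a parallel section of one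
  larger flat connection.\<close>

lemma frechet_derivative_eq: "(f has_derivative D) (at x) \<Longrightarrow> frechet_derivative f (at x) = D"
  using frechet_derivative_at by metis

lemma smooth_on_differentiable: "smooth_on S f \<Longrightarrow> x \<in> S \<Longrightarrow> f differentiable (at x)"
  unfolding smooth_on_def by (metis iter_dderiv.simps(1))

lemma smooth_on_has_derivative:
  "smooth_on S f \<Longrightarrow> x \<in> S \<Longrightarrow> (f has_derivative frechet_derivative f (at x)) (at x)"
  using smooth_on_differentiable frechet_derivative_works by blast

lemma smooth_on_continuous: "smooth_on S f \<Longrightarrow> continuous_on S f"
  by (meson smooth_on_differentiable continuous_at_imp_continuous_on differentiable_imp_continuous_within)

lemma smooth_on_isCont: "smooth_on S f \<Longrightarrow> x \<in> S \<Longrightarrow> isCont f x"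
  by (meson smooth_on_differentiable differentiable_imp_continuous_within)

lemma smooth_on_subset: "smooth_on S f \<Longrightarrow> T \<subseteq> S \<Longrightarrow> smooth_on T f"
  unfolding smooth_on_def by blast

lemma iter_dderiv_append: "iter_dderiv (vs @ ws) f = iter_dderiv vs (iter_dderiv ws f)"
  by (induction vs) auto

lemma smooth_on_dderiv: "smooth_on S f \<Longrightarrow> smooth_on S (\<lambda>x. frechet_derivative f (at x) v)"
  unfolding smooth_on_def
proof (intro allI ballI)
  fix vs x assume f: "\<forall>vs. \<forall>x\<in>S. iter_dderiv vs f differentiable at x" and x: "x \<in> S"
  have "iter_dderiv vs (\<lambda>x. frechet_derivative f (at x) v) = iter_dderiv (vs @ [v]) f"
    by (simp add: iter_dderiv_append)
  then show "iter_dderiv vs (\<lambda>x. frechet_derivative f (at x) v) differentiable at x"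
    using f x by metis
qed

lemma has_derivative_sum_list:
  assumes "\<And>h. h \<in> set fs \<Longrightarrow> (h has_derivative D h) F"
  shows "((\<lambda>x. \<Sum>h\<leftarrow>fs. h x) has_derivative (\<lambda>v. \<Sum>h\<leftarrow>fs. D h v)) F"
  using assms by (induction fs) (auto intro!: has_derivative_add)

text \<open>Bootstrapping: a family closed, up to finite sums, under directional derivatives consists
  of smooth functions.\<close>
lemma smooth_on_family:
  fixes Fam :: "('a::real_normed_vector \<Rightarrow> 'b::real_normed_vector) set"
  assumes S: "open S" and f: "f \<in> Fam"
    and D: "\<And>h x. h \<in> Fam \<Longrightarrow> x \<in> S \<Longrightarrow> (h has_derivative D h x) (at x)"
    and cl: "\<And>h v. h \<in> Fam \<Longrightarrow> \<exists>hs. set hs \<subseteq> Fam \<and> (\<forall>x\<in>S. D h x v = (\<Sum>k\<leftarrow>hs. k x))"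
  shows "smooth_on S f"
proof -
  \<comment> \<open>The iterated derivatives agree with sums of members only on \<open>S\<close>;
    openness of \<open>S\<close> is what allows such an equality to be differentiated again.\<close>
  have key: "\<exists>hs. set hs \<subseteq> Fam \<and> (\<forall>x\<in>S. iter_dderiv vs f x = (\<Sum>k\<leftarrow>hs. k x))" for vs
  proof (induction vs)
    case Nil
    show ?case by (rule exI[of _ "[f]"]) (use f in auto)
  next
    case (Cons v vs)
    then obtain hs where hs: "set hs \<subseteq> Fam" "\<forall>x\<in>S. iter_dderiv vs f x = (\<Sum>k\<leftarrow>hs. k x)"
      by blast
    obtain c where c: "\<And>h. h \<in> Fam \<Longrightarrow> set (c h) \<subseteq> Fam \<and> (\<forall>x\<in>S. D h x v = (\<Sum>k\<leftarrow>c h. k x))"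
      using cl[of _ v] by metis
    have "iter_dderiv (v # vs) f x = (\<Sum>k\<leftarrow>concat (map c hs). k x)" if x: "x \<in> S" for x
    proof -
      have "((\<lambda>x. \<Sum>k\<leftarrow>hs. k x) has_derivative (\<lambda>v. \<Sum>h\<leftarrow>hs. D h x v)) (at x)"
        by (rule has_derivative_sum_list) (use hs D x in auto)
      then have "(iter_dderiv vs f has_derivative (\<lambda>v. \<Sum>h\<leftarrow>hs. D h x v)) (at x)"
        by (rule has_derivative_transform_within_open[OF _ S x]) (use hs in auto)
      then have "iter_dderiv (v # vs) f x = (\<Sum>h\<leftarrow>hs. D h x v)"
        by (simp add: frechet_derivative_eq)
      also have "\<dots> = (\<Sum>k\<leftarrow>concat (map c hs). k x)"
        using hs(1) c x by (induction hs) auto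
      finally show ?thesis .
    qed
    moreover have "set (concat (map c hs)) \<subseteq> Fam" using hs(1) c by auto
    ultimately show ?case by blast
  qed
  show ?thesis unfolding smooth_on_def
  proof (intro allI ballI)
    fix vs x assume x: "x \<in> S"
    obtain hs where hs: "set hs \<subseteq> Fam" "\<forall>x\<in>S. iter_dderiv vs f x = (\<Sum>k\<leftarrow>hs. k x)"
      using key by blast
    have "((\<lambda>x. \<Sum>k\<leftarrow>hs. k x) has_derivative (\<lambda>v. \<Sum>h\<leftarrow>hs. D h x v)) (at x)"
      by (rule has_derivative_sum_list) (use hs D x in auto)
    then have "(iter_dderiv vs f has_derivative (\<lambda>v. \<Sum>h\<leftarrow>hs. D h x v)) (at x)"
      by (rule has_derivative_transform_within_open[OF _ S x]) (use hs in auto)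
    then show "iter_dderiv vs f differentiable at x"
      unfolding differentiable_def by blast
  qed
qed

text \<open>Adjoining \<open>f\<close> to the class of all smooth functions keeps it closed under
  differentiation, because the derivatives of the newcomer are already smooth.\<close>

lemma smooth_onI_deriv:
  assumes S: "open S" and D: "\<And>x. x \<in> S \<Longrightarrow> (f has_derivative D x) (at x)"
    and sm: "\<And>v. smooth_on S (\<lambda>x. D x v)"
  shows "smooth_on S f"
proof (rule smooth_on_family[where Fam = "insert f {h. smooth_on S h}"
      and D = "\<lambda>h x. frechet_derivative h (at x)"])
  show "open S" "f \<in> insert f {h. smooth_on S h}" using S by auto
  fix h assume h: "h \<in> insert f {h. smooth_on S h}"
  show "(h has_derivative frechet_derivative h (at x)) (at x)" if x: "x \<in> S" for x
    using h D[OF x] smooth_on_has_derivative[OF _ x] frechet_derivative_at by fastforce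
  fix v
  show "\<exists>hs. set hs \<subseteq> insert f {h. smooth_on S h} \<and>
      (\<forall>x\<in>S. frechet_derivative h (at x) v = (\<Sum>k\<leftarrow>hs. k x))"
  proof (cases "smooth_on S h")
    case True
    show ?thesis
      by (rule exI[of _ "[\<lambda>x. frechet_derivative h (at x) v]"])
        (use smooth_on_dderiv[OF True] in auto)
  next
    case False
    then have "h = f" using h by auto
    show ?thesis
      by (rule exI[of _ "[\<lambda>x. D x v]"])
        (use \<open>h = f\<close> sm D frechet_derivative_at in fastforce)
  qed
qed

lemma smooth_on_cong:
  assumes S: "open S" and f: "smooth_on S f" and eq: "\<And>x. x \<in> S \<Longrightarrow> f x = g x"
  shows "smooth_on S g"
proof (rule smooth_onI_deriv[OF S])
  show "(g has_derivative frechet_derivative f (at x)) (at x)" if "x \<in> S" for x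
    by (rule has_derivative_transform_within_open[OF smooth_on_has_derivative[OF f that] S that]) (rule eq)
qed (rule smooth_on_dderiv[OF f])

section \<open>Closure properties of smooth functions\<close>

lemma smooth_on_const [intro, simp]: "open S \<Longrightarrow> smooth_on S (\<lambda>x. c)"
  by (rule smooth_on_family[where Fam = "{\<lambda>x. c, \<lambda>x. 0}" and D = "\<lambda>_ _ _. 0"])
    (auto intro!: exI[of _ "[]"])

lemma smooth_on_bounded_linear:
  assumes "open S" "bounded_linear f" shows "smooth_on S f"
  by (rule smooth_onI_deriv[where D = "\<lambda>_. f"])
    (use assms in \<open>auto simp: bounded_linear_imp_has_derivative\<close>)

lemma smooth_on_linear_image:
  assumes S: "open S" and L: "bounded_linear L" and f: "smooth_on S f"
  shows "smooth_on S (\<lambda>x. L (f x))"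
proof (rule smooth_on_family[where Fam = "{\<lambda>x. L (h x) | h. smooth_on S h}"
      and D = "\<lambda>k x. frechet_derivative k (at x)"])
  fix k assume "k \<in> {\<lambda>x. L (h x) | h. smooth_on S h}"
  then obtain h where k: "k = (\<lambda>x. L (h x))" and h: "smooth_on S h" by blast
  have D: "(k has_derivative (\<lambda>v. L (frechet_derivative h (at x) v))) (at x)" if "x \<in> S" for x
    unfolding k by (rule bounded_linear.has_derivative[OF L smooth_on_has_derivative[OF h that]])
  show "(k has_derivative frechet_derivative k (at x)) (at x)" if "x \<in> S" for x
    using D[OF that] frechet_derivative_at by fastforce
  fix v
  show "\<exists>hs. set hs \<subseteq> {\<lambda>x. L (h x) | h. smooth_on S h} \<and>
      (\<forall>x\<in>S. frechet_derivative k (at x) v = (\<Sum>k\<leftarrow>hs. k x))"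
    by (rule exI[of _ "[\<lambda>x. L (frechet_derivative h (at x) v)]"])
      (use smooth_on_dderiv[OF h, of v] frechet_derivative_eq[OF D] in auto)
qed (use S f in auto)

lemma smooth_on_add:
  assumes S: "open S" and f: "smooth_on S f" and g: "smooth_on S g"
  shows "smooth_on S (\<lambda>x. f x + g x)"
proof (rule smooth_on_family[where Fam = "{\<lambda>x. f x + g x | f g. smooth_on S f \<and> smooth_on S g}"
      and D = "\<lambda>k x. frechet_derivative k (at x)"])
  fix k assume "k \<in> {\<lambda>x. f x + g x | f g. smooth_on S f \<and> smooth_on S g}"
  then obtain f g where k: "k = (\<lambda>x. f x + g x)" and h: "smooth_on S f" "smooth_on S g" by blast
  have D: "(k has_derivative (\<lambda>v. frechet_derivative f (at x) v + frechet_derivative g (at x) v)) (at x)"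
    if "x \<in> S" for x
    unfolding k by (intro has_derivative_add smooth_on_has_derivative[OF _ that] h)
  show "(k has_derivative frechet_derivative k (at x)) (at x)" if "x \<in> S" for x
    using D[OF that] frechet_derivative_at by fastforce
  fix v
  show "\<exists>hs. set hs \<subseteq> {\<lambda>x. f x + g x | f g. smooth_on S f \<and> smooth_on S g} \<and>
      (\<forall>x\<in>S. frechet_derivative k (at x) v = (\<Sum>k\<leftarrow>hs. k x))"
    by (rule exI[of _ "[\<lambda>x. frechet_derivative f (at x) v + frechet_derivative g (at x) v]"])
      (use smooth_on_dderiv[OF h(1), of v] smooth_on_dderiv[OF h(2), of v] frechet_derivative_eq[OF D] in auto)
qed (use S f g in auto)

lemma smooth_on_uminus: "open S \<Longrightarrow> smooth_on S f \<Longrightarrow> smooth_on S (\<lambda>x. - f x)"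
  by (rule smooth_on_linear_image[where L = uminus]) (auto intro: bounded_linear_minus bounded_linear_ident)

lemma smooth_on_diff:
  "open S \<Longrightarrow> smooth_on S f \<Longrightarrow> smooth_on S g \<Longrightarrow> smooth_on S (\<lambda>x. f x - g x)"
  using smooth_on_add[OF _ _ smooth_on_uminus, of S f g] by simp

lemma smooth_on_sum:
  assumes "open S" and "\<And>i. i \<in> I \<Longrightarrow> smooth_on S (f i)"
  shows "smooth_on S (\<lambda>x. \<Sum>i\<in>I. f i x)"
  using assms(2) by (induction I rule: infinite_finite_induct) (auto intro!: smooth_on_add assms(1))

text \<open>The Leibniz rule turns one product into two products; this is why
  \<open>smooth_on_family\<close> admits finite sums of members.\<close>

lemma smooth_on_bilinear:
  assumes S: "open S" and B: "bounded_bilinear B" and f: "smooth_on S f" and g: "smooth_on S g"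
  shows "smooth_on S (\<lambda>x. B (f x) (g x))"
proof (rule smooth_on_family[where Fam = "{\<lambda>x. B (f x) (g x) | f g. smooth_on S f \<and> smooth_on S g}"
      and D = "\<lambda>k x. frechet_derivative k (at x)"])
  fix k assume "k \<in> {\<lambda>x. B (f x) (g x) | f g. smooth_on S f \<and> smooth_on S g}"
  then obtain f g where k: "k = (\<lambda>x. B (f x) (g x))" and h: "smooth_on S f" "smooth_on S g" by blast
  have D: "(k has_derivative (\<lambda>v. B (f x) (frechet_derivative g (at x) v) + B (frechet_derivative f (at x) v) (g x))) (at x)"
    if "x \<in> S" for x
    unfolding k by (intro bounded_bilinear.FDERIV[OF B] smooth_on_has_derivative[OF _ that] h)
  show "(k has_derivative frechet_derivative k (at x)) (at x)" if "x \<in> S" for x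
    using D[OF that] frechet_derivative_at by fastforce
  fix v
  show "\<exists>hs. set hs \<subseteq> {\<lambda>x. B (f x) (g x) | f g. smooth_on S f \<and> smooth_on S g} \<and>
      (\<forall>x\<in>S. frechet_derivative k (at x) v = (\<Sum>k\<leftarrow>hs. k x))"
    by (rule exI[of _ "[\<lambda>x. B (f x) (frechet_derivative g (at x) v), \<lambda>x. B (frechet_derivative f (at x) v) (g x)]"])
      (use smooth_on_dderiv[OF h(1), of v] smooth_on_dderiv[OF h(2), of v] h frechet_derivative_eq[OF D] in auto)
qed (use S f g in auto)

lemma bounded_bilinear_matrix_vector_mult:
  "bounded_bilinear (\<lambda>(A :: real^'n^'m) (x :: real^'n). A *v x)"
  by (rule iffD1[OF bilinear_conv_bounded_bilinear])
    (auto simp: bilinear_def linear_iff matrix_vector_mult_add_rdistrib matrix_vector_right_distrib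
      scaleR_matrix_vector_assoc matrix_vector_mult_scaleR)

lemmas smooth_on_mult = smooth_on_bilinear[OF _ bounded_bilinear_mult]
lemmas smooth_on_scaleR = smooth_on_bilinear[OF _ bounded_bilinear_scaleR]
lemmas smooth_on_inner = smooth_on_bilinear[OF _ bounded_bilinear_inner]
lemmas smooth_on_matrix_vector_mult = smooth_on_bilinear[OF _ bounded_bilinear_matrix_vector_mult]

lemma smooth_on_vec_nth: "open S \<Longrightarrow> smooth_on S f \<Longrightarrow> smooth_on S (\<lambda>x. f x $ i)"
  by (rule smooth_on_linear_image[OF _ bounded_linear_vec_nth])

lemma smooth_on_vec:
  fixes f :: "'a::real_normed_vector \<Rightarrow> 'b::real_normed_vector ^ 'n"
  assumes S: "open S" and f: "\<And>i. smooth_on S (\<lambda>x. f x $ i)"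
  shows "smooth_on S f"
proof -
  have L: "bounded_linear (\<lambda>c :: 'b. axis i c :: 'b ^ 'n)" for i
  proof (rule bounded_linear_intro[where K = 1])
    show "norm (axis i c :: 'b ^ 'n) \<le> norm c * 1" for c :: 'b
      by (simp add: norm_vec_def L2_set_def axis_def if_distrib[of norm] if_distrib[of "\<lambda>x. x\<^sup>2"] sum.delta
        cong: if_cong)
  qed (auto simp: axis_def vec_eq_iff)
  have "f = (\<lambda>x. \<Sum>i\<in>UNIV. axis i (f x $ i))"
    by (simp add: fun_eq_iff vec_eq_iff axis_def sum.delta)
  then show ?thesis
    using smooth_on_sum[OF S, of UNIV "\<lambda>i x. axis i (f x $ i)"] smooth_on_linear_image[OF S L f] by simp
qed

lemma frechet_derivative_euclidean:
  fixes f :: "'a::euclidean_space \<Rightarrow> 'b::real_normed_vector"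
  assumes "f differentiable (at x)"
  shows "frechet_derivative f (at x) v = (\<Sum>e\<in>Basis. (v \<bullet> e) *\<^sub>R frechet_derivative f (at x) e)"
proof -
  interpret linear "frechet_derivative f (at x)"
    by (rule linear_frechet_derivative[OF assms])
  have "frechet_derivative f (at x) v = frechet_derivative f (at x) (\<Sum>e\<in>Basis. (v \<bullet> e) *\<^sub>R e)"
    by (simp add: euclidean_representation)
  then show ?thesis by (simp add: sum scale)
qed

text \<open>The chain rule multiplies a derivative of \<open>f\<close>, taken at \<open>u x\<close>,
  by components of the derivative of \<open>u\<close>. The family therefore carries a smooth scalar
  factor, and expanding along the basis keeps it closed.\<close>

lemma smooth_on_compose:
  fixes f :: "'b::euclidean_space \<Rightarrow> 'c::real_normed_vector" and u :: "'a::real_normed_vector \<Rightarrow> 'b"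
  assumes S: "open S" and f: "smooth_on T f" and u: "smooth_on S u" and uT: "u ` S \<subseteq> T"
  shows "smooth_on S (\<lambda>x. f (u x))"
proof (rule smooth_on_family[where Fam = "{\<lambda>x. (h x :: real) *\<^sub>R f (u x) | h f. smooth_on S h \<and> smooth_on T f}"
      and D = "\<lambda>k x. frechet_derivative k (at x)"])
  show "(\<lambda>x. f (u x)) \<in> {\<lambda>x. (h x :: real) *\<^sub>R f (u x) | h f. smooth_on S h \<and> smooth_on T f}"
    by (rule CollectI, rule exI[of _ "\<lambda>x. 1"]) (use S f in auto)
  fix k assume "k \<in> {\<lambda>x. (h x :: real) *\<^sub>R f (u x) | h f. smooth_on S h \<and> smooth_on T f}"
  then obtain h f where k: "k = (\<lambda>x. (h x :: real) *\<^sub>R f (u x))" and h: "smooth_on S h" and f: "smooth_on T f"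
    by blast
  have D: "(k has_derivative (\<lambda>v. h x *\<^sub>R frechet_derivative f (at (u x)) (frechet_derivative u (at x) v)
      + frechet_derivative h (at x) v *\<^sub>R f (u x))) (at x)" if x: "x \<in> S" for x
  proof -
    have ux: "u x \<in> T" using uT x by auto
    have "((f \<circ> u) has_derivative (frechet_derivative f (at (u x)) \<circ> frechet_derivative u (at x))) (at x)"
      by (rule diff_chain_at[OF smooth_on_has_derivative[OF u x] smooth_on_has_derivative[OF f ux]])
    then have "((\<lambda>x. f (u x)) has_derivative (\<lambda>v. frechet_derivative f (at (u x)) (frechet_derivative u (at x) v))) (at x)"
      by (simp add: o_def)
    then show ?thesis unfolding k
      by (rule has_derivative_scaleR[OF smooth_on_has_derivative[OF h x]])
  qed
  show "(k has_derivative frechet_derivative k (at x)) (at x)" if "x \<in> S" for x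
    using D[OF that] frechet_derivative_at by fastforce
  fix v
  obtain es :: "'b list" where es: "set es = Basis" "distinct es"
    using finite_distinct_list[OF finite_Basis] by auto
  let ?hs = "(\<lambda>x. frechet_derivative h (at x) v *\<^sub>R f (u x)) #
     map (\<lambda>e x. (h x * (frechet_derivative u (at x) v \<bullet> e)) *\<^sub>R frechet_derivative f (at (u x)) e) es"
  have "frechet_derivative k (at x) v = (\<Sum>k\<leftarrow>?hs. k x)" if x: "x \<in> S" for x
  proof -
    have ux: "f differentiable (at (u x))" using uT x smooth_on_differentiable[OF f] by auto
    have "(\<Sum>k\<leftarrow>?hs. k x) = frechet_derivative h (at x) v *\<^sub>R f (u x) +
       (\<Sum>e\<in>Basis. (h x * (frechet_derivative u (at x) v \<bullet> e)) *\<^sub>R frechet_derivative f (at (u x)) e)"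
      using es by (simp add: o_def sum_list_distinct_conv_sum_set)
    also have "\<dots> = frechet_derivative h (at x) v *\<^sub>R f (u x) +
       h x *\<^sub>R frechet_derivative f (at (u x)) (frechet_derivative u (at x) v)"
      by (simp add: frechet_derivative_euclidean[OF ux, of "frechet_derivative u (at x) v"] scaleR_sum_right)
    finally show ?thesis using frechet_derivative_eq[OF D[OF x]] by simp
  qed
  moreover have "set ?hs \<subseteq> {\<lambda>x. (h x :: real) *\<^sub>R f (u x) | h f. smooth_on S h \<and> smooth_on T f}"
  proof -
    have "(\<lambda>x. (h x * (frechet_derivative u (at x) v \<bullet> e)) *\<^sub>R frechet_derivative f (at (u x)) e)
       \<in> {\<lambda>x. (h x :: real) *\<^sub>R f (u x) | h f. smooth_on S h \<and> smooth_on T f}" for e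
      by (rule CollectI, rule exI[of _ "\<lambda>x. h x * (frechet_derivative u (at x) v \<bullet> e)"],
          rule exI[of _ "\<lambda>y. frechet_derivative f (at y) e"])
        (intro conjI refl smooth_on_mult smooth_on_inner smooth_on_dderiv S f h u smooth_on_const)
    moreover have "(\<lambda>x. frechet_derivative h (at x) v *\<^sub>R f (u x))
       \<in> {\<lambda>x. (h x :: real) *\<^sub>R f (u x) | h f. smooth_on S h \<and> smooth_on T f}"
      by (rule CollectI, rule exI[of _ "\<lambda>x. frechet_derivative h (at x) v"], rule exI[of _ f])
        (intro conjI refl smooth_on_dderiv h f)
    ultimately show ?thesis by auto
  qed
  ultimately show "\<exists>hs. set hs \<subseteq> {\<lambda>x. (h x :: real) *\<^sub>R f (u x) | h f. smooth_on S h \<and> smooth_on T f} \<and>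
      (\<forall>x\<in>S. frechet_derivative k (at x) v = (\<Sum>k\<leftarrow>hs. k x))"
    by blast
qed (rule S)

text \<open>The derivative of \<open>h / f^n\<close> is \<open>h' / f^n - n h f' / f^(n+1)\<close>,
  so the quotients by all powers of \<open>f\<close> form a closed family while the reciprocal alone
  does not.\<close>

lemma smooth_on_inverse:
  fixes f :: "'a::real_normed_vector \<Rightarrow> real"
  assumes S: "open S" and f: "smooth_on S f" and nz: "\<And>x. x \<in> S \<Longrightarrow> f x \<noteq> 0"
  shows "smooth_on S (\<lambda>x. inverse (f x))"
proof (rule smooth_on_family[where Fam = "{\<lambda>x. h x * inverse (f x) ^ n | h n. smooth_on S h}"
      and D = "\<lambda>k x. frechet_derivative k (at x)"])
  show "(\<lambda>x. inverse (f x)) \<in> {\<lambda>x. h x * inverse (f x) ^ n | h n. smooth_on S h}"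
    by (rule CollectI, rule exI[of _ "\<lambda>x. 1"], rule exI[of _ 1]) (use S in auto)
  fix k assume "k \<in> {\<lambda>x. h x * inverse (f x) ^ n | h n. smooth_on S h}"
  then obtain h n where k: "k = (\<lambda>x. h x * inverse (f x) ^ n)" and h: "smooth_on S h" by blast
  have D: "(k has_derivative (\<lambda>v. frechet_derivative h (at x) v * inverse (f x) ^ n
      + (- real n * h x * frechet_derivative f (at x) v) * inverse (f x) ^ Suc n)) (at x)" if x: "x \<in> S" for x
    unfolding k
    by (rule derivative_eq_intros smooth_on_has_derivative[OF h x] smooth_on_has_derivative[OF f x] nz[OF x] refl)+
      (cases n; auto simp: algebra_simps fun_eq_iff)
  show "(k has_derivative frechet_derivative k (at x)) (at x)" if "x \<in> S" for x
    using D[OF that] frechet_derivative_at by fastforce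
  fix v
  let ?hs = "[\<lambda>x. frechet_derivative h (at x) v * inverse (f x) ^ n,
     \<lambda>x. (- real n * h x * frechet_derivative f (at x) v) * inverse (f x) ^ Suc n]"
  have "smooth_on S (\<lambda>x. - real n * h x * frechet_derivative f (at x) v)"
    by (intro smooth_on_mult smooth_on_dderiv S h f smooth_on_const)
  moreover have "(\<lambda>x. k x * inverse (f x) ^ m) \<in> {\<lambda>x. h x * inverse (f x) ^ n | h n. smooth_on S h}"
    if "smooth_on S k" for k m using that by blast
  ultimately have "set ?hs \<subseteq> {\<lambda>x. h x * inverse (f x) ^ n | h n. smooth_on S h}"
    using smooth_on_dderiv[OF h, of v] unfolding list.set by (intro insert_subsetI empty_subsetI) blast+
  then show "\<exists>hs. set hs \<subseteq> {\<lambda>x. h x * inverse (f x) ^ n | h n. smooth_on S h} \<and>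
      (\<forall>x\<in>S. frechet_derivative k (at x) v = (\<Sum>k\<leftarrow>hs. k x))"
    by (rule_tac exI[of _ ?hs]) (use frechet_derivative_eq[OF D] in auto)
qed (rule S)

section \<open>Test functions and integration on the plane\<close>

definition flat_exp :: "real \<Rightarrow> real" where
  "flat_exp x = (if x > 0 then exp (- inverse x) else 0)"

text \<open>From \<open>t \<le> exp t\<close> at \<open>t = 1 / (n x)\<close>, raised to the power
  \<open>n = k + 2\<close>. The two powers beyond \<open>k\<close> leave the factor
  \<open>x\<^sup>2\<close>, which is what differentiability at 0 requires.\<close>

lemma inverse_power_exp_bound:
  assumes x: "(x::real) > 0"
  shows "inverse x ^ k * exp (- inverse x) \<le> real (k + 2) ^ (k + 2) * x\<^sup>2"
proof -
  define n where "n = k + 2"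
  have n: "n > 0" by (simp add: n_def)
  have "(inverse x / n) ^ n \<le> exp (inverse x / n) ^ n"
  proof (rule power_mono)
    show "inverse x / n \<le> exp (inverse x / n)" using exp_ge_add_one_self[of "inverse x / n"] by linarith
    show "0 \<le> inverse x / n" using x by simp
  qed
  also have "\<dots> = exp (inverse x)"
    using n by (simp flip: exp_of_nat_mult)
  finally have "exp (- inverse x) \<le> inverse ((inverse x / n) ^ n)"
    using x n by (simp add: exp_minus le_imp_inverse_le)
  then have "inverse x ^ k * exp (- inverse x) \<le> inverse x ^ k * inverse ((inverse x / n) ^ n)"
    using x by (intro mult_left_mono) auto
  also have "\<dots> = real n ^ n * x\<^sup>2"
  proof -
    have "inverse ((inverse x / n) ^ n) = real n ^ n * x ^ n"
      using x n by (simp add: power_divide power_inverse power_mult_distrib divide_inverse)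
    moreover have "x ^ n = x ^ k * x\<^sup>2" by (simp add: n_def power_add power2_eq_square)
    ultimately show ?thesis using x by (simp add: power_inverse)
  qed
  finally show ?thesis by (simp add: n_def)
qed

lemma smooth_on_flat_exp: "smooth_on UNIV flat_exp"
proof (rule smooth_on_family[where
      Fam = "{\<lambda>x. if x > 0 then c * inverse x ^ k * exp (- inverse x) else 0 | c k. True}"
      and D = "\<lambda>k x. frechet_derivative k (at x)"])
  show "flat_exp \<in> {\<lambda>x. if x > 0 then c * inverse x ^ k * exp (- inverse x) else 0 | c k. True}"
    by (rule CollectI, rule exI[of _ 1], rule exI[of _ 0]) (auto simp: flat_exp_def)
  fix h assume "h \<in> {\<lambda>x. if (x::real) > 0 then c * inverse x ^ k * exp (- inverse x) else 0 | c k. True}"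
  then obtain c k where h: "h = (\<lambda>x. if (x::real) > 0 then c * inverse x ^ k * exp (- inverse x) else 0)"
    by blast
  define d where "d x = (if x > 0 then (- real k * c) * inverse x ^ (k + 1) * exp (- inverse x) else 0)
     + (if x > 0 then c * inverse x ^ (k + 2) * exp (- inverse x) else 0)" for x :: real
  have D: "(h has_real_derivative d x) (at x)" for x
  proof -
    consider "x > 0" | "x < 0" | "x = 0" by linarith
    then show ?thesis
    proof cases
      case 1
      have "((\<lambda>x. inverse x ^ k) has_real_derivative - real k * inverse x ^ (k + 1)) (at x)"
        using 1 power_eq_if[of "inverse x" k]
        by (auto intro!: derivative_eq_intros simp: algebra_simps split: if_splits)
      then have "((\<lambda>x. c * inverse x ^ k * exp (- inverse x)) has_real_derivative d x) (at x)"
        unfolding d_def using 1 power_eq_if[of "inverse x" k]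
        by (auto intro!: derivative_eq_intros simp: algebra_simps split: if_splits)
      then show ?thesis unfolding h
        by (rule has_field_derivative_transform_within_open[where S = "{0<..}"]) (use 1 in auto)
    next
      case 2
      have "((\<lambda>x. 0) has_real_derivative d x) (at x)"
        unfolding d_def using 2 by simp
      then show ?thesis unfolding h
        by (rule has_field_derivative_transform_within_open[where S = "{..<0}"]) (use 2 in auto)
    next
      case 3
      \<comment> \<open>The quadratic bound makes the difference quotient at 0 of order
        \<open>y\<close>, hence the derivative there is 0, in agreement with
        \<open>d\<close>.\<close>
      define C where "C = \<bar>c\<bar> * real (k + 2) ^ (k + 2)"
      have bd: "\<bar>h y\<bar> \<le> C * y\<^sup>2" for y
        using inverse_power_exp_bound[of y k] mult_left_mono[of _ _ "\<bar>c\<bar>"]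
        by (fastforce simp: h C_def abs_mult mult.assoc)
      have "\<bar>h y / y\<bar> \<le> C * \<bar>y\<bar>" for y
      proof (cases "y = 0")
        case False
        have "\<bar>h y / y\<bar> = \<bar>h y\<bar> / \<bar>y\<bar>" by (simp add: abs_divide)
        also have "\<dots> \<le> C * y\<^sup>2 / \<bar>y\<bar>" by (intro divide_right_mono bd) auto
        also have "\<dots> = C * \<bar>y\<bar>" using False by (simp add: power2_eq_square field_simps abs_if)
        finally show ?thesis .
      qed simp
      moreover have "((\<lambda>y. C * \<bar>y\<bar>) \<longlongrightarrow> 0) (at 0)"
        by (auto intro!: tendsto_eq_intros)
      ultimately have "((\<lambda>y. h y / y) \<longlongrightarrow> 0) (at 0)"
        by (intro Lim_null_comparison[of "\<lambda>y. h y / y" "\<lambda>y. C * \<bar>y\<bar>"]) auto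
      then have "(h has_real_derivative 0) (at 0)"
        unfolding has_field_derivative_iff by (simp add: h)
      then show ?thesis using 3 by (simp add: d_def)
    qed
  qed
  then have D': "(h has_derivative (\<lambda>v. d x * v)) (at x)" for x
    by (simp add: has_field_derivative_def)
  show "(h has_derivative frechet_derivative h (at x)) (at x)" for x
    using D'[of x] frechet_derivative_at by fastforce
  fix v
  show "\<exists>hs. set hs \<subseteq> {\<lambda>x. if x > 0 then c * inverse x ^ k * exp (- inverse x) else 0 | c k. True} \<and>
      (\<forall>x\<in>UNIV. frechet_derivative h (at x) v = (\<Sum>k\<leftarrow>hs. k x))"
  proof (intro exI conjI ballI)
    let ?hs = "[\<lambda>x. if x > 0 then (- real k * c * v) * inverse x ^ (k + 1) * exp (- inverse x) else 0,
      \<lambda>x. if x > 0 then (c * v) * inverse x ^ (k + 2) * exp (- inverse x) else 0]"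
    show "set ?hs \<subseteq> {\<lambda>x. if x > 0 then c * inverse x ^ k * exp (- inverse x) else 0 | c k. True}"
      unfolding list.set by (intro insert_subsetI empty_subsetI) blast+
    show "frechet_derivative h (at x) v = (\<Sum>k\<leftarrow>?hs. k x)" for x
      by (simp add: frechet_derivative_eq[OF D'] d_def algebra_simps)
  qed
qed simp

lemma ex_plateau:
  fixes p0 :: "'a::euclidean_space"
  assumes r: "r > 0"
  obtains z :: "'a \<Rightarrow> real" where "smooth_on UNIV z" "\<And>p. 0 \<le> z p" "\<And>p. z p \<le> 1"
    "\<And>p. dist p p0 \<le> r \<Longrightarrow> z p = 1" "\<And>p. dist p p0 \<ge> 2 * r \<Longrightarrow> z p = 0"
proof -
  define e where "e x = flat_exp x + flat_exp (1 - x)" for x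
  define s where "s x = flat_exp x * inverse (e x)" for x
  have fe: "flat_exp x \<ge> 0" for x by (simp add: flat_exp_def)
  have e: "e x > 0" for x by (auto simp: e_def flat_exp_def add_pos_nonneg)
  have "smooth_on UNIV (\<lambda>x::real. 1 - x)"
    by (intro smooth_on_diff smooth_on_const smooth_on_bounded_linear bounded_linear_ident) auto
  then have "smooth_on UNIV (\<lambda>x. flat_exp (1 - x))"
    by (intro smooth_on_compose[OF _ smooth_on_flat_exp]) auto
  then have se: "smooth_on UNIV e"
    unfolding e_def[abs_def] by (intro smooth_on_add smooth_on_flat_exp) auto
  have ss: "smooth_on UNIV s"
    unfolding s_def[abs_def] using e
    by (intro smooth_on_mult smooth_on_inverse se smooth_on_flat_exp) (auto simp: less_imp_neq[symmetric])
  \<comment> \<open>The squared distance is used because the distance itself is not smooth at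
    \<open>p0\<close>. The value is at least 1 up to distance \<open>r\<close> and at most 0 from
    \<open>sqrt 2 * r\<close> onwards, in particular from \<open>2 * r\<close> onwards.\<close>
  define m where "m p = 2 - ((p - p0) \<bullet> (p - p0)) * inverse (r\<^sup>2)" for p
  have "smooth_on UNIV (\<lambda>p. p - p0)"
    by (intro smooth_on_diff smooth_on_const smooth_on_bounded_linear bounded_linear_ident) auto
  then have sm: "smooth_on UNIV m"
    unfolding m_def[abs_def]
    by (intro smooth_on_diff[where f = "\<lambda>p. 2"] smooth_on_mult smooth_on_inner smooth_on_const) (auto simp del: dist_norm)
  have m: "m p = 2 - (dist p p0 / r)\<^sup>2" for p
    by (simp add: m_def dist_norm power2_norm_eq_inner power_divide divide_inverse power_mult_distrib power_inverse)
  have s0: "s x = 0" if "x \<le> 0" for x using that by (simp add: s_def flat_exp_def)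
  have s1: "s x = 1" if "x \<ge> 1" for x
  proof -
    have "flat_exp (1 - x) = 0" using that by (simp add: flat_exp_def)
    moreover have "flat_exp x \<noteq> 0" using that by (simp add: flat_exp_def)
    ultimately show ?thesis by (simp add: s_def e_def)
  qed
  have s01: "0 \<le> s x \<and> s x \<le> 1" for x
    using e[of x] fe[of x] fe[of "1 - x"] by (simp add: s_def e_def flip: divide_inverse)
  show ?thesis
  proof (rule that[of "\<lambda>p. s (m p)"])
    show "smooth_on UNIV (\<lambda>p. s (m p))" by (rule smooth_on_compose[OF _ ss sm]) auto
    show "s (m p) = 1" if "dist p p0 \<le> r" for p
    proof (rule s1)
      have "(dist p p0 / r)\<^sup>2 \<le> 1\<^sup>2" using that r by (intro power_mono) auto
      then show "1 \<le> m p" by (simp add: m)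
    qed
    show "s (m p) = 0" if "dist p p0 \<ge> 2 * r" for p
    proof (rule s0)
      have "2\<^sup>2 \<le> (dist p p0 / r)\<^sup>2" using that r by (intro power_mono) (auto simp: field_simps)
      then show "m p \<le> 0" by (simp add: m)
    qed
  qed (use s01 in auto)
qed

text \<open>Throughout, the index \<open>False\<close> stands for \<open>x\<close> and \<open>True\<close> for \<open>y\<close>.\<close>
definition dir :: "bool \<Rightarrow> plane" where "dir \<alpha> = (if \<alpha> then (0, 1) else (1, 0))"

section \<open>Partial derivatives in the plane\<close>

definition pd :: "bool \<Rightarrow> (plane \<Rightarrow> 'b::real_normed_vector) \<Rightarrow> plane \<Rightarrow> 'b" where
  "pd \<alpha> f p = frechet_derivative f (at p) (dir \<alpha>)"

lemma pd_eq: "(f has_derivative D) (at p) \<Longrightarrow> pd \<alpha> f p = D (dir \<alpha>)"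
  by (simp add: pd_def frechet_derivative_eq)

lemma smooth_on_pd: "smooth_on S f \<Longrightarrow> smooth_on S (pd \<alpha> f)"
  unfolding pd_def by (rule smooth_on_dderiv)

lemma frechet_derivative_pd:
  assumes "f differentiable at p"
  shows "frechet_derivative f (at p) (s, t) = s *\<^sub>R pd False f p + t *\<^sub>R pd True f p"
proof -
  have "(s, t) = s *\<^sub>R (1, 0) + t *\<^sub>R (0, 1)" by simp
  then show ?thesis
    by (simp only: linear_add[OF linear_frechet_derivative[OF assms]]
        linear_scale[OF linear_frechet_derivative[OF assms]] pd_def dir_def if_True if_False)
qed

lemma has_vector_derivative_pd_False:
  assumes "f differentiable at (x, y)"
  shows "((\<lambda>t. f (t, y)) has_vector_derivative pd False f (x, y)) (at x)"
proof -
  have "((\<lambda>t. (t, y)) has_derivative (\<lambda>t. (t, 0))) (at x)"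
    by (auto intro!: derivative_eq_intros)
  from diff_chain_at[OF this iffD1[OF frechet_derivative_works assms]]
  show ?thesis by (simp add: o_def frechet_derivative_pd[OF assms] has_vector_derivative_def)
qed

lemma has_vector_derivative_pd_True:
  assumes "f differentiable at (x, y)"
  shows "((\<lambda>t. f (x, t)) has_vector_derivative pd True f (x, y)) (at y)"
proof -
  have "((\<lambda>t. (x, t)) has_derivative (\<lambda>t. (0, t))) (at y)"
    by (auto intro!: derivative_eq_intros)
  from diff_chain_at[OF this iffD1[OF frechet_derivative_works assms]]
  show ?thesis by (simp add: o_def frechet_derivative_pd[OF assms] has_vector_derivative_def)
qed

lemma pdx_eq_pd: "f differentiable at p \<Longrightarrow> pdx f p = pd False f p"
  unfolding pdx_def by (rule vector_derivative_at) (use has_vector_derivative_pd_False[of f "fst p" "snd p"] in simp)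

lemma pdy_eq_pd: "f differentiable at p \<Longrightarrow> pdy f p = pd True f p"
  unfolding pdy_def by (rule vector_derivative_at) (use has_vector_derivative_pd_True[of f "fst p" "snd p"] in simp)

lemma pd_cong_open:
  assumes "open W" "p \<in> W" "\<And>q. q \<in> W \<Longrightarrow> f q = g q"
  shows "pd \<alpha> f p = pd \<alpha> g p"
proof -
  have "(f has_derivative D) (at p) \<longleftrightarrow> (g has_derivative D) (at p)" for D
  proof
    show "(g has_derivative D) (at p)" if "(f has_derivative D) (at p)"
      by (rule has_derivative_transform_within_open[OF that assms])
    show "(f has_derivative D) (at p)" if "(g has_derivative D) (at p)"
      by (rule has_derivative_transform_within_open[OF that assms(1,2)]) (simp add: assms(3))
  qed
  then show ?thesis by (simp add: pd_def frechet_derivative_def)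
qed

lemma pd_const [simp]: "pd \<alpha> (\<lambda>p. c) p = 0"
  by (simp add: pd_def)

lemma pd_has_derivative:
  "f differentiable at p \<Longrightarrow> (f has_derivative frechet_derivative f (at p)) (at p)"
  by (simp add: frechet_derivative_works)

lemma pd_add: "f differentiable at p \<Longrightarrow> g differentiable at p \<Longrightarrow> pd \<alpha> (\<lambda>p. f p + g p) p = pd \<alpha> f p + pd \<alpha> g p"
  using pd_eq[OF has_derivative_add[OF pd_has_derivative pd_has_derivative], of f p g \<alpha>]
  by (simp add: pd_def)

lemma pd_diff: "f differentiable at p \<Longrightarrow> g differentiable at p \<Longrightarrow> pd \<alpha> (\<lambda>p. f p - g p) p = pd \<alpha> f p - pd \<alpha> g p"
  using pd_eq[OF has_derivative_diff[OF pd_has_derivative pd_has_derivative], of f p g \<alpha>]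
  by (simp add: pd_def)

lemma pd_linear:
  assumes "bounded_linear L" "f differentiable at p"
  shows "pd \<alpha> (\<lambda>p. L (f p)) p = L (pd \<alpha> f p)"
  using pd_eq[OF bounded_linear.has_derivative[OF assms(1) pd_has_derivative[OF assms(2)]]]
  by (simp add: pd_def)

lemma pd_sum:
  assumes "\<And>i. i \<in> I \<Longrightarrow> f i differentiable at p"
  shows "pd \<alpha> (\<lambda>p. \<Sum>i\<in>I. f i p) p = (\<Sum>i\<in>I. pd \<alpha> (f i) p)"
proof -
  have "((\<lambda>p. \<Sum>i\<in>I. f i p) has_derivative (\<lambda>v. \<Sum>i\<in>I. frechet_derivative (f i) (at p) v)) (at p)"
    by (intro has_derivative_sum pd_has_derivative assms)
  from pd_eq[OF this] show ?thesis by (simp add: pd_def)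
qed

lemma pd_bilinear:
  assumes "bounded_bilinear B" "f differentiable at p" "g differentiable at p"
  shows "pd \<alpha> (\<lambda>p. B (f p) (g p)) p = B (f p) (pd \<alpha> g p) + B (pd \<alpha> f p) (g p)"
  using pd_eq[OF bounded_bilinear.FDERIV[OF assms(1) pd_has_derivative pd_has_derivative], of f p g \<alpha>] assms
  by (simp add: pd_def)

lemmas pd_mult = pd_bilinear[OF bounded_bilinear_mult]
lemmas pd_scaleR = pd_bilinear[OF bounded_bilinear_scaleR]
lemmas pd_inner = pd_bilinear[OF bounded_bilinear_inner]

lemma pd_compose:
  assumes "f differentiable at (u p)" "u differentiable at p"
  shows "pd \<alpha> (\<lambda>q. f (u q)) p = frechet_derivative f (at (u p)) (pd \<alpha> u p)"
  using pd_eq[OF diff_chain_at[OF pd_has_derivative[OF assms(2)] pd_has_derivative[OF assms(1)]]]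
  by (simp add: o_def pd_def)

section \<open>Compact supports and integration by parts\<close>

lemma compact_supp_box:
  fixes h :: "plane \<Rightarrow> 'b::real_normed_vector"
  assumes "compact_supp h"
  obtains a :: real where "a > 0" "\<And>p. p \<notin> cbox (-a, -a) (a, a) \<Longrightarrow> h p = 0"
proof -
  obtain K where K: "compact K" "\<And>p. p \<notin> K \<Longrightarrow> h p = 0" using assms unfolding compact_supp_def by blast
  obtain r where r: "r > 0" "\<And>p. p \<in> K \<Longrightarrow> norm p \<le> r"
    using compact_imp_bounded[OF K(1)] unfolding bounded_pos by blast
  have "p \<in> cbox (-r, -r) (r, r)" if "p \<in> K" for p
  proof -
    have "\<bar>fst p\<bar> \<le> r" "\<bar>snd p\<bar> \<le> r"
      using r(2)[OF that] norm_fst_le[of "fst p" "snd p"] norm_snd_le[of "snd p" "fst p"] by auto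
    then show ?thesis by (cases p) (auto simp: cbox_Pair_iff abs_le_iff)
  qed
  then show ?thesis using that[OF r(1)] K(2) by blast
qed

lemma compact_supp_subset: "compact_supp f \<Longrightarrow> (\<And>p. f p = 0 \<Longrightarrow> g p = 0) \<Longrightarrow> compact_supp g"
  unfolding compact_supp_def by meson

lemma compact_supp_pd:
  assumes "compact_supp f" shows "compact_supp (pd \<alpha> f)"
proof -
  obtain K where K: "compact K" "\<And>p. p \<notin> K \<Longrightarrow> f p = 0" using assms unfolding compact_supp_def by blast
  have "pd \<alpha> f p = 0" if "p \<notin> K" for p
    using pd_cong_open[of "- K" p f "\<lambda>p. 0" \<alpha>] K that compact_imp_closed by auto
  then show ?thesis unfolding compact_supp_def using K(1) by blast
qed

lemma integral_UNIV_box: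
  fixes f :: "plane \<Rightarrow> 'b::euclidean_space"
  assumes "\<And>p. p \<notin> cbox a b \<Longrightarrow> f p = 0"
  shows "integral UNIV f = integral (cbox a b) f"
proof -
  have "f = (\<lambda>p. if p \<in> cbox a b then f p else 0)" using assms by auto
  then show ?thesis using integral_restrict_UNIV[of "cbox a b" f] by simp
qed

lemma integrable_compact_supp:
  fixes f :: "plane \<Rightarrow> 'b::euclidean_space"
  assumes "continuous_on UNIV f" "compact_supp f"
  shows "f integrable_on UNIV"
proof -
  obtain a where a: "\<And>p. p \<notin> cbox (-a, -a) (a, a) \<Longrightarrow> f p = 0" using compact_supp_box[OF assms(2)] by blast
  have "f integrable_on cbox (-a, -a) (a, a)"
    by (intro integrable_continuous continuous_on_subset[OF assms(1)]) auto
  then show ?thesis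
    by (rule integrable_on_superset) (use a in auto)
qed

lemma integral_pd_zero:
  fixes f :: "plane \<Rightarrow> real"
  assumes sm: "smooth_on UNIV f" and c: "compact_supp f"
  shows "integral UNIV (pd \<alpha> f) = 0"
proof -
  obtain a where a: "a > 0" "\<And>p. p \<notin> cbox (-a, -a) (a, a) \<Longrightarrow> f p = 0" using compact_supp_box[OF c] by blast
  \<comment> \<open>One unit of room: \<open>f0\<close> demands a coordinate strictly beyond
    \<open>a\<close>, and with \<open>b\<close> the boundary terms of the fundamental theorem of
    calculus vanish.\<close>
  define b where "b = a + 1"
  have f0: "f (x, y) = 0" if "\<bar>x\<bar> > a \<or> \<bar>y\<bar> > a" for x y
    by (rule a(2)) (use that in \<open>auto simp: cbox_Pair_iff\<close>)
  have p0: "pd \<alpha> f p = 0" if "p \<notin> cbox (-a, -a) (a, a)" for p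
    using pd_cong_open[of "- cbox (-a, -a) (a, a)" p f "\<lambda>p. 0" \<alpha>] a that by (auto intro: open_Compl)
  have p0': "pd \<alpha> f p = 0" if "p \<notin> cbox (-b, -b) (b, b)" for p
    by (rule p0) (use that in \<open>cases p; auto simp: cbox_Pair_iff b_def\<close>)
  have cont: "continuous_on (cbox (-b, -b) (b, b)) (pd \<alpha> f)"
    by (rule continuous_on_subset[OF smooth_on_continuous[OF smooth_on_pd[OF sm]]]) auto
  have diff: "f differentiable at p" for p
    by (rule smooth_on_differentiable[OF sm]) auto
  have ab: "- b \<le> b" using a b_def by auto
  have "integral (cbox (-b, -b) (b, b)) (pd \<alpha> f) = 0"
  proof (cases \<alpha>)
    case True
    have "integral (cbox (-b) b) (\<lambda>y. pd \<alpha> f (x, y)) = 0" for x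
    proof -
      have "((\<lambda>y. f (x, y)) has_vector_derivative pd \<alpha> f (x, y)) (at y)" for y
        using True has_vector_derivative_pd_True[OF diff] by simp
      then have "((\<lambda>y. pd \<alpha> f (x, y)) has_integral (f (x, b) - f (x, - b))) {-b..b}"
        by (intro fundamental_theorem_of_calculus ab) (auto intro: has_vector_derivative_at_within)
      then show ?thesis using f0[of x b] f0[of x "-b"] a(1) by (simp add: b_def cbox_interval integral_unique)
    qed
    then show ?thesis by (simp add: integral_prod_continuous[OF cont])
  next
    case False
    have "integral (cbox (-b) b) (\<lambda>x. pd \<alpha> f (x, y)) = 0" for y
    proof -
      have "((\<lambda>x. f (x, y)) has_vector_derivative pd \<alpha> f (x, y)) (at x)" for x
        using False has_vector_derivative_pd_False[OF diff] by simp
      then have "((\<lambda>x. pd \<alpha> f (x, y)) has_integral (f (b, y) - f (- b, y))) {-b..b}"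
        by (intro fundamental_theorem_of_calculus ab) (auto intro: has_vector_derivative_at_within)
      then show ?thesis using f0[of b y] f0[of "-b" y] a(1) by (simp add: b_def cbox_interval integral_unique)
    qed
    then show ?thesis
      using integral_swap_continuous[of "-b" "-b" b b "\<lambda>x y. pd \<alpha> f (x, y)"] cont
      by (simp add: integral_prod_continuous[OF cont])
  qed
  then show ?thesis using integral_UNIV_box[OF p0'] by simp
qed

section \<open>Fundamental lemma and uniqueness of variational derivatives\<close>

lemma fundamental_lemma:
  fixes S :: "plane \<Rightarrow> real"
  assumes cont: "continuous_on UNIV S"
    and int: "\<And>f. smooth_on UNIV f \<Longrightarrow> compact_supp f \<Longrightarrow> integral UNIV (\<lambda>p. f p * S p) = 0"
  shows "S p0 = 0"
proof (rule ccontr)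
  assume nz: "S p0 \<noteq> 0"
  have "isCont S p0" using cont by (simp add: continuous_on_eq_continuous_at del: split_paired_All)
  then obtain r where r: "r > 0" "\<And>p. dist p p0 < r \<Longrightarrow> dist (S p) (S p0) < \<bar>S p0\<bar>"
    unfolding continuous_at_eps_delta using nz by (metis zero_less_abs_iff)
  obtain z :: "plane \<Rightarrow> real" where z: "smooth_on UNIV z" "\<And>p. 0 \<le> z p" "\<And>p. z p \<le> 1"
    "\<And>p. dist p p0 \<le> r/2 \<Longrightarrow> z p = 1" "\<And>p. dist p p0 \<ge> 2 * (r/2) \<Longrightarrow> z p = 0"
    using ex_plateau[of "r/2" p0] r(1) by auto
  have cz: "compact_supp z" unfolding compact_supp_def
    by (rule exI[of _ "cball p0 r"]) (use z(5) in \<open>auto simp: dist_commute\<close>)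
  obtain a where a: "a > 0" "\<And>p. p \<notin> cbox (-a, -a) (a, a) \<Longrightarrow> z p = 0" using compact_supp_box[OF cz] by blast
  \<comment> \<open>\<open>S\<close> keeps the sign of \<open>S p0\<close> on the ball where the
    cutoff is nonzero, so the cutoff times that sign is a test function whose product with
    \<open>S\<close> is nonnegative and positive at \<open>p0\<close>.\<close>
  define f where "f p = z p * (sgn (S p0) * S p)" for p
  have pos: "f p \<ge> 0" for p
  proof (cases "dist p p0 < r")
    case True
    then have "sgn (S p0) * S p \<ge> 0" using r(2)[OF True] by (auto simp: dist_real_def sgn_if abs_if split: if_splits)
    then show ?thesis unfolding f_def using z(2) by simp
  qed (use z(5) in \<open>auto simp: f_def\<close>)
  have cf: "continuous_on UNIV f"
    unfolding f_def by (intro continuous_intros smooth_on_continuous z(1) cont)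
  have "compact_supp f" by (rule compact_supp_subset[OF cz]) (simp add: f_def)
  have "integral UNIV f = 0"
    using int[of "\<lambda>p. z p * sgn (S p0)"] z(1) cz
    by (simp add: f_def[abs_def] mult.assoc smooth_on_mult smooth_on_const compact_supp_subset[OF cz])
  then have "integral (cbox (-a, -a) (a, a)) f = 0"
    using integral_UNIV_box[of "(-a,-a)" "(a,a)" f] a(2) by (simp add: f_def)
  moreover have "f integrable_on cbox (-a, -a) (a, a)"
    by (intro integrable_continuous continuous_on_subset[OF cf]) auto
  ultimately have "(f has_integral 0) (cbox (-a, -a) (a, a))"
    by (metis integrable_integral)
  moreover have p0: "p0 \<in> cbox (-a, -a) (a, a)" using a(2)[of p0] z(4)[of p0] r(1) by force
  moreover have "box (-a, -a) (a, a) \<noteq> {}" using a(1) by (auto simp: box_ne_empty Basis_prod_def)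
  ultimately have "f p0 = 0"
    using has_integral_0_cbox_imp_0[of "(-a,-a)" "(a,a)" f p0] pos continuous_on_subset[OF cf] by auto
  then show False using z(4)[of p0] r(1) nz by (simp add: f_def sgn_if split: if_splits)
qed

text \<open>Justifies the definite description in \<open>var_deriv\<close>: two densities are
  compared one component at a time, by test fields pointing along a single axis.\<close>

lemma has_var_deriv_unique:
  assumes 1: "has_var_deriv F u d1" and 2: "has_var_deriv F u (d2 :: plane \<Rightarrow> real^'n)"
  shows "d1 = d2"
proof
  fix p
  show "d1 p = d2 p"
  proof (rule iffD2[OF vec_eq_iff], intro allI)
    fix i
    have c1: "continuous_on UNIV (\<lambda>p. d1 p $ i)" and c2: "continuous_on UNIV (\<lambda>p. d2 p $ i)"
      using 1 2 unfolding has_var_deriv_def by (auto intro!: continuous_intros)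
    have "d1 p $ i - d2 p $ i = 0"
    proof (rule fundamental_lemma[of "\<lambda>p. d1 p $ i - d2 p $ i"])
      show "continuous_on UNIV (\<lambda>p. d1 p $ i - d2 p $ i)" by (intro continuous_intros c1 c2)
      fix f :: "plane \<Rightarrow> real" assume f: "smooth_on UNIV f" "compact_supp f"
      define h where "h p = f p *\<^sub>R (axis i 1 :: real^'n)" for p
      have "smooth_on UNIV h" unfolding h_def[abs_def] by (intro smooth_on_scaleR f smooth_on_const) auto
      moreover have "compact_supp h" by (rule compact_supp_subset[OF f(2)]) (simp add: h_def)
      ultimately have "integral UNIV (\<lambda>p. d1 p \<bullet> h p) = integral UNIV (\<lambda>p. d2 p \<bullet> h p)"
        using 1 2 unfolding has_var_deriv_def by (blast intro: DERIV_unique)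
      moreover have "(\<lambda>p. d1 p $ i * f p) integrable_on UNIV" "(\<lambda>p. d2 p $ i * f p) integrable_on UNIV"
        by (auto intro!: integrable_compact_supp compact_supp_subset[OF f(2)]
            continuous_on_mult[OF c1 smooth_on_continuous[OF f(1)]]
            continuous_on_mult[OF c2 smooth_on_continuous[OF f(1)]])
      ultimately show "integral UNIV (\<lambda>p. f p * (d1 p $ i - d2 p $ i)) = 0"
        by (simp add: h_def inner_axis algebra_simps integral_diff)
    qed
    then show "d1 p $ i = d2 p $ i" by simp
  qed
qed

lemma var_deriv_eq: "has_var_deriv F u d \<Longrightarrow> var_deriv F u = d"
  unfolding var_deriv_def by (rule the_equality) (auto intro: has_var_deriv_unique)

section \<open>The Jacobi identity on linear functionals\<close>

lemma linear_as_inner: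
  assumes "linear (L :: real^'n \<Rightarrow> real)"
  shows "L h = (\<chi> k. L (axis k 1)) \<bullet> h"
proof -
  have "L h = L (\<Sum>k\<in>UNIV. h $ k *\<^sub>R axis k 1)"
    by (simp add: basis_expansion flip: scalar_mult_eq_scaleR)
  also have "\<dots> = (\<Sum>k\<in>UNIV. h $ k * L (axis k 1))"
    by (simp add: linear_sum[OF assms] linear_scale[OF assms])
  finally show ?thesis by (simp add: inner_vec_def mult.commute)
qed

definition grad :: "(real^'n \<Rightarrow> real) \<Rightarrow> real^'n \<Rightarrow> real^'n" where
  "grad f y = (\<chi> k. frechet_derivative f (at y) (axis k 1))"

lemma grad_inner: "f differentiable at y \<Longrightarrow> grad f y \<bullet> h = frechet_derivative f (at y) h"
  unfolding grad_def by (rule linear_as_inner[symmetric, OF linear_frechet_derivative])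

lemma smooth_on_grad: "open S \<Longrightarrow> smooth_on S f \<Longrightarrow> smooth_on S (grad f)"
  by (rule smooth_on_vec) (auto simp: grad_def intro: smooth_on_dderiv)

text \<open>The transposed derivative of \<open>f\<close> applied to \<open>v\<close>. It isolates
  the variation \<open>h\<close> in expressions such as \<open>f'(h) \<bullet> v\<close>, as a
  variational derivative requires.\<close>

definition tjac :: "(real^'n \<Rightarrow> real^'n) \<Rightarrow> real^'n \<Rightarrow> real^'n \<Rightarrow> real^'n" where
  "tjac f y v = (\<chi> k. frechet_derivative f (at y) (axis k 1) \<bullet> v)"

lemma tjac_inner:
  assumes "f differentiable at y"
  shows "tjac f y v \<bullet> h = frechet_derivative f (at y) h \<bullet> v"
  unfolding tjac_def
  by (rule linear_as_inner[symmetric, of "\<lambda>h. frechet_derivative f (at y) h \<bullet> v"])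
    (use linear_frechet_derivative[OF assms] in \<open>auto simp: linear_iff inner_left_distrib\<close>)

lemma smooth_on_tjac_compose:
  assumes S: "open S" and f: "smooth_on T f" and u: "smooth_on S u" "u ` S \<subseteq> T" and v: "smooth_on S v"
  shows "smooth_on S (\<lambda>p. tjac f (u p) (v p))"
proof (rule smooth_on_vec[OF S])
  fix i
  have "smooth_on S (\<lambda>p. frechet_derivative f (at (u p)) (axis i 1))"
    by (rule smooth_on_compose[OF S smooth_on_dderiv[OF f] u])
  then show "smooth_on S (\<lambda>p. tjac f (u p) (v p) $ i)"
    by (simp add: tjac_def smooth_on_inner[OF S] v)
qed

text \<open>The integrand is smooth only where a perturbed field stays in the domain of the
  coefficients, an open \<open>W\<close> that contains the slice over parameter 0. Compactness of
  the box yields one interval of parameters valid for all its points, and there the Leibniz rule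
  applies.\<close>

lemma derivative_under_integral:
  fixes D :: "real \<times> plane \<Rightarrow> real"
  assumes W: "open W" and sm: "smooth_on W D" and a: "a > 0"
    and W0: "\<And>p. p \<in> cbox (-a, -a) (a, a) \<Longrightarrow> (0, p) \<in> W"
    and z: "\<And>e p. p \<notin> cbox (-a, -a) (a, a) \<Longrightarrow> D (e, p) = 0 \<and> E p = 0"
    and E: "\<And>p. p \<in> cbox (-a, -a) (a, a) \<Longrightarrow> ((\<lambda>e. D (e, p)) has_real_derivative E p) (at 0)"
  shows "((\<lambda>e. integral UNIV (\<lambda>p. D (e, p))) has_real_derivative integral UNIV E) (at 0)"
proof -
  let ?B = "cbox (-a, -a) (a, a) :: plane set"
  have "compact ({0} \<times> ?B)" by (intro compact_Times) auto
  moreover have "{0} \<times> ?B \<subseteq> W" using W0 by auto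
  ultimately obtain d where d: "d > 0" "(\<Union>x\<in>{0} \<times> ?B. ball x d) \<subseteq> W"
    using compact_subset_open_imp_ball_epsilon_subset[OF _ W] by metis
  have dW: "(e, p) \<in> W" if "e \<in> ball 0 d" "p \<in> ?B" for e p
  proof -
    have "(e, p) \<in> ball (0, p) d" using that(1) by (simp add: dist_Pair_Pair)
    then show ?thesis using d(2) that(2) by blast
  qed
  have diff: "(D has_derivative frechet_derivative D (at q)) (at q)" if "q \<in> W" for q
    by (rule smooth_on_has_derivative[OF sm that])
  define D' where "D' e p = frechet_derivative D (at (e, p)) (1, 0)" for e p
  have der: "((\<lambda>e. D (e, p)) has_real_derivative D' e p) (at e)" if "(e, p) \<in> W" for e p
  proof -
    have "((\<lambda>t. (t, p)) has_derivative (\<lambda>t. (t, 0))) (at e)" by (auto intro!: derivative_eq_intros)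
    from diff_chain_at[OF this diff[OF that]]
    have *: "((\<lambda>e. D (e, p)) has_derivative (\<lambda>t. frechet_derivative D (at (e, p)) (t, 0))) (at e)"
      by (simp add: o_def)
    have "(t, 0) = t *\<^sub>R (1, 0 :: plane)" for t :: real by simp
    then have "frechet_derivative D (at (e, p)) (t, 0) = t * D' e p" for t
      unfolding D'_def using linear_scale[OF linear_frechet_derivative[OF smooth_on_differentiable[OF sm that]]]
      by (metis real_scaleR_def)
    then show ?thesis using * by (simp add: has_field_derivative_def mult_commute_abs)
  qed
  have "((\<lambda>e. integral ?B (\<lambda>p. D (e, p))) has_real_derivative integral ?B (D' 0)) (at 0 within ball 0 d)"
  proof (rule leibniz_rule_field_derivative)
    show "((\<lambda>e. D (e, p)) has_real_derivative D' e p) (at e within ball 0 d)"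
      if "e \<in> ball 0 d" "p \<in> ?B" for e p
      using der[OF dW[OF that]] by (rule has_field_derivative_at_within)
    show "(\<lambda>p. D (e, p)) integrable_on ?B" if "e \<in> ball 0 d" for e
    proof (rule integrable_continuous)
      show "continuous_on ?B (\<lambda>p. D (e, p))"
        by (rule continuous_on_compose2[OF smooth_on_continuous[OF sm]])
          (use dW[OF that] in \<open>auto intro!: continuous_intros\<close>)
    qed
    show "continuous_on (ball 0 d \<times> ?B) (\<lambda>(e, p). D' e p)"
      using continuous_on_subset[OF smooth_on_continuous[OF smooth_on_dderiv[OF sm, of "(1, 0)"]], of "ball 0 d \<times> ?B"] dW
      by (auto simp: D'_def case_prod_unfold subset_eq)
  qed (use d in auto)
  then have "((\<lambda>e. integral ?B (\<lambda>p. D (e, p))) has_real_derivative integral ?B (D' 0)) (at 0)"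
    using d(1) by (simp add: at_within_open[of 0 "ball 0 d"])
  moreover have "integral UNIV (\<lambda>p. D (e, p)) = integral ?B (\<lambda>p. D (e, p))" for e
    by (rule integral_UNIV_box) (use z in auto)
  moreover have "integral UNIV E = integral ?B E"
    by (rule integral_UNIV_box) (use z in auto)
  moreover have "integral ?B E = integral ?B (D' 0)"
    by (rule integral_cong) (use DERIV_unique[OF E der] W0 in auto)
  ultimately show ?thesis by simp
qed

section \<open>The operator on linear functionals\<close>

locale dn_operator =
  fixes U :: "(real^'n) set" and A :: "bool \<Rightarrow> real^'n \<Rightarrow> real^'n^'n"
    and bc :: "bool \<Rightarrow> real^'n \<Rightarrow> 'n \<Rightarrow> 'n \<Rightarrow> 'n \<Rightarrow> real"
  assumes open_U: "open U" and smooth_A: "\<And>\<alpha>. smooth_on U (A \<alpha>)"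
    and smooth_bc: "\<And>\<alpha> i j k. smooth_on U (\<lambda>y. bc \<alpha> y i j k)"
begin

definition P :: "(plane \<Rightarrow> real^'n) \<Rightarrow> (plane \<Rightarrow> real^'n) \<Rightarrow> plane \<Rightarrow> real^'n" where
  "P = hop (A False) (bc False) (A True) (bc True)"

text \<open>The coefficients \<open>b\<^sup>i\<^sup>j\<^sub>k\<close> contracted with two covectors, again a covector.\<close>
definition \<beta> :: "bool \<Rightarrow> real^'n \<Rightarrow> real^'n \<Rightarrow> real^'n \<Rightarrow> real^'n" where
  "\<beta> \<alpha> y a b = (\<chi> k. \<Sum>i\<in>UNIV. \<Sum>j\<in>UNIV. a $ i * b $ j * bc \<alpha> y i j k)"

text \<open>\<open>\<beta>\<close> with its first covector slot read as a vector output: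
  \<open>Bm \<alpha> y \<xi> v\<close> at \<open>v = pd \<alpha> u p\<close> is the term of the
  operator that does not differentiate \<open>\<xi>\<close>.\<close>

definition Bm :: "bool \<Rightarrow> real^'n \<Rightarrow> real^'n \<Rightarrow> real^'n \<Rightarrow> real^'n" where
  "Bm \<alpha> y c v = (\<chi> l. \<beta> \<alpha> y (axis l 1) c \<bullet> v)"

lemma \<beta>_add_left: "\<beta> \<alpha> y (a + a') b = \<beta> \<alpha> y a b + \<beta> \<alpha> y a' b"
  and \<beta>_add_right: "\<beta> \<alpha> y a (b + b') = \<beta> \<alpha> y a b + \<beta> \<alpha> y a b'"
  and \<beta>_scaleR_left: "\<beta> \<alpha> y (c *\<^sub>R a) b = c *\<^sub>R \<beta> \<alpha> y a b"
  and \<beta>_scaleR_right: "\<beta> \<alpha> y a (c *\<^sub>R b) = c *\<^sub>R \<beta> \<alpha> y a b"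
  by (simp_all add: \<beta>_def vec_eq_iff algebra_simps sum.distrib sum_distrib_left)

lemma inner_Bm: "a \<bullet> Bm \<alpha> y c v = \<beta> \<alpha> y a c \<bullet> v"
proof -
  have "linear (\<lambda>a. \<beta> \<alpha> y a c \<bullet> v)"
    by (auto simp: linear_iff \<beta>_add_left \<beta>_scaleR_left inner_left_distrib)
  from linear_as_inner[OF this, of a] show ?thesis
    by (simp add: Bm_def inner_commute)
qed

lemma smooth_\<beta>: "smooth_on U (\<lambda>y. \<beta> \<alpha> y a b)"
  by (rule smooth_on_vec[OF open_U])
    (auto simp: \<beta>_def intro!: smooth_on_sum smooth_on_mult smooth_on_const open_U smooth_bc)

lemma smooth_AA: "smooth_on U (\<lambda>y. a \<bullet> (A \<alpha> y *v b))"
  by (intro smooth_on_inner smooth_on_matrix_vector_mult smooth_on_const open_U smooth_A)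

text \<open>The value of the operator on \<open>\<psi> b\<close>, see \<open>P_eq_wf\<close>,
  expressed through \<open>pd\<close> so that it is visibly smooth and linear in the first jet of
  \<open>\<psi>\<close>.\<close>

definition wf :: "(plane \<Rightarrow> real^'n) \<Rightarrow> real^'n \<Rightarrow> (plane \<Rightarrow> real) \<Rightarrow> plane \<Rightarrow> real^'n" where
  "wf u b \<psi> p = (\<Sum>\<alpha>\<in>UNIV. pd \<alpha> \<psi> p *\<^sub>R (A \<alpha> (u p) *v b) + \<psi> p *\<^sub>R Bm \<alpha> (u p) b (pd \<alpha> u p))"

lemma inner_wf:
  "a \<bullet> wf u b \<psi> p = (\<Sum>\<alpha>\<in>UNIV. pd \<alpha> \<psi> p * (a \<bullet> (A \<alpha> (u p) *v b)) + \<psi> p * (\<beta> \<alpha> (u p) a b \<bullet> pd \<alpha> u p))"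
  by (simp add: wf_def inner_sum_right inner_right_distrib inner_Bm)

lemma P_eq:
  assumes u: "u differentiable at p" and \<xi>: "\<xi> differentiable at p"
  shows "P u \<xi> p = (\<Sum>\<alpha>\<in>UNIV. A \<alpha> (u p) *v pd \<alpha> \<xi> p + Bm \<alpha> (u p) (\<xi> p) (pd \<alpha> u p))"
proof -
  have "(\<Sum>j\<in>UNIV. \<Sum>k\<in>UNIV. bc \<alpha> (u p) i j k * pd \<alpha> u p $ k * \<xi> p $ j)
      = \<beta> \<alpha> (u p) (axis i 1) (\<xi> p) \<bullet> pd \<alpha> u p" for \<alpha> i
  proof -
    have "\<beta> \<alpha> (u p) (axis i 1) (\<xi> p) = (\<chi> k. \<Sum>j\<in>UNIV. \<xi> p $ j * bc \<alpha> (u p) i j k)"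
    proof -
      have "(\<Sum>i'\<in>UNIV. \<Sum>j\<in>UNIV. axis i 1 $ i' * \<xi> p $ j * bc \<alpha> (u p) i' j k)
          = (\<Sum>i'\<in>UNIV. if i' = i then \<Sum>j\<in>UNIV. \<xi> p $ j * bc \<alpha> (u p) i' j k else 0)" for k
        by (intro sum.cong) (auto simp: axis_def)
      then show ?thesis by (simp add: \<beta>_def vec_eq_iff)
    qed
    then show ?thesis
      by (simp add: inner_vec_def sum_distrib_left sum_distrib_right ac_simps)
        (rule sum.swap)
  qed
  then show ?thesis
    by (simp add: P_def hop_def Bm_def vec_eq_iff pdx_eq_pd[OF \<xi>] pdy_eq_pd[OF \<xi>] pdx_eq_pd[OF u]
        pdy_eq_pd[OF u] UNIV_bool matrix_vector_mult_def ac_simps)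
qed

lemma Bm_scaleR: "Bm \<alpha> y c (r *\<^sub>R v) = r *\<^sub>R Bm \<alpha> y c v"
  and Bm_scaleR_left: "Bm \<alpha> y (r *\<^sub>R c) v = r *\<^sub>R Bm \<alpha> y c v"
  by (simp_all add: Bm_def vec_eq_iff \<beta>_scaleR_right)

lemma P_eq_wf:
  assumes u: "u differentiable at p" and \<psi>: "\<psi> differentiable at p"
  shows "P u (\<lambda>q. \<psi> q *\<^sub>R b) p = wf u b \<psi> p"
proof -
  have d: "(\<lambda>q. \<psi> q *\<^sub>R b) differentiable at p" using \<psi> by (intro differentiable_scaleR) auto
  have pd: "pd \<alpha> (\<lambda>q. \<psi> q *\<^sub>R b) p = pd \<alpha> \<psi> p *\<^sub>R b" for \<alpha>
    using pd_scaleR[OF \<psi>, of "\<lambda>_. b" \<alpha>] by simp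
  show ?thesis
    unfolding P_eq[OF u d] wf_def pd by (simp add: Bm_scaleR_left matrix_vector_mult_scaleR)
qed

text \<open>The variational derivative is \<open>\<phi> a\<close> at every \<open>u\<close>. With
  such functionals outside, only the inner bracket of a nested bracket has to be varied.\<close>

definition Fn :: "(plane \<Rightarrow> real) \<Rightarrow> real^'n \<Rightarrow> 'n functional" where
  "Fn \<phi> a = (\<lambda>u. integral UNIV (\<lambda>p. \<phi> p * (a \<bullet> u p)))"

lemma local_functional_Fn:
  assumes "smooth_on UNIV \<phi>" "compact_supp \<phi>"
  shows "local_functional (Fn \<phi> a)"
proof -
  let ?f = "\<lambda>q :: plane \<times> (real^'n). \<phi> (fst q) * (a \<bullet> snd q)"
  have f: "smooth_on UNIV (\<lambda>q :: plane \<times> (real^'n). \<phi> (fst q))"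
    by (rule smooth_on_compose[OF _ assms(1)]) (auto intro!: smooth_on_bounded_linear bounded_linear_fst)
  have sf: "smooth_on UNIV ?f"
    by (intro smooth_on_mult smooth_on_inner f smooth_on_const smooth_on_bounded_linear bounded_linear_snd) auto
  have eq: "Fn \<phi> a = (\<lambda>u. integral UNIV (\<lambda>p. ?f (p, u p)))" by (simp add: Fn_def)
  obtain b where b: "b > 0" "\<And>p. p \<notin> cbox (-b, -b) (b, b) \<Longrightarrow> \<phi> p = 0"
    using compact_supp_box[OF assms(2)] by blast
  have "\<exists>K. compact K \<and> (\<forall>p y. p \<notin> K \<longrightarrow> ?f (p, y) = 0)"
    by (rule exI[of _ "cbox (-b, -b) (b, b)"]) (use b in auto)
  then show ?thesis unfolding local_functional_def using sf eq by blast
qed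

lemma var_deriv_Fn:
  assumes \<phi>: "smooth_on UNIV \<phi>" "compact_supp \<phi>" and u: "continuous_on UNIV u"
  shows "var_deriv (Fn \<phi> a) u = (\<lambda>p. \<phi> p *\<^sub>R a)"
proof (rule var_deriv_eq)
  show "has_var_deriv (Fn \<phi> a) u (\<lambda>p. \<phi> p *\<^sub>R a)"
    unfolding has_var_deriv_def
  proof (intro conjI allI impI)
    note c = smooth_on_continuous[OF \<phi>(1)]
    show "continuous_on UNIV (\<lambda>p. \<phi> p *\<^sub>R a)" by (intro continuous_intros c)
    fix h :: "plane \<Rightarrow> real^'n" assume h: "smooth_on UNIV h \<and> compact_supp h"
    have i1: "(\<lambda>p. \<phi> p * (a \<bullet> u p)) integrable_on UNIV"
      by (intro integrable_compact_supp continuous_intros c u compact_supp_subset[OF \<phi>(2)]) auto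
    have i2: "(\<lambda>p. \<phi> p * (a \<bullet> h p)) integrable_on UNIV"
      by (intro integrable_compact_supp continuous_on_mult continuous_on_inner continuous_on_const c
          smooth_on_continuous compact_supp_subset[OF \<phi>(2)]) (use h in auto)
    have "Fn \<phi> a (\<lambda>p. u p + e *\<^sub>R h p)
        = integral UNIV (\<lambda>p. \<phi> p * (a \<bullet> u p)) + e * integral UNIV (\<lambda>p. \<phi> p * (a \<bullet> h p))" for e
      using integral_add[OF i1 integrable_cmul[OF i2, of e]]
      by (simp add: Fn_def inner_right_distrib algebra_simps)
    moreover have "((\<lambda>e. integral UNIV (\<lambda>p. \<phi> p * (a \<bullet> u p)) + e * integral UNIV (\<lambda>p. \<phi> p * (a \<bullet> h p)))
       has_real_derivative integral UNIV (\<lambda>p. \<phi> p * (a \<bullet> h p))) (at 0)"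
      by (auto intro!: derivative_eq_intros)
    ultimately show "((\<lambda>e. Fn \<phi> a (\<lambda>p. u p + e *\<^sub>R h p)) has_real_derivative
        integral UNIV (\<lambda>p. \<phi> p *\<^sub>R a \<bullet> h p)) (at 0)"
      by simp
  qed
qed

text \<open>Stated for arbitrary smooth fields, because it is applied to \<open>u + e h\<close> for
  every \<open>e\<close>, including those for which the perturbed field leaves
  \<open>U\<close>.\<close>

lemma pbracket_Fn:
  assumes \<phi>: "smooth_on UNIV \<phi>" "compact_supp \<phi>" and \<psi>: "smooth_on UNIV \<psi>" "compact_supp \<psi>"
    and u: "smooth_on UNIV u"
  shows "pbracket P (Fn \<phi> a) (Fn \<psi> b) u = integral UNIV (\<lambda>p. \<phi> p * (a \<bullet> wf u b \<psi> p))"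
  unfolding pbracket_def var_deriv_Fn[OF \<phi> smooth_on_continuous[OF u]] var_deriv_Fn[OF \<psi> smooth_on_continuous[OF u]]
  by (subst P_eq_wf) (auto intro: smooth_on_differentiable[OF u] smooth_on_differentiable[OF \<psi>(1)])

section \<open>First variation of a bracket and the pointwise identities\<close>

context
  fixes u assumes u: "config U u"
begin

lemma u_smooth: "smooth_on UNIV u" and u_in: "u p \<in> U" and u_range: "u ` S \<subseteq> U"
  using u by (auto simp: config_def)

lemma smooth_Au: "smooth_on UNIV (\<lambda>p. A \<alpha> (u p) *v b)"
  by (intro smooth_on_matrix_vector_mult smooth_on_const smooth_on_compose[OF _ smooth_A u_smooth u_range]) auto

lemma smooth_\<beta>u: "smooth_on UNIV (\<lambda>p. \<beta> \<alpha> (u p) a b)"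
  by (intro smooth_on_compose[OF _ smooth_\<beta> u_smooth u_range]) auto

lemma smooth_Bmu: "smooth_on UNIV (\<lambda>p. Bm \<alpha> (u p) b (pd \<alpha> u p))"
  by (rule smooth_on_vec) (auto simp: Bm_def intro!: smooth_on_inner smooth_\<beta>u smooth_on_pd u_smooth)

lemma smooth_wf: "smooth_on UNIV \<psi> \<Longrightarrow> smooth_on UNIV (wf u b \<psi>)"
  unfolding wf_def[abs_def]
  by (intro smooth_on_sum smooth_on_add smooth_on_scaleR smooth_Au smooth_Bmu smooth_on_pd) auto

lemma compact_supp_wf:
  assumes "compact_supp \<psi>" shows "compact_supp (wf u b \<psi>)"
proof -
  obtain K where K: "compact K" "\<And>p. p \<notin> K \<Longrightarrow> \<psi> p = 0" using assms unfolding compact_supp_def by blast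
  have "pd \<alpha> \<psi> p = 0" if "p \<notin> K" for p \<alpha>
    using pd_cong_open[OF open_Compl[OF compact_imp_closed[OF K(1)]], of p \<psi> "\<lambda>p. 0"] K(2) that by simp
  then have "wf u b \<psi> p = 0" if "p \<notin> K" for p
    using K(2) that by (simp add: wf_def)
  then show ?thesis unfolding compact_supp_def using K(1) by blast
qed

definition gA :: "bool \<Rightarrow> real^'n \<Rightarrow> real^'n \<Rightarrow> plane \<Rightarrow> real^'n" where
  "gA \<alpha> a b p = grad (\<lambda>y. a \<bullet> (A \<alpha> y *v b)) (u p)"

text \<open>Its inner product with \<open>h\<close> is the part of the variation of
  \<open>\<beta> \<bullet> pd \<alpha> u\<close> in which only the coefficient
  \<open>\<beta>\<close> is varied.\<close>

definition c\<beta> :: "bool \<Rightarrow> real^'n \<Rightarrow> real^'n \<Rightarrow> plane \<Rightarrow> real^'n" where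
  "c\<beta> \<alpha> a b p = tjac (\<lambda>y. \<beta> \<alpha> y a b) (u p) (pd \<alpha> u p)"

lemma smooth_gA: "smooth_on UNIV (gA \<alpha> a b)"
  unfolding gA_def[abs_def]
  by (rule smooth_on_compose[OF _ smooth_on_grad[OF open_U smooth_AA] u_smooth u_range]) auto

lemma smooth_c\<beta>: "smooth_on UNIV (c\<beta> \<alpha> a b)"
  unfolding c\<beta>_def[abs_def]
  by (intro smooth_on_tjac_compose[OF _ smooth_\<beta> u_smooth u_range] smooth_on_pd u_smooth) auto

text \<open>The derivative of \<open>a \<bullet> P\<^sub>u(\<psi> b)\<close> in the direction \<open>h\<close>.\<close>
definition dQ :: "real^'n \<Rightarrow> real^'n \<Rightarrow> (plane \<Rightarrow> real) \<Rightarrow> (plane \<Rightarrow> real^'n) \<Rightarrow> plane \<Rightarrow> real" where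
  "dQ a b \<psi> h p = (\<Sum>\<alpha>\<in>UNIV. pd \<alpha> \<psi> p * (gA \<alpha> a b p \<bullet> h p) +
      \<psi> p * (c\<beta> \<alpha> a b p \<bullet> h p + \<beta> \<alpha> (u p) a b \<bullet> pd \<alpha> h p))"

text \<open>The Euler-Lagrange expression of the bracket of \<open>Fn \<phi> a\<close> and
  \<open>Fn \<psi> b\<close>: \<open>\<phi> * dQ\<close> with the derivative moved off
  \<open>h\<close>.\<close>

definition \<delta> :: "(plane \<Rightarrow> real) \<Rightarrow> real^'n \<Rightarrow> (plane \<Rightarrow> real) \<Rightarrow> real^'n \<Rightarrow> plane \<Rightarrow> real^'n" where
  "\<delta> \<phi> a \<psi> b p = (\<Sum>\<alpha>\<in>UNIV. (\<phi> p * pd \<alpha> \<psi> p) *\<^sub>R gA \<alpha> a b p + (\<phi> p * \<psi> p) *\<^sub>R c\<beta> \<alpha> a b p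
      - pd \<alpha> (\<lambda>q. (\<phi> q * \<psi> q) *\<^sub>R \<beta> \<alpha> (u q) a b) p)"

lemma smooth_\<delta>: "smooth_on UNIV \<phi> \<Longrightarrow> smooth_on UNIV \<psi> \<Longrightarrow> smooth_on UNIV (\<delta> \<phi> a \<psi> b)"
  unfolding \<delta>_def[abs_def]
  by (intro smooth_on_sum smooth_on_diff smooth_on_add smooth_on_scaleR smooth_on_mult smooth_gA smooth_c\<beta>
      smooth_on_pd smooth_\<beta>u) auto

lemma smooth_dQ: "smooth_on UNIV \<psi> \<Longrightarrow> smooth_on UNIV h \<Longrightarrow> smooth_on UNIV (dQ a b \<psi> h)"
  unfolding dQ_def[abs_def]
  by (intro smooth_on_sum smooth_on_add smooth_on_mult smooth_on_inner smooth_gA smooth_c\<beta>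
      smooth_on_pd smooth_\<beta>u) auto

text \<open>The two integrands differ by the divergence of
  \<open>(\<phi> * \<psi>) * (\<beta> \<bullet> h)\<close>, whose support lies in that of
  \<open>\<phi>\<close>. The lemma serves in both directions: to find the variational derivative,
  and later to free a test function from it.\<close>

lemma integral_dQ:
  assumes \<phi>: "smooth_on UNIV \<phi>" "compact_supp \<phi>" and \<psi>: "smooth_on UNIV \<psi>"
    and h: "smooth_on UNIV h"
  shows "integral UNIV (\<lambda>p. \<phi> p * dQ a b \<psi> h p) = integral UNIV (\<lambda>p. \<delta> \<phi> a \<psi> b p \<bullet> h p)"
proof -
  note sm = smooth_on_differentiable[where S = UNIV, OF _ UNIV_I]
  define R where "R \<alpha> q = (\<phi> q * \<psi> q) *\<^sub>R \<beta> \<alpha> (u q) a b" for \<alpha> q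
  have R: "smooth_on UNIV (R \<alpha>)" for \<alpha>
    unfolding R_def[abs_def] by (intro smooth_on_scaleR smooth_on_mult \<phi> \<psi> smooth_\<beta>u) auto
  have Rh: "smooth_on UNIV (\<lambda>q. R \<alpha> q \<bullet> h q)" for \<alpha>
    by (intro smooth_on_inner R h) auto
  have cs: "compact_supp (\<lambda>q. R \<alpha> q \<bullet> h q)" for \<alpha>
    by (rule compact_supp_subset[OF \<phi>(2)]) (simp add: R_def)
  have *: "\<phi> p * dQ a b \<psi> h p = \<delta> \<phi> a \<psi> b p \<bullet> h p + (\<Sum>\<alpha>\<in>UNIV. pd \<alpha> (\<lambda>q. R \<alpha> q \<bullet> h q) p)" for p
  proof -
    have "R \<alpha> p \<bullet> v = \<phi> p * (\<psi> p * (\<beta> \<alpha> (u p) a b \<bullet> v))" for \<alpha> v by (simp add: R_def)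
    moreover have "pd \<alpha> (\<lambda>q. (\<phi> q * \<psi> q) *\<^sub>R \<beta> \<alpha> (u q) a b) p = pd \<alpha> (R \<alpha>) p" for \<alpha>
      by (simp add: R_def[abs_def])
    ultimately show ?thesis
      unfolding dQ_def \<delta>_def
      by (simp add: pd_inner[OF sm[OF R] sm[OF h]] UNIV_bool inner_left_distrib inner_diff_left algebra_simps)
  qed
  have i2: "pd \<alpha> (\<lambda>q. R \<alpha> q \<bullet> h q) integrable_on UNIV" for \<alpha>
    by (intro integrable_compact_supp smooth_on_continuous smooth_on_pd Rh compact_supp_pd cs)
  have "compact_supp (\<lambda>p. \<phi> p * dQ a b \<psi> h p)"
    by (rule compact_supp_subset[OF \<phi>(2)]) simp
  then have "(\<lambda>p. \<phi> p * dQ a b \<psi> h p) integrable_on UNIV"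
    by (intro integrable_compact_supp smooth_on_continuous smooth_on_mult \<phi> smooth_dQ \<psi> h) auto
  from integral_diff[OF this integrable_sum[of UNIV "\<lambda>\<alpha>. pd \<alpha> (\<lambda>q. R \<alpha> q \<bullet> h q)"]]
  have "integral UNIV (\<lambda>p. \<phi> p * dQ a b \<psi> h p) - integral UNIV (\<lambda>p. \<Sum>\<alpha>\<in>UNIV. pd \<alpha> (\<lambda>q. R \<alpha> q \<bullet> h q) p)
      = integral UNIV (\<lambda>p. \<phi> p * dQ a b \<psi> h p - (\<Sum>\<alpha>\<in>UNIV. pd \<alpha> (\<lambda>q. R \<alpha> q \<bullet> h q) p))"
    using i2 by simp
  moreover have "integral UNIV (\<lambda>p. \<Sum>\<alpha>\<in>UNIV. pd \<alpha> (\<lambda>q. R \<alpha> q \<bullet> h q) p) = 0"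
    by (subst integral_sum) (auto simp: i2 integral_pd_zero[OF Rh cs])
  ultimately show ?thesis by (simp add: *)
qed

lemma has_derivative_along:
  assumes "f differentiable at y"
  shows "((\<lambda>e. f (y + e *\<^sub>R v)) has_derivative (\<lambda>e. e *\<^sub>R frechet_derivative f (at y) v)) (at 0)"
proof -
  have g: "((\<lambda>e. y + e *\<^sub>R v) has_derivative (\<lambda>e. e *\<^sub>R v)) (at 0)"
    by (auto intro!: derivative_eq_intros)
  have "(f has_derivative frechet_derivative f (at y)) (at (y + 0 *\<^sub>R v))"
    using assms by (simp add: frechet_derivative_works)
  from diff_chain_at[OF g this] show ?thesis
    by (simp add: o_def linear_scale[OF linear_frechet_derivative[OF assms]])
qed

lemma has_var_deriv_bracket:
  assumes \<phi>: "smooth_on UNIV \<phi>" "compact_supp \<phi>" and \<psi>: "smooth_on UNIV \<psi>" "compact_supp \<psi>"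
  shows "has_var_deriv (pbracket P (Fn \<phi> a) (Fn \<psi> b)) u (\<delta> \<phi> a \<psi> b)"
  unfolding has_var_deriv_def
proof (intro conjI allI impI)
  show "continuous_on UNIV (\<delta> \<phi> a \<psi> b)"
    by (rule smooth_on_continuous[OF smooth_\<delta>[OF \<phi>(1) \<psi>(1)]])
  fix h :: "plane \<Rightarrow> real^'n" assume "smooth_on UNIV h \<and> compact_supp h"
  then have h: "smooth_on UNIV h" by simp
  note sm = smooth_on_differentiable[where S = UNIV, OF _ UNIV_I]
  define y where "y q = u (snd q) + fst q *\<^sub>R h (snd q)" for q :: "real \<times> plane"
  define D where "D q = \<phi> (snd q) * (\<Sum>\<alpha>\<in>UNIV. pd \<alpha> \<psi> (snd q) * (a \<bullet> (A \<alpha> (y q) *v b)) +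
     \<psi> (snd q) * (\<beta> \<alpha> (y q) a b \<bullet> (pd \<alpha> u (snd q) + fst q *\<^sub>R pd \<alpha> h (snd q))))" for q :: "real \<times> plane"
  have fs: "smooth_on UNIV (\<lambda>q :: real \<times> plane. f (snd q))" if "smooth_on UNIV f" for f :: "plane \<Rightarrow> 'z::real_normed_vector"
    by (rule smooth_on_compose[OF _ that]) (auto intro!: smooth_on_bounded_linear bounded_linear_snd)
  have ffst: "smooth_on UNIV (\<lambda>q :: real \<times> plane. fst q)"
    by (auto intro!: smooth_on_bounded_linear bounded_linear_fst)
  have ys: "smooth_on UNIV y" unfolding y_def[abs_def]
    by (intro smooth_on_add smooth_on_scaleR fs ffst u_smooth h) auto
  \<comment> \<open>The coefficients are smooth only on \<open>U\<close>, so smoothness in parameter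
    and point together holds only where the perturbed field stays in \<open>U\<close>.\<close>
  define W where "W = y -` U"
  have W: "open W"
    unfolding W_def using continuous_on_open_vimage[OF open_UNIV, of y] smooth_on_continuous[OF ys] open_U by auto
  have rst: "smooth_on UNIV f \<Longrightarrow> smooth_on W f" for f :: "real \<times> plane \<Rightarrow> 'z::real_normed_vector"
    by (rule smooth_on_subset) auto
  have yW: "smooth_on W y" "y ` W \<subseteq> U" using rst[OF ys] by (auto simp: W_def)
  have DW: "smooth_on W D"
    unfolding D_def[abs_def]
    by (intro smooth_on_mult smooth_on_sum smooth_on_add smooth_on_inner smooth_on_scaleR W
        rst[OF fs] rst[OF ffst] \<phi> \<psi> smooth_on_pd u_smooth h smooth_on_compose[OF W smooth_AA yW]
        smooth_on_compose[OF W smooth_\<beta> yW])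
  obtain r where r: "r > 0" "\<And>p. p \<notin> cbox (-r, -r) (r, r) \<Longrightarrow> \<phi> p = 0"
    using compact_supp_box[OF \<phi>(2)] by blast
  have E: "((\<lambda>e. D (e, p)) has_real_derivative \<phi> p * dQ a b \<psi> h p) (at 0)" for p
  proof -
    have dA: "(\<lambda>y. a \<bullet> (A \<alpha> y *v b)) differentiable at (u p)" for \<alpha>
      by (rule smooth_on_differentiable[OF smooth_AA u_in])
    have d\<beta>: "(\<lambda>y. \<beta> \<alpha> y a b) differentiable at (u p)" for \<alpha>
      by (rule smooth_on_differentiable[OF smooth_\<beta> u_in])
    have 1: "((\<lambda>e. a \<bullet> (A \<alpha> (u p + e *\<^sub>R h p) *v b)) has_real_derivative gA \<alpha> a b p \<bullet> h p) (at 0)" for \<alpha>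
      using has_derivative_along[OF dA, of \<alpha> "h p"]
      unfolding gA_def grad_inner[OF dA]
      by (simp add: has_field_derivative_def mult_commute_abs)
    have 2: "((\<lambda>e. \<beta> \<alpha> (u p + e *\<^sub>R h p) a b \<bullet> (pd \<alpha> u p + e *\<^sub>R pd \<alpha> h p)) has_real_derivative
       (c\<beta> \<alpha> a b p \<bullet> h p + \<beta> \<alpha> (u p) a b \<bullet> pd \<alpha> h p)) (at 0)" for \<alpha>
    proof -
      have "((\<lambda>e. pd \<alpha> u p + e *\<^sub>R pd \<alpha> h p) has_derivative (\<lambda>e. e *\<^sub>R pd \<alpha> h p)) (at 0)"
        by (auto intro!: derivative_eq_intros)
      note * = has_derivative_inner[OF has_derivative_along[OF d\<beta>, of \<alpha> "h p"] this]
      show ?thesis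
        unfolding c\<beta>_def tjac_inner[OF d\<beta>] has_field_derivative_def
        by (rule has_derivative_eq_rhs[OF *]) (simp add: fun_eq_iff algebra_simps)
    qed
    show ?thesis
      unfolding D_def y_def dQ_def UNIV_bool
      by (auto intro!: derivative_eq_intros 1 2)
  qed
  have "((\<lambda>e. integral UNIV (\<lambda>p. D (e, p))) has_real_derivative integral UNIV (\<lambda>p. \<phi> p * dQ a b \<psi> h p)) (at 0)"
    by (rule derivative_under_integral[OF W DW r(1)])
      (use r(2) E u_in in \<open>auto simp: W_def y_def D_def\<close>)
  \<comment> \<open>This holds for all \<open>e\<close>; the derivative at 0 looks only at small
    ones, for which the relevant points lie in \<open>W\<close>.\<close>
  moreover have "pbracket P (Fn \<phi> a) (Fn \<psi> b) (\<lambda>p. u p + e *\<^sub>R h p) = integral UNIV (\<lambda>p. D (e, p))" for e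
  proof -
    have su: "smooth_on UNIV (\<lambda>p. u p + e *\<^sub>R h p)"
      by (intro smooth_on_add smooth_on_scaleR smooth_on_const u_smooth h) auto
    have "pd \<alpha> (\<lambda>p. u p + e *\<^sub>R h p) p = pd \<alpha> u p + e *\<^sub>R pd \<alpha> h p" for \<alpha> p
      using pd_add[OF sm[OF u_smooth], of "\<lambda>p. e *\<^sub>R h p" p \<alpha>] pd_scaleR[of "\<lambda>_. e" p h \<alpha>] sm[OF h, of p]
      by (simp add: differentiable_scaleR)
    then show ?thesis
      unfolding pbracket_Fn[OF \<phi> \<psi> su] inner_wf D_def y_def by simp
  qed
  ultimately show "((\<lambda>e. pbracket P (Fn \<phi> a) (Fn \<psi> b) (\<lambda>p. u p + e *\<^sub>R h p)) has_real_derivative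
      integral UNIV (\<lambda>p. \<delta> \<phi> a \<psi> b p \<bullet> h p)) (at 0)"
    by (simp add: integral_dQ[OF \<phi> \<psi>(1) h])
qed

lemma pbracket_pbracket:
  assumes \<phi>: "smooth_on UNIV \<phi>" "compact_supp \<phi>" and \<psi>: "smooth_on UNIV \<psi>" "compact_supp \<psi>"
    and \<tau>: "smooth_on UNIV \<tau>" "compact_supp \<tau>"
  shows "pbracket P (pbracket P (Fn \<phi> a) (Fn \<psi> b)) (Fn \<tau> c) u
    = integral UNIV (\<lambda>p. \<delta> \<phi> a \<psi> b p \<bullet> wf u c \<tau> p)"
  unfolding pbracket_def[of P "pbracket P (Fn \<phi> a) (Fn \<psi> b)"] var_deriv_eq[OF has_var_deriv_bracket[OF \<phi> \<psi>]]
    var_deriv_Fn[OF \<tau> smooth_on_continuous[OF u_smooth]]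
  by (subst P_eq_wf) (auto intro: smooth_on_differentiable[OF u_smooth] smooth_on_differentiable[OF \<tau>(1)])

text \<open>Integration by parts moves the derivatives from \<open>f\<close> onto \<open>S1\<close>;
  then the fundamental lemma applies to the collected coefficient of \<open>f\<close>.\<close>

lemma weak_to_pointwise:
  fixes S0 :: "plane \<Rightarrow> real" and S1 :: "bool \<Rightarrow> plane \<Rightarrow> real"
  assumes S0: "smooth_on UNIV S0" and S1: "\<And>\<alpha>. smooth_on UNIV (S1 \<alpha>)"
    and int: "\<And>f. smooth_on UNIV f \<Longrightarrow> compact_supp f \<Longrightarrow>
       integral UNIV (\<lambda>p. f p * S0 p + (\<Sum>\<alpha>\<in>UNIV. pd \<alpha> f p * S1 \<alpha> p)) = 0"
  shows "S0 p = (\<Sum>\<alpha>\<in>UNIV. pd \<alpha> (S1 \<alpha>) p)"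
proof -
  note sm = smooth_on_differentiable[where S = UNIV, OF _ UNIV_I]
  let ?S = "\<lambda>p. S0 p - (\<Sum>\<alpha>\<in>UNIV. pd \<alpha> (S1 \<alpha>) p)"
  have sS: "smooth_on UNIV ?S" by (intro smooth_on_diff smooth_on_sum smooth_on_pd S0 S1) auto
  have "?S p = 0"
  proof (rule fundamental_lemma[of ?S])
    show "continuous_on UNIV ?S" by (rule smooth_on_continuous[OF sS])
    fix f :: "plane \<Rightarrow> real" assume f: "smooth_on UNIV f" "compact_supp f"
    have fS: "smooth_on UNIV (\<lambda>p. f p * S1 \<alpha> p)" for \<alpha> by (intro smooth_on_mult f S1) auto
    have cs: "compact_supp (\<lambda>p. f p * g p)" for g by (rule compact_supp_subset[OF f(2)]) simp
    have *: "f p * S0 p + (\<Sum>\<alpha>\<in>UNIV. pd \<alpha> f p * S1 \<alpha> p) = f p * ?S p + (\<Sum>\<alpha>\<in>UNIV. pd \<alpha> (\<lambda>p. f p * S1 \<alpha> p) p)" for p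
      by (simp add: pd_mult[OF sm[OF f(1)] sm[OF S1]] UNIV_bool algebra_simps)
    have i1: "(\<lambda>p. f p * ?S p) integrable_on UNIV"
      by (intro integrable_compact_supp smooth_on_continuous smooth_on_mult f sS cs) auto
    have i2: "pd \<alpha> (\<lambda>p. f p * S1 \<alpha> p) integrable_on UNIV" for \<alpha>
      by (intro integrable_compact_supp smooth_on_continuous smooth_on_pd fS compact_supp_pd cs)
    have "0 = integral UNIV (\<lambda>p. f p * ?S p) + integral UNIV (\<lambda>p. \<Sum>\<alpha>\<in>UNIV. pd \<alpha> (\<lambda>p. f p * S1 \<alpha> p) p)"
      using int[OF f] integral_add[OF i1 integrable_sum[of UNIV "\<lambda>\<alpha>. pd \<alpha> (\<lambda>p. f p * S1 \<alpha> p)"]] i2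
      unfolding * by simp
    moreover have "integral UNIV (\<lambda>p. \<Sum>\<alpha>\<in>UNIV. pd \<alpha> (\<lambda>p. f p * S1 \<alpha> p) p) = 0"
      by (subst integral_sum) (auto simp: i2 integral_pd_zero[OF fS cs])
    ultimately show "integral UNIV (\<lambda>p. f p * ?S p) = 0" by simp
  qed
  then show ?thesis by simp
qed

text \<open>Removes the test function \<open>\<phi>\<close> from the Jacobi identity. Each double
  bracket is written so that \<open>\<phi>\<close> is differentiated at most once: by
  \<open>integral_dQ\<close> in the first and third, where it would otherwise sit inside a
  variational derivative, while in the second it occurs only in
  \<open>wf u a \<phi>\<close>.\<close>

lemma jacobi_pointwise:
  assumes ham: "hamiltonian U P" and \<psi>: "smooth_on UNIV \<psi>" "compact_supp \<psi>"
    and \<tau>: "smooth_on UNIV \<tau>" "compact_supp \<tau>"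
  shows "dQ a b \<psi> (wf u c \<tau>) p
      + (\<Sum>\<alpha>\<in>UNIV. \<tau> p * (c\<beta> \<alpha> c a p \<bullet> wf u b \<psi> p + \<beta> \<alpha> (u p) c a \<bullet> pd \<alpha> (wf u b \<psi>) p)
          + \<delta> \<psi> b \<tau> c p \<bullet> Bm \<alpha> (u p) a (pd \<alpha> u p))
    = (\<Sum>\<alpha>\<in>UNIV. pd \<alpha> (\<lambda>q. \<tau> q * (gA \<alpha> c a q \<bullet> wf u b \<psi> q) + \<delta> \<psi> b \<tau> c q \<bullet> (A \<alpha> (u q) *v a)) p)"
proof (rule weak_to_pointwise)
  note w = smooth_wf[OF \<psi>(1), of b] smooth_wf[OF \<tau>(1), of c]
  note d = smooth_\<delta>[OF \<psi>(1) \<tau>(1), of b c]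
  show "smooth_on UNIV (\<lambda>p. dQ a b \<psi> (wf u c \<tau>) p
      + (\<Sum>\<alpha>\<in>UNIV. \<tau> p * (c\<beta> \<alpha> c a p \<bullet> wf u b \<psi> p + \<beta> \<alpha> (u p) c a \<bullet> pd \<alpha> (wf u b \<psi>) p)
          + \<delta> \<psi> b \<tau> c p \<bullet> Bm \<alpha> (u p) a (pd \<alpha> u p)))"
    by (intro smooth_on_add smooth_on_sum smooth_on_mult smooth_on_inner smooth_dQ \<psi> \<tau> w d smooth_c\<beta> smooth_\<beta>u
        smooth_on_pd smooth_Bmu) auto
  show "smooth_on UNIV (\<lambda>q. \<tau> q * (gA \<alpha> c a q \<bullet> wf u b \<psi> q) + \<delta> \<psi> b \<tau> c q \<bullet> (A \<alpha> (u q) *v a))" for \<alpha>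
    by (intro smooth_on_add smooth_on_mult smooth_on_inner \<tau> w d smooth_gA smooth_Au) auto
  fix \<phi> :: "plane \<Rightarrow> real" assume \<phi>: "smooth_on UNIV \<phi>" "compact_supp \<phi>"
  let ?T1 = "\<lambda>p. \<phi> p * dQ a b \<psi> (wf u c \<tau>) p"
  let ?T2 = "\<lambda>p. \<delta> \<psi> b \<tau> c p \<bullet> wf u a \<phi> p"
  let ?T3 = "\<lambda>p. \<tau> p * dQ c a \<phi> (wf u b \<psi>) p"
  have i1: "?T1 integrable_on UNIV"
    by (intro integrable_compact_supp smooth_on_continuous smooth_on_mult smooth_dQ \<phi> \<psi> w)
      (auto intro: compact_supp_subset[OF \<phi>(2)])
  have i2: "?T2 integrable_on UNIV"
    by (intro integrable_compact_supp smooth_on_continuous smooth_on_inner d smooth_wf \<phi>)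
      (auto intro: compact_supp_subset[OF compact_supp_wf[OF \<phi>(2), of a]])
  have i3: "?T3 integrable_on UNIV"
    by (intro integrable_compact_supp smooth_on_continuous smooth_on_mult smooth_dQ \<phi> \<tau> w)
      (auto intro: compact_supp_subset[OF \<tau>(2)])
  have "pbracket P (pbracket P (Fn \<phi> a) (Fn \<psi> b)) (Fn \<tau> c) u
      + pbracket P (pbracket P (Fn \<psi> b) (Fn \<tau> c)) (Fn \<phi> a) u
      + pbracket P (pbracket P (Fn \<tau> c) (Fn \<phi> a)) (Fn \<psi> b) u = 0"
    using ham u local_functional_Fn[OF \<phi>] local_functional_Fn[OF \<psi>] local_functional_Fn[OF \<tau>]
    unfolding hamiltonian_def by blast
  then have "integral UNIV ?T1 + integral UNIV ?T2 + integral UNIV ?T3 = 0"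
    unfolding pbracket_pbracket[OF \<phi> \<psi> \<tau>] pbracket_pbracket[OF \<psi> \<tau> \<phi>] pbracket_pbracket[OF \<tau> \<phi> \<psi>]
      integral_dQ[OF \<phi> \<psi>(1) w(2), symmetric] integral_dQ[OF \<tau> \<phi>(1) w(1), symmetric] .
  then have "integral UNIV (\<lambda>p. ?T1 p + ?T2 p + ?T3 p) = 0"
    using integral_add[OF i1 i2] integral_add[OF integrable_add[OF i1 i2] i3] by simp
  moreover have "?T1 p + ?T2 p + ?T3 p = \<phi> p * (dQ a b \<psi> (wf u c \<tau>) p
      + (\<Sum>\<alpha>\<in>UNIV. \<tau> p * (c\<beta> \<alpha> c a p \<bullet> wf u b \<psi> p + \<beta> \<alpha> (u p) c a \<bullet> pd \<alpha> (wf u b \<psi>) p)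
          + \<delta> \<psi> b \<tau> c p \<bullet> Bm \<alpha> (u p) a (pd \<alpha> u p)))
      + (\<Sum>\<alpha>\<in>UNIV. pd \<alpha> \<phi> p * (\<tau> p * (gA \<alpha> c a p \<bullet> wf u b \<psi> p) + \<delta> \<psi> b \<tau> c p \<bullet> (A \<alpha> (u p) *v a)))" for p
    unfolding dQ_def[of c a] wf_def[of u a]
    by (simp add: UNIV_bool inner_right_distrib algebra_simps)
  ultimately show "integral UNIV (\<lambda>p. \<phi> p * (dQ a b \<psi> (wf u c \<tau>) p
      + (\<Sum>\<alpha>\<in>UNIV. \<tau> p * (c\<beta> \<alpha> c a p \<bullet> wf u b \<psi> p + \<beta> \<alpha> (u p) c a \<bullet> pd \<alpha> (wf u b \<psi>) p)
          + \<delta> \<psi> b \<tau> c p \<bullet> Bm \<alpha> (u p) a (pd \<alpha> u p)))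
      + (\<Sum>\<alpha>\<in>UNIV. pd \<alpha> \<phi> p * (\<tau> p * (gA \<alpha> c a p \<bullet> wf u b \<psi> p) + \<delta> \<psi> b \<tau> c p \<bullet> (A \<alpha> (u p) *v a)))) = 0"
    by simp
qed

lemma skew_pointwise:
  assumes ham: "hamiltonian U P" and \<psi>: "smooth_on UNIV \<psi>" "compact_supp \<psi>"
  shows "a \<bullet> wf u b \<psi> p + (\<Sum>\<alpha>\<in>UNIV. \<psi> p * (\<beta> \<alpha> (u p) b a \<bullet> pd \<alpha> u p))
    = (\<Sum>\<alpha>\<in>UNIV. pd \<alpha> (\<lambda>q. \<psi> q * (b \<bullet> (A \<alpha> (u q) *v a))) p)"
proof (rule weak_to_pointwise)
  note w = smooth_wf[OF \<psi>(1), of b]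
  show "smooth_on UNIV (\<lambda>p. a \<bullet> wf u b \<psi> p + (\<Sum>\<alpha>\<in>UNIV. \<psi> p * (\<beta> \<alpha> (u p) b a \<bullet> pd \<alpha> u p)))"
    by (intro smooth_on_add smooth_on_sum smooth_on_mult smooth_on_inner \<psi> w smooth_\<beta>u smooth_on_pd u_smooth smooth_on_const) auto
  show "smooth_on UNIV (\<lambda>q. \<psi> q * (b \<bullet> (A \<alpha> (u q) *v a)))" for \<alpha>
    by (intro smooth_on_mult smooth_on_inner \<psi> smooth_Au smooth_on_const) auto
  fix \<phi> :: "plane \<Rightarrow> real" assume \<phi>: "smooth_on UNIV \<phi>" "compact_supp \<phi>"
  let ?T1 = "\<lambda>p. \<phi> p * (a \<bullet> wf u b \<psi> p)"
  let ?T2 = "\<lambda>p. \<psi> p * (b \<bullet> wf u a \<phi> p)"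
  have i1: "?T1 integrable_on UNIV"
    by (intro integrable_compact_supp smooth_on_continuous smooth_on_mult smooth_on_inner smooth_on_const \<phi> w)
      (auto intro: compact_supp_subset[OF \<phi>(2)])
  have i2: "?T2 integrable_on UNIV"
    by (intro integrable_compact_supp smooth_on_continuous smooth_on_mult smooth_on_inner smooth_on_const \<psi> smooth_wf \<phi>)
      (auto intro: compact_supp_subset[OF \<psi>(2)])
  have "pbracket P (Fn \<phi> a) (Fn \<psi> b) u = - pbracket P (Fn \<psi> b) (Fn \<phi> a) u"
    using ham u local_functional_Fn[OF \<phi>] local_functional_Fn[OF \<psi>]
    unfolding hamiltonian_def by blast
  then have "integral UNIV (\<lambda>p. ?T1 p + ?T2 p) = 0"
    unfolding pbracket_Fn[OF \<phi> \<psi> u_smooth] pbracket_Fn[OF \<psi> \<phi> u_smooth] by (simp add: integral_add[OF i1 i2])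
  moreover have "?T1 p + ?T2 p = \<phi> p * (a \<bullet> wf u b \<psi> p + (\<Sum>\<alpha>\<in>UNIV. \<psi> p * (\<beta> \<alpha> (u p) b a \<bullet> pd \<alpha> u p)))
      + (\<Sum>\<alpha>\<in>UNIV. pd \<alpha> \<phi> p * (\<psi> p * (b \<bullet> (A \<alpha> (u p) *v a))))" for p
    unfolding inner_wf by (simp add: UNIV_bool algebra_simps)
  ultimately show "integral UNIV (\<lambda>p. \<phi> p * (a \<bullet> wf u b \<psi> p + (\<Sum>\<alpha>\<in>UNIV. \<psi> p * (\<beta> \<alpha> (u p) b a \<bullet> pd \<alpha> u p)))
      + (\<Sum>\<alpha>\<in>UNIV. pd \<alpha> \<phi> p * (\<psi> p * (b \<bullet> (A \<alpha> (u p) *v a))))) = 0"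
    by simp
qed

end

end

section \<open>Polynomial jets at the origin\<close>

definition co :: "bool \<Rightarrow> plane \<Rightarrow> real" where "co \<alpha> p = (if \<alpha> then snd p else fst p)"

lemma bounded_linear_co: "bounded_linear (co \<alpha>)"
  unfolding co_def[abs_def] by (cases \<alpha>) (simp_all add: bounded_linear_fst bounded_linear_snd)

lemma smooth_co: "smooth_on UNIV (co \<alpha>)"
  by (rule smooth_on_bounded_linear[OF _ bounded_linear_co]) auto

lemma pd_co: "pd \<beta> (co \<alpha>) p = of_bool (\<alpha> = \<beta>)"
  unfolding pd_eq[OF bounded_linear_imp_has_derivative[OF bounded_linear_co]]
  by (simp add: co_def dir_def)

lemma co_0 [simp]: "co \<alpha> 0 = 0" by (simp add: co_def)

definition quad :: "bool \<Rightarrow> bool \<Rightarrow> plane \<Rightarrow> real" where "quad \<gamma> \<epsilon> p = co \<gamma> p * co \<epsilon> p"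

lemma smooth_quad: "smooth_on UNIV (quad \<gamma> \<epsilon>)"
  unfolding quad_def[abs_def] by (intro smooth_on_mult smooth_co) auto

lemma pd_quad: "pd \<beta> (quad \<gamma> \<epsilon>) p = co \<gamma> p * of_bool (\<epsilon> = \<beta>) + of_bool (\<gamma> = \<beta>) * co \<epsilon> p"
proof -
  have "co \<alpha> differentiable at p" for \<alpha> by (rule smooth_on_differentiable[OF smooth_co]) auto
  then show ?thesis unfolding quad_def[abs_def] by (simp add: pd_mult pd_co)
qed

lemma pd_pd_quad: "pd \<alpha> (pd \<beta> (quad \<gamma> \<epsilon>)) p = of_bool (\<gamma> = \<alpha> \<and> \<epsilon> = \<beta>) + of_bool (\<gamma> = \<beta> \<and> \<epsilon> = \<alpha>)"
proof -
  have d: "co \<alpha> differentiable at p" for \<alpha> by (rule smooth_on_differentiable[OF smooth_co]) auto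
  have "pd \<beta> (quad \<gamma> \<epsilon>) = (\<lambda>p. co \<gamma> p * of_bool (\<epsilon> = \<beta>) + of_bool (\<gamma> = \<beta>) * co \<epsilon> p)"
    by (rule ext) (rule pd_quad)
  moreover have "pd \<alpha> (\<lambda>p. co \<gamma> p * of_bool (\<epsilon> = \<beta>) + of_bool (\<gamma> = \<beta>) * co \<epsilon> p) p
      = of_bool (\<gamma> = \<alpha>) * of_bool (\<epsilon> = \<beta>) + of_bool (\<gamma> = \<beta>) * of_bool (\<epsilon> = \<alpha>)"
  proof -
    have 1: "(\<lambda>p. co \<gamma> p * of_bool (\<epsilon> = \<beta>)) differentiable at p"
      and 2: "(\<lambda>p. of_bool (\<gamma> = \<beta>) * co \<epsilon> p) differentiable at p"
      by (intro differentiable_mult d differentiable_const)+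
    show ?thesis
      by (simp only: pd_add[OF 1 2] pd_mult[OF d differentiable_const] pd_mult[OF differentiable_const d] pd_co pd_const)
  qed
  ultimately show ?thesis by (simp only: of_bool_conj)
qed

text \<open>The identities are evaluated at the origin, where derivatives of any order see only the
  unit ball. Polynomials can thus stand in for compactly supported functions.\<close>

lemma ex_test_function:
  assumes m: "smooth_on UNIV (m :: plane \<Rightarrow> real)"
  obtains f where "smooth_on UNIV f" "compact_supp f" "\<And>p. p \<in> ball 0 1 \<Longrightarrow> f p = m p"
proof -
  obtain z :: "plane \<Rightarrow> real" where "smooth_on UNIV z" "\<And>p. 0 \<le> z p" "\<And>p. z p \<le> 1"
    "\<And>p. dist p 0 \<le> 1 \<Longrightarrow> z p = 1" "\<And>p. dist p 0 \<ge> 2 * 1 \<Longrightarrow> z p = 0"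
    by (rule ex_plateau[OF zero_less_one, of "0::plane"]) (rule that)
  note z = this(1,4,5)
  have "z p * m p = 0" if "p \<notin> cball 0 2" for p
  proof -
    have "\<not> dist p 0 \<le> 2" using that unfolding mem_cball dist_commute[of 0] .
    then have "z p = 0" by (intro z(3)) linarith
    then show ?thesis by simp
  qed
  then have 1: "compact_supp (\<lambda>p. z p * m p)"
    unfolding compact_supp_def by (intro exI[of _ "cball 0 2"] conjI compact_cball) iprover
  have 2: "smooth_on UNIV (\<lambda>p. z p * m p)" by (rule smooth_on_mult[OF open_UNIV z(1) m])
  have 3: "z p * m p = m p" if "p \<in> ball 0 1" for p
  proof -
    have "dist p 0 < 1" using that unfolding mem_ball dist_commute[of 0] .
    then have "z p = 1" by (intro z(2)) linarith
    then show ?thesis by simp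
  qed
  show ?thesis by (rule that[OF 2 1 3])
qed

text \<open>A polynomial displacement would leave \<open>U\<close>; it is cut off to become bounded
  and then scaled by \<open>e\<close>. The scale cancels later, since the identities drawn from it
  are linear in the displacement.\<close>

lemma ex_config:
  fixes U :: "(real^'n) set"
  assumes U: "open U" "y \<in> U" and m: "smooth_on UNIV (m :: plane \<Rightarrow> real)"
  obtains e u where "e > 0" "config U u" "\<And>p. p \<in> ball 0 1 \<Longrightarrow> u p = y + (e * m p) *\<^sub>R v"
proof -
  obtain f where f: "smooth_on UNIV f" "compact_supp f" "\<And>p. p \<in> ball 0 1 \<Longrightarrow> f p = m p"
    using ex_test_function[OF m] by blast
  obtain r where r: "r > 0" "\<And>p. p \<notin> cbox (-r, -r) (r, r) \<Longrightarrow> f p = 0"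
    using compact_supp_box[OF f(2)] by blast
  have "compact (f ` cbox (-r, -r) (r, r))"
    by (intro compact_continuous_image continuous_on_subset[OF smooth_on_continuous[OF f(1)]]) auto
  then have "bounded (f ` cbox (-r, -r) (r, r))" by (rule compact_imp_bounded)
  then obtain C where C: "C > 0" "\<And>p. p \<in> cbox (-r, -r) (r, r) \<Longrightarrow> norm (f p) \<le> C"
    unfolding bounded_pos by blast
  have C': "\<bar>f p\<bar> \<le> C" for p using C r(2)[of p] by (cases "p \<in> cbox (-r, -r) (r, r)") auto
  obtain d where d: "d > 0" "ball y d \<subseteq> U" using U openE by blast
  \<comment> \<open>Keeps the displacement within \<open>d / 2\<close>. Adding 1 to
    \<open>norm v\<close> avoids a zero denominator when \<open>v\<close> vanishes.\<close>
  define e where "e = d / (2 * C * (norm v + 1))"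
  have nv: "norm v + 1 > 0" using norm_ge_zero[of v] by linarith
  have e: "e > 0" unfolding e_def using d C nv by (intro divide_pos_pos mult_pos_pos) auto
  show ?thesis
  proof (rule that[OF e])
    show "y + (e * f p) *\<^sub>R v = y + (e * m p) *\<^sub>R v" if "p \<in> ball 0 1" for p
      using f(3)[OF that] by simp
    have "y + (e * f p) *\<^sub>R v \<in> U" for p
    proof -
      have "\<bar>e * f p\<bar> * norm v \<le> (e * C) * (norm v + 1)"
        using C'[of p] e C(1) by (intro mult_mono) (auto simp: abs_mult)
      also have "\<dots> = d / 2"
      proof -
        have "d / (2 * C * N) * C * N = d / 2" if "N > 0" for N :: real
          using that C(1) by (simp add: field_simps)
        then show ?thesis using nv by (simp only: e_def)
      qed
      finally show ?thesis using d by (auto simp: dist_norm subset_eq)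
    qed
    moreover have "smooth_on UNIV (\<lambda>p. y + (e * f p) *\<^sub>R v)"
      by (intro smooth_on_add smooth_on_scaleR smooth_on_mult smooth_on_const f) auto
    ultimately show "config U (\<lambda>p. y + (e * f p) *\<^sub>R v)" by (auto simp: config_def)
  qed
qed

context dn_operator
begin

abbreviation dA :: "bool \<Rightarrow> real^'n \<Rightarrow> real^'n \<Rightarrow> real^'n \<Rightarrow> real^'n \<Rightarrow> real" where
  "dA \<alpha> y a b v \<equiv> frechet_derivative (\<lambda>y. a \<bullet> (A \<alpha> y *v b)) (at y) v"

abbreviation d\<beta> :: "bool \<Rightarrow> real^'n \<Rightarrow> real^'n \<Rightarrow> real^'n \<Rightarrow> real^'n \<Rightarrow> real^'n" where
  "d\<beta> \<alpha> y a b v \<equiv> frechet_derivative (\<lambda>y. \<beta> \<alpha> y a b) (at y) v"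

lemma Bm_0 [simp]: "Bm \<alpha> y c 0 = 0"
  by (simp add: Bm_def vec_eq_iff)

lemma tjac_0 [simp]: "tjac f y 0 = 0"
  by (simp add: tjac_def vec_eq_iff)

lemma tjac_scaleR: "tjac f y (r *\<^sub>R v) = r *\<^sub>R tjac f y v"
  by (simp add: tjac_def vec_eq_iff)

text \<open>At a constant field everything containing a derivative of \<open>u\<close> disappears.
  What remains is bilinear in the second jets of \<open>\<psi>\<close> and \<open>\<tau>\<close>,
  which may be prescribed freely.\<close>

lemma jacobi_const:
  assumes ham: "hamiltonian U P" and y: "y \<in> U"
    and \<psi>: "smooth_on UNIV \<psi>" "compact_supp \<psi>"
    and \<tau>: "smooth_on UNIV \<tau>" "compact_supp \<tau>"
  shows "(\<Sum>\<alpha>\<in>UNIV. \<Sum>\<gamma>\<in>UNIV. pd \<alpha> \<psi> p * pd \<gamma> \<tau> p * dA \<alpha> y a b (A \<gamma> y *v c)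
       + \<psi> p * pd \<alpha> (pd \<gamma> \<tau>) p * (\<beta> \<alpha> y a b \<bullet> (A \<gamma> y *v c))
       + \<tau> p * pd \<alpha> (pd \<gamma> \<psi>) p * (\<beta> \<alpha> y c a \<bullet> (A \<gamma> y *v b)))
    = (\<Sum>\<alpha>\<in>UNIV. \<Sum>\<gamma>\<in>UNIV. pd \<alpha> \<tau> p * pd \<gamma> \<psi> p * dA \<alpha> y c a (A \<gamma> y *v b)
       + \<tau> p * pd \<alpha> (pd \<gamma> \<psi>) p * dA \<alpha> y c a (A \<gamma> y *v b)
       + (\<psi> p * pd \<alpha> (pd \<gamma> \<tau>) p + pd \<alpha> \<psi> p * pd \<gamma> \<tau> p) * dA \<gamma> y b c (A \<alpha> y *v a)
       - pd \<alpha> (pd \<gamma> (\<lambda>q. \<psi> q * \<tau> q)) p * (\<beta> \<gamma> y b c \<bullet> (A \<alpha> y *v a)))"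
proof -
  note sm = smooth_on_differentiable[where S = UNIV, OF _ UNIV_I]
  define u where "u = (\<lambda>q :: plane. y)"
  have u: "config U u" unfolding u_def config_def using y by auto
  have gr: "grad (\<lambda>y. a \<bullet> (A \<alpha> y *v b)) y \<bullet> v = dA \<alpha> y a b v" for \<alpha> a b v
    by (rule grad_inner[OF smooth_on_differentiable[OF smooth_AA y]])
  note d1 = sm[OF \<psi>(1), of p] sm[OF \<tau>(1), of p] sm[OF smooth_on_pd[OF \<psi>(1)], of _ p] sm[OF smooth_on_pd[OF \<tau>(1)], of _ p]
  have r: "smooth_on UNIV (\<lambda>q. \<psi> q * \<tau> q)" by (intro smooth_on_mult \<psi> \<tau>) auto
  have pu: "pd \<alpha> u q = 0" for \<alpha> q by (simp add: u_def)
  have w: "wf u b \<psi> = (\<lambda>q. \<Sum>\<gamma>\<in>UNIV. pd \<gamma> \<psi> q *\<^sub>R (A \<gamma> y *v b))" for b \<psi>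
    by (rule ext) (simp add: wf_def pu, simp add: u_def)
  have pw: "pd \<alpha> (wf u b \<psi>) p = (\<Sum>\<gamma>\<in>UNIV. pd \<alpha> (pd \<gamma> \<psi>) p *\<^sub>R (A \<gamma> y *v b))"
    if "smooth_on UNIV \<psi>" for \<alpha> b \<psi>
    unfolding w
    by (subst pd_sum)
      (auto intro!: differentiable_scaleR sm[OF smooth_on_pd[OF that]] simp: pd_scaleR sm[OF smooth_on_pd[OF that]])
  have gA': "gA u \<alpha> a b = (\<lambda>q. grad (\<lambda>y. a \<bullet> (A \<alpha> y *v b)) y)" for \<alpha> a b
    unfolding gA_def[OF u, abs_def] by (simp only: u_def)
  have c\<beta>': "c\<beta> u \<alpha> a b q = 0" for \<alpha> a b q by (simp add: c\<beta>_def[OF u] pu)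
  have pr: "pd \<gamma> (\<lambda>q. (\<psi> q * \<tau> q) *\<^sub>R \<beta> \<gamma> y b c) q = pd \<gamma> (\<lambda>q. \<psi> q * \<tau> q) q *\<^sub>R \<beta> \<gamma> y b c" for \<gamma> q
    using pd_scaleR[OF sm[OF r], of "\<lambda>_. \<beta> \<gamma> y b c"] by simp
  have \<delta>': "\<delta> u \<psi> b \<tau> c = (\<lambda>q. \<Sum>\<gamma>\<in>UNIV. (\<psi> q * pd \<gamma> \<tau> q) *\<^sub>R grad (\<lambda>y. b \<bullet> (A \<gamma> y *v c)) y
       - pd \<gamma> (\<lambda>q. \<psi> q * \<tau> q) q *\<^sub>R \<beta> \<gamma> y b c)"
    by (rule ext) (simp add: \<delta>_def[OF u] gA' c\<beta>', simp add: u_def pr)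
  have p\<delta>: "pd \<alpha> (\<delta> u \<psi> b \<tau> c) p = (\<Sum>\<gamma>\<in>UNIV. (\<psi> p * pd \<alpha> (pd \<gamma> \<tau>) p + pd \<alpha> \<psi> p * pd \<gamma> \<tau> p) *\<^sub>R grad (\<lambda>y. b \<bullet> (A \<gamma> y *v c)) y
       - pd \<alpha> (pd \<gamma> (\<lambda>q. \<psi> q * \<tau> q)) p *\<^sub>R \<beta> \<gamma> y b c)" for \<alpha>
  proof -
    have 1: "(\<lambda>q. \<psi> q * pd \<gamma> \<tau> q) differentiable at p" for \<gamma>
      by (intro differentiable_mult d1)
    have 2: "(\<lambda>q. (\<psi> q * pd \<gamma> \<tau> q) *\<^sub>R grad (\<lambda>y. b \<bullet> (A \<gamma> y *v c)) y) differentiable at p" for \<gamma>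
      by (intro differentiable_scaleR 1) auto
    have 3: "(\<lambda>q. pd \<gamma> (\<lambda>q. \<psi> q * \<tau> q) q *\<^sub>R \<beta> \<gamma> y b c) differentiable at p" for \<gamma>
      by (intro differentiable_scaleR sm[OF smooth_on_pd[OF r]]) auto
    show ?thesis unfolding \<delta>'
      by (subst pd_sum)
        (auto intro!: differentiable_diff 2 3 simp: pd_diff 2 3 pd_scaleR 1 sm[OF smooth_on_pd[OF r]] pd_mult d1)
  qed
  have *: "pd \<alpha> (\<lambda>q. \<tau> q * (gA u \<alpha> c a q \<bullet> wf u b \<psi> q) + \<delta> u \<psi> b \<tau> c q \<bullet> (A \<alpha> (u q) *v a)) p
      = pd \<alpha> \<tau> p * (gA u \<alpha> c a p \<bullet> wf u b \<psi> p) + \<tau> p * (gA u \<alpha> c a p \<bullet> pd \<alpha> (wf u b \<psi>) p)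
        + pd \<alpha> (\<delta> u \<psi> b \<tau> c) p \<bullet> (A \<alpha> y *v a)" for \<alpha>
  proof -
    note dw = sm[OF smooth_wf[OF u \<psi>(1)], of b p] and d\<delta> = sm[OF smooth_\<delta>[OF u \<psi>(1) \<tau>(1)], of b c p]
    have 1: "(\<lambda>q. G \<bullet> wf u b \<psi> q) differentiable at p" and 2: "(\<lambda>q. \<delta> u \<psi> b \<tau> c q \<bullet> G) differentiable at p" for G
      by (intro differentiable_inner dw d\<delta> differentiable_const)+
    have 3: "(\<lambda>q. \<tau> q * (G \<bullet> wf u b \<psi> q)) differentiable at p" for G by (intro differentiable_mult d1 1)
    show ?thesis
      unfolding gA' by (simp add: u_def[THEN fun_cong] pd_add 2 3 pd_mult d1 1 pd_inner dw d\<delta>)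
  qed
  show ?thesis
    using jacobi_pointwise[OF u ham \<psi> \<tau>, of a b c p]
    unfolding *
    unfolding p\<delta> dQ_def[OF u] pw[OF \<psi>(1)] pw[OF \<tau>(1)]
    unfolding c\<beta>' gA' w pu Bm_0
    by (simp add: UNIV_bool u_def gr inner_left_distrib inner_right_distrib inner_diff_left algebra_simps)
qed

end

section \<open>Pointwise consequences of the Hamiltonian property\<close>

context dn_operator
begin

lemma pd_ball:
  assumes "\<And>p. p \<in> ball 0 1 \<Longrightarrow> f p = g p"
  shows "p \<in> ball 0 1 \<Longrightarrow> pd \<alpha> f p = pd \<alpha> g p"
  by (rule pd_cong_open[of "ball 0 1"]) (use assms in auto)

lemma bool_delta:
  fixes f :: "bool \<Rightarrow> real"
  shows "(\<Sum>\<alpha>\<in>UNIV. of_bool (\<gamma> = \<alpha>) * f \<alpha>) = f \<gamma>"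
  by (cases \<gamma>) (simp_all add: UNIV_bool)

text \<open>Constant \<open>u\<close> and a \<open>\<psi>\<close> vanishing to first order isolate
  the principal part: a skew-adjoint first-order operator has symmetric leading
  coefficients.\<close>

theorem skew_A:
  assumes ham: "hamiltonian U P" and y: "y \<in> U"
  shows "a \<bullet> (A \<gamma> y *v b) = b \<bullet> (A \<gamma> y *v a)"
proof -
  obtain \<psi> :: "plane \<Rightarrow> real" where \<psi>: "smooth_on UNIV \<psi>" "compact_supp \<psi>" "\<And>p. p \<in> ball 0 1 \<Longrightarrow> \<psi> p = co \<gamma> p"
    by (rule ex_test_function[OF smooth_co]) blast
  have u: "config U (\<lambda>q. y)" unfolding config_def using y by auto
  have 0: "(0::plane) \<in> ball 0 1" by simp
  have v: "\<psi> 0 = 0" "pd \<alpha> \<psi> 0 = of_bool (\<gamma> = \<alpha>)" for \<alpha>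
    using \<psi>(3)[OF 0] pd_ball[OF \<psi>(3) 0] by (simp_all add: pd_co)
  have d: "\<psi> differentiable at 0" by (rule smooth_on_differentiable[OF \<psi>(1)]) auto
  have "pd \<alpha> (\<lambda>q. \<psi> q * (b \<bullet> (A \<alpha> y *v a))) 0 = of_bool (\<gamma> = \<alpha>) * (b \<bullet> (A \<alpha> y *v a))" for \<alpha>
    using pd_mult[OF d, of "\<lambda>_. b \<bullet> (A \<alpha> y *v a)" \<alpha>] v by simp
  then show ?thesis
    using skew_pointwise[OF u ham \<psi>(1,2), of a b 0] v by (simp add: inner_wf bool_delta)
qed

text \<open>With \<open>\<psi> = 1\<close> near the origin and \<open>u\<close> affine there, the
  zero-order part of skew-adjointness remains. In components it reads
  \<open>d_k g^ij = b^ij_k + b^ji_k\<close>: the connection is compatible with the metric.\<close>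

theorem deriv_A:
  assumes ham: "hamiltonian U P" and y: "y \<in> U"
  shows "dA \<gamma> y a b v = (\<beta> \<gamma> y a b + \<beta> \<gamma> y b a) \<bullet> v"
proof -
  obtain e u where e: "e > 0" and u: "config U u" "\<And>p. p \<in> ball 0 1 \<Longrightarrow> u p = y + (e * co \<gamma> p) *\<^sub>R v"
    by (rule ex_config[OF open_U y smooth_co]) blast
  obtain \<psi> :: "plane \<Rightarrow> real" where \<psi>: "smooth_on UNIV \<psi>" "compact_supp \<psi>" "\<And>p. p \<in> ball 0 1 \<Longrightarrow> \<psi> p = 1"
    by (rule ex_test_function[OF smooth_on_const[OF open_UNIV, of "1::real"]]) blast
  have 0: "(0::plane) \<in> ball 0 1" by simp
  have v: "\<psi> 0 = 1" "pd \<alpha> \<psi> 0 = 0" for \<alpha>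
    using \<psi>(3)[OF 0] pd_ball[OF \<psi>(3) 0] by (simp_all add: pd_const)
  have d: "\<psi> differentiable at 0" by (rule smooth_on_differentiable[OF \<psi>(1)]) auto
  have u0: "u 0 = y" using u(2)[OF 0] by simp
  have du: "u differentiable at 0" by (rule smooth_on_differentiable[OF u_smooth[OF u(1)]]) auto
  have dAA: "(\<lambda>y. b \<bullet> (A \<alpha> y *v a)) differentiable at (u 0)" for \<alpha> a b
    by (rule smooth_on_differentiable[OF smooth_AA u_in[OF u(1)]])
  have pu: "pd \<alpha> u 0 = of_bool (\<gamma> = \<alpha>) *\<^sub>R (e *\<^sub>R v)" for \<alpha>
  proof -
    have dc: "co \<gamma> differentiable at 0" by (rule smooth_on_differentiable[OF smooth_co]) auto
    have 1: "(\<lambda>p. e * co \<gamma> p) differentiable at 0" by (intro differentiable_mult dc differentiable_const)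
    have 2: "(\<lambda>p. (e * co \<gamma> p) *\<^sub>R v) differentiable at 0" by (intro differentiable_scaleR 1 differentiable_const)
    have "pd \<alpha> u 0 = pd \<alpha> (\<lambda>p. y + (e * co \<gamma> p) *\<^sub>R v) 0" by (rule pd_ball[OF u(2) 0])
    then show ?thesis
      by (simp only: pd_add[OF differentiable_const 2] pd_scaleR[OF 1 differentiable_const]
          pd_mult[OF differentiable_const dc] pd_const pd_co) (simp add: mult.commute)
  qed
  have "pd \<alpha> (\<lambda>q. \<psi> q * (b \<bullet> (A \<alpha> (u q) *v a))) 0 = of_bool (\<gamma> = \<alpha>) * (e * dA \<alpha> y b a v)" for \<alpha>
  proof -
    have 1: "(\<lambda>q. b \<bullet> (A \<alpha> (u q) *v a)) differentiable at 0"
      using differentiable_chain_at[OF du dAA[of b \<alpha> a]] by (simp add: o_def)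
    have "pd \<alpha> (\<lambda>q. \<psi> q * (b \<bullet> (A \<alpha> (u q) *v a))) 0 = pd \<alpha> (\<lambda>q. b \<bullet> (A \<alpha> (u q) *v a)) 0"
      by (simp add: pd_mult[OF d 1] v)
    also have "\<dots> = dA \<alpha> (u 0) b a (pd \<alpha> u 0)"
      by (rule pd_compose[OF dAA du])
    also have "\<dots> = of_bool (\<gamma> = \<alpha>) * (e * dA \<alpha> y b a v)"
      using linear_scale[OF linear_frechet_derivative[OF dAA]] by (simp only: u0 pu real_scaleR_def)
    finally show ?thesis .
  qed
  then have "e * ((\<beta> \<gamma> y a b + \<beta> \<gamma> y b a) \<bullet> v) = e * dA \<gamma> y b a v"
    using skew_pointwise[OF u(1) ham \<psi>(1,2), of a b 0] v
    by (cases \<gamma>) (simp_all add: inner_wf pu u0 UNIV_bool inner_left_distrib algebra_simps)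
  moreover have "dA \<gamma> y b a v = dA \<gamma> y a b v"
  proof -
    have *: "((\<lambda>y. b \<bullet> (A \<gamma> y *v a)) has_derivative dA \<gamma> y b a) (at y)"
      by (rule smooth_on_has_derivative[OF smooth_AA y])
    have "((\<lambda>y. a \<bullet> (A \<gamma> y *v b)) has_derivative dA \<gamma> y b a) (at y)"
      by (rule has_derivative_transform_within_open[OF * open_U y]) (rule skew_A[OF ham])
    then show ?thesis by (simp add: frechet_derivative_eq)
  qed
  ultimately show ?thesis using e by simp
qed

text \<open>\<open>\<psi> = 1\<close> and quadratic \<open>\<tau>\<close> leave only second
  derivatives of \<open>\<tau>\<close>. For \<open>\<gamma> = \<epsilon>\<close> this is
  \<open>g^is b^jk_s = g^js b^ik_s\<close>, that is, vanishing torsion; for distinct indices it is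
  the polarized form.\<close>

theorem torsion_identity:
  assumes ham: "hamiltonian U P" and y: "y \<in> U"
  shows "\<beta> \<gamma> y a b \<bullet> (A \<epsilon> y *v c) + \<beta> \<epsilon> y a b \<bullet> (A \<gamma> y *v c)
    = \<beta> \<epsilon> y c b \<bullet> (A \<gamma> y *v a) + \<beta> \<gamma> y c b \<bullet> (A \<epsilon> y *v a)"
proof -
  obtain \<psi> :: "plane \<Rightarrow> real" where \<psi>: "smooth_on UNIV \<psi>" "compact_supp \<psi>" "\<And>p. p \<in> ball 0 1 \<Longrightarrow> \<psi> p = 1"
    by (rule ex_test_function[OF smooth_on_const[OF open_UNIV, of "1::real"]]) blast
  obtain \<tau> :: "plane \<Rightarrow> real" where \<tau>: "smooth_on UNIV \<tau>" "compact_supp \<tau>" "\<And>p. p \<in> ball 0 1 \<Longrightarrow> \<tau> p = quad \<gamma> \<epsilon> p"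
    by (rule ex_test_function[OF smooth_quad]) blast
  have 0: "(0::plane) \<in> ball 0 1" by simp
  have v: "\<psi> 0 = 1" "pd \<alpha> \<psi> 0 = 0" "pd \<alpha> (pd \<alpha>' \<psi>) 0 = 0"
    "\<tau> 0 = 0" "pd \<alpha> \<tau> 0 = 0" "pd \<alpha> (pd \<alpha>' \<tau>) 0 = pd \<alpha> (pd \<alpha>' (quad \<gamma> \<epsilon>)) 0"
    "pd \<alpha> (pd \<alpha>' (\<lambda>q. \<psi> q * \<tau> q)) 0 = pd \<alpha> (pd \<alpha>' (quad \<gamma> \<epsilon>)) 0" for \<alpha> \<alpha>'
    subgoal using \<psi>(3)[OF 0] by simp
    subgoal using pd_ball[OF \<psi>(3) 0] by (simp add: pd_const)
    subgoal using pd_ball[OF pd_ball[OF \<psi>(3)] 0] by (simp add: pd_const[abs_def])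
    subgoal using \<tau>(3)[OF 0] by (simp add: quad_def)
    subgoal using pd_ball[OF \<tau>(3) 0] by (simp add: pd_quad)
    subgoal by (rule pd_ball[OF pd_ball[OF \<tau>(3)] 0])
    subgoal by (rule pd_ball[OF pd_ball 0]) (simp_all add: \<psi>(3) \<tau>(3))
    done
  have dA: "dA \<alpha> y b c v = \<beta> \<alpha> y b c \<bullet> v + \<beta> \<alpha> y c b \<bullet> v" for \<alpha> v
    by (simp add: deriv_A[OF ham y] inner_left_distrib)
  show ?thesis
    using jacobi_const[OF ham y \<psi>(1,2) \<tau>(1,2), of 0 a b c]
    unfolding v pd_pd_quad
    by (cases \<gamma>; cases \<epsilon>) (simp_all add: UNIV_bool dA algebra_simps)
qed

text \<open>Linear \<open>\<psi>\<close> and \<open>\<tau>\<close> select the products of first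
  derivatives. Applied to the pair of different metrics, this is the source of the cyclic identity
  \<open>T_cyclic\<close>.\<close>

theorem first_order_identity:
  assumes ham: "hamiltonian U P" and y: "y \<in> U"
  shows "dA \<gamma> y a b (A \<epsilon> y *v c) = dA \<epsilon> y c a (A \<gamma> y *v b) + dA \<epsilon> y b c (A \<gamma> y *v a)
    - \<beta> \<epsilon> y b c \<bullet> (A \<gamma> y *v a) - \<beta> \<gamma> y b c \<bullet> (A \<epsilon> y *v a)"
proof -
  obtain \<psi> :: "plane \<Rightarrow> real" where \<psi>: "smooth_on UNIV \<psi>" "compact_supp \<psi>" "\<And>p. p \<in> ball 0 1 \<Longrightarrow> \<psi> p = co \<gamma> p"
    by (rule ex_test_function[OF smooth_co]) blast
  obtain \<tau> :: "plane \<Rightarrow> real" where \<tau>: "smooth_on UNIV \<tau>" "compact_supp \<tau>" "\<And>p. p \<in> ball 0 1 \<Longrightarrow> \<tau> p = co \<epsilon> p"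
    by (rule ex_test_function[OF smooth_co]) blast
  have 0: "(0::plane) \<in> ball 0 1" by simp
  have v: "\<psi> 0 = 0" "pd \<alpha> \<psi> 0 = of_bool (\<gamma> = \<alpha>)" "\<tau> 0 = 0" "pd \<alpha> \<tau> 0 = of_bool (\<epsilon> = \<alpha>)"
    "pd \<alpha> (pd \<alpha>' (\<lambda>q. \<psi> q * \<tau> q)) 0 = pd \<alpha> (pd \<alpha>' (quad \<gamma> \<epsilon>)) 0" for \<alpha> \<alpha>'
    subgoal using \<psi>(3)[OF 0] by simp
    subgoal using pd_ball[OF \<psi>(3) 0] by (simp add: pd_co)
    subgoal using \<tau>(3)[OF 0] by simp
    subgoal using pd_ball[OF \<tau>(3) 0] by (simp add: pd_co)
    subgoal by (rule pd_ball[OF pd_ball 0]) (simp_all add: \<psi>(3) \<tau>(3) quad_def)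
    done
  show ?thesis
    using jacobi_const[OF ham y \<psi>(1,2) \<tau>(1,2), of 0 a b c]
    unfolding v pd_pd_quad
    by (cases \<gamma>; cases \<epsilon>) (simp_all add: UNIV_bool algebra_simps)
qed

text \<open>Here \<open>\<psi> = \<tau> = 1\<close>, and the displacement is quadratic so that the
  first derivatives of \<open>u\<close> vanish at the origin: products of them drop out and only
  second derivatives of \<open>u\<close> survive. Their coefficient is the curvature expression,
  derivatives of \<open>\<beta>\<close> against products of two \<open>\<beta>\<close>.\<close>

theorem second_order_identity:
  assumes ham: "hamiltonian U P" and y: "y \<in> U"
  shows "\<beta> \<epsilon> y (\<beta> \<gamma> y a b) c \<bullet> v + \<beta> \<gamma> y (\<beta> \<epsilon> y a b) c \<bullet> v
      - \<beta> \<epsilon> y (\<beta> \<gamma> y a c) b \<bullet> v - \<beta> \<gamma> y (\<beta> \<epsilon> y a c) b \<bullet> v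
    = d\<beta> \<epsilon> y b c (A \<gamma> y *v a) \<bullet> v - d\<beta> \<epsilon> y b c v \<bullet> (A \<gamma> y *v a)
      + d\<beta> \<gamma> y b c (A \<epsilon> y *v a) \<bullet> v - d\<beta> \<gamma> y b c v \<bullet> (A \<epsilon> y *v a)"
proof -
  note sm = smooth_on_differentiable[where S = UNIV, OF _ UNIV_I]
  obtain e u where e: "e > 0" and u: "config U u" "\<And>p. p \<in> ball 0 1 \<Longrightarrow> u p = y + (e * quad \<gamma> \<epsilon> p) *\<^sub>R v"
    by (rule ex_config[OF open_U y smooth_quad]) blast
  obtain \<psi> :: "plane \<Rightarrow> real" where \<psi>: "smooth_on UNIV \<psi>" "compact_supp \<psi>" "\<And>p. p \<in> ball 0 1 \<Longrightarrow> \<psi> p = 1"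
    by (rule ex_test_function[OF smooth_on_const[OF open_UNIV, of "1::real"]]) blast
  define m where "m \<alpha> p = e * pd \<alpha> (quad \<gamma> \<epsilon>) p" for \<alpha> p
  have 0: "(0::plane) \<in> ball 0 1" by simp
  have pq: "smooth_on UNIV (pd \<alpha> (quad \<gamma> \<epsilon>))" for \<alpha> by (intro smooth_on_pd smooth_quad)
  have m: "smooth_on UNIV (m \<alpha>)" for \<alpha>
    unfolding m_def[abs_def] by (intro smooth_on_mult smooth_on_const pq) auto
  have m0: "m \<alpha> 0 = 0" for \<alpha> by (simp add: m_def pd_quad)
  define q where "q \<alpha> \<alpha>' = (of_bool (\<gamma> = \<alpha> \<and> \<epsilon> = \<alpha>') + of_bool (\<gamma> = \<alpha>' \<and> \<epsilon> = \<alpha>) :: real)" for \<alpha> \<alpha>'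
  have pm: "pd \<alpha> (m \<alpha>') p = e * q \<alpha> \<alpha>'" for \<alpha> \<alpha>' p
    unfolding m_def[abs_def]
    by (simp add: pd_mult[OF differentiable_const sm[OF pq]] pd_pd_quad q_def)
  have pu: "pd \<alpha> u p = m \<alpha> p *\<^sub>R v" if p: "p \<in> ball 0 1" for \<alpha> p
  proof -
    have dq: "quad \<gamma> \<epsilon> differentiable at p" by (rule sm[OF smooth_quad])
    have 1: "(\<lambda>p. e * quad \<gamma> \<epsilon> p) differentiable at p" by (intro differentiable_mult dq differentiable_const)
    have 2: "(\<lambda>p. (e * quad \<gamma> \<epsilon> p) *\<^sub>R v) differentiable at p" by (intro differentiable_scaleR 1 differentiable_const)
    have "pd \<alpha> u p = pd \<alpha> (\<lambda>p. y + (e * quad \<gamma> \<epsilon> p) *\<^sub>R v) p" by (rule pd_ball[OF u(2) p])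
    then show ?thesis
      by (simp only: pd_add[OF differentiable_const 2] pd_scaleR[OF 1 differentiable_const]
          pd_mult[OF differentiable_const dq] pd_const) (simp add: m_def)
  qed
  have u0: "u 0 = y" using u(2)[OF 0] by (simp add: quad_def)
  have pu0: "pd \<alpha> u 0 = 0" for \<alpha> using pu[OF 0] m0 by simp
  have v1: "\<psi> p = 1" "pd \<alpha> \<psi> p = 0" if "p \<in> ball 0 1" for p \<alpha>
    using \<psi>(3)[OF that] pd_ball[OF \<psi>(3) that] by (simp_all add: pd_const)
  have sB: "smooth_on UNIV (\<lambda>p. Bm \<alpha> (u p) b v)" for \<alpha> b
    by (rule smooth_on_vec) (auto simp: Bm_def intro!: smooth_on_inner smooth_\<beta>u[OF u(1)] smooth_on_const)
  have w: "wf u b \<psi> p = (\<Sum>\<alpha>\<in>UNIV. m \<alpha> p *\<^sub>R Bm \<alpha> (u p) b v)" if "p \<in> ball 0 1" for b p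
    by (simp add: wf_def v1[OF that] pu[OF that] Bm_scaleR)
  have w0: "wf u b \<psi> 0 = 0" for b by (simp add: w[OF 0] m0)
  \<comment> \<open>Every \<open>m\<close> vanishes at the origin, so in a product the derivative
    has to fall on \<open>m\<close>; the other factor is merely evaluated.\<close>
  have prod0: "pd \<alpha> (\<lambda>p. \<Sum>\<alpha>'\<in>UNIV. m \<alpha>' p *\<^sub>R F \<alpha>' p) 0 = (\<Sum>\<alpha>'\<in>UNIV. (e * q \<alpha> \<alpha>') *\<^sub>R F \<alpha>' 0)"
    if F: "\<And>\<alpha>'. smooth_on UNIV (F \<alpha>')" for \<alpha> and F :: "bool \<Rightarrow> plane \<Rightarrow> real^'n"
  proof -
    have "(\<lambda>p. m \<alpha>' p *\<^sub>R F \<alpha>' p) differentiable at 0" for \<alpha>'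
      by (intro differentiable_scaleR sm[OF m] sm[OF F])
    then have "pd \<alpha> (\<lambda>p. \<Sum>\<alpha>'\<in>UNIV. m \<alpha>' p *\<^sub>R F \<alpha>' p) 0 = (\<Sum>\<alpha>'\<in>UNIV. pd \<alpha> (\<lambda>p. m \<alpha>' p *\<^sub>R F \<alpha>' p) 0)"
      by (intro pd_sum)
    then show ?thesis by (simp only: pd_scaleR[OF sm[OF m] sm[OF F]] m0 pm) simp
  qed
  have pw: "pd \<alpha> (wf u b \<psi>) 0 = (\<Sum>\<alpha>'\<in>UNIV. (e * q \<alpha> \<alpha>') *\<^sub>R Bm \<alpha>' y b v)" for \<alpha> b
  proof -
    have "pd \<alpha> (wf u b \<psi>) 0 = pd \<alpha> (\<lambda>p. \<Sum>\<alpha>'\<in>UNIV. m \<alpha>' p *\<^sub>R Bm \<alpha>' (u p) b v) 0"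
      by (rule pd_ball[OF w 0])
    then show ?thesis unfolding prod0[OF sB] u0 .
  qed
  \<comment> \<open>With \<open>\<psi> = \<tau> = 1\<close> the variational derivative becomes the
    exterior derivative of the one-form \<open>\<beta> \<alpha> y b c\<close> contracted with
    \<open>v\<close>; compare \<open>D0\<close>.\<close>
  define D where "D \<alpha> p = tjac (\<lambda>y. \<beta> \<alpha> y b c) (u p) v - d\<beta> \<alpha> (u p) b c v" for \<alpha> p
  have sD: "smooth_on UNIV (D \<alpha>)" for \<alpha>
    unfolding D_def[abs_def]
    by (intro smooth_on_diff smooth_on_tjac_compose[OF _ smooth_\<beta> u_smooth u_range] smooth_on_const
        smooth_on_compose[OF _ smooth_on_dderiv[OF smooth_\<beta>] u_smooth u_range] u(1)) auto
  have \<delta>': "\<delta> u \<psi> b \<psi> c p = (\<Sum>\<alpha>\<in>UNIV. m \<alpha> p *\<^sub>R D \<alpha> p)" if p: "p \<in> ball 0 1" for p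
  proof -
    have "pd \<alpha> (\<lambda>q. (\<psi> q * \<psi> q) *\<^sub>R \<beta> \<alpha> (u q) b c) p = m \<alpha> p *\<^sub>R d\<beta> \<alpha> (u p) b c v" for \<alpha>
    proof -
      have "pd \<alpha> (\<lambda>q. (\<psi> q * \<psi> q) *\<^sub>R \<beta> \<alpha> (u q) b c) p = pd \<alpha> (\<lambda>q. \<beta> \<alpha> (u q) b c) p"
        by (rule pd_ball[OF _ p]) (simp add: v1)
      also have "\<dots> = d\<beta> \<alpha> (u p) b c (pd \<alpha> u p)"
        by (rule pd_compose[OF smooth_on_differentiable[OF smooth_\<beta> u_in[OF u(1)]] sm[OF u_smooth[OF u(1)]]])
      also have "\<dots> = m \<alpha> p *\<^sub>R d\<beta> \<alpha> (u p) b c v"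
        unfolding pu[OF p]
        by (rule linear_scale[OF linear_frechet_derivative[OF smooth_on_differentiable[OF smooth_\<beta> u_in[OF u(1)]]]])
      finally show ?thesis .
    qed
    then show ?thesis
      by (simp add: \<delta>_def[OF u(1)] v1[OF p] c\<beta>_def[OF u(1)] pu[OF p] tjac_scaleR D_def scaleR_diff_right)
  qed
  have \<delta>0: "\<delta> u \<psi> b \<psi> c 0 = 0" by (simp add: \<delta>'[OF 0] m0)
  have p\<delta>: "pd \<alpha> (\<delta> u \<psi> b \<psi> c) 0 = (\<Sum>\<alpha>'\<in>UNIV. (e * q \<alpha> \<alpha>') *\<^sub>R D \<alpha>' 0)" for \<alpha>
  proof -
    have "pd \<alpha> (\<delta> u \<psi> b \<psi> c) 0 = pd \<alpha> (\<lambda>p. \<Sum>\<alpha>'\<in>UNIV. m \<alpha>' p *\<^sub>R D \<alpha>' p) 0"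
      by (rule pd_ball[OF \<delta>' 0])
    then show ?thesis unfolding prod0[OF sD] .
  qed
  have gA: "gA u \<alpha> c a 0 \<bullet> h = \<beta> \<alpha> y c a \<bullet> h + \<beta> \<alpha> y a c \<bullet> h" for \<alpha> h
    unfolding gA_def[OF u(1)] u0 grad_inner[OF smooth_on_differentiable[OF smooth_AA y]]
    by (simp add: deriv_A[OF ham y] inner_left_distrib)
  have rhs: "pd \<alpha> (\<lambda>q. \<psi> q * (gA u \<alpha> c a q \<bullet> wf u b \<psi> q) + \<delta> u \<psi> b \<psi> c q \<bullet> (A \<alpha> (u q) *v a)) 0
      = gA u \<alpha> c a 0 \<bullet> pd \<alpha> (wf u b \<psi>) 0 + pd \<alpha> (\<delta> u \<psi> b \<psi> c) 0 \<bullet> (A \<alpha> y *v a)" for \<alpha>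
  proof -
    note d = sm[OF smooth_gA[OF u(1)], of \<alpha> c a 0] sm[OF smooth_wf[OF u(1) \<psi>(1)], of b 0]
      sm[OF smooth_\<delta>[OF u(1) \<psi>(1) \<psi>(1)], of b c 0] sm[OF smooth_Au[OF u(1)], of \<alpha> a 0]
    have 1: "(\<lambda>q. gA u \<alpha> c a q \<bullet> wf u b \<psi> q) differentiable at 0" by (intro differentiable_inner d)
    have 2: "(\<lambda>q. \<delta> u \<psi> b \<psi> c q \<bullet> (A \<alpha> (u q) *v a)) differentiable at 0" by (intro differentiable_inner d)
    have 3: "(\<lambda>q. \<psi> q * (gA u \<alpha> c a q \<bullet> wf u b \<psi> q)) differentiable at 0" by (intro differentiable_mult sm[OF \<psi>(1)] 1)
    show ?thesis
      by (simp only: pd_add[OF 3 2] pd_mult[OF sm[OF \<psi>(1)] 1] pd_inner[OF d(1,2)] pd_inner[OF d(3,4)] v1[OF 0] w0 \<delta>0 u0) simp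
  qed
  have "(\<Sum>\<alpha>\<in>UNIV. \<Sum>\<alpha>'\<in>UNIV. (e * q \<alpha> \<alpha>') * (\<beta> \<alpha> y a b \<bullet> Bm \<alpha>' y c v + \<beta> \<alpha> y c a \<bullet> Bm \<alpha>' y b v))
    = (\<Sum>\<alpha>\<in>UNIV. \<Sum>\<alpha>'\<in>UNIV. (e * q \<alpha> \<alpha>') * (\<beta> \<alpha> y c a \<bullet> Bm \<alpha>' y b v + \<beta> \<alpha> y a c \<bullet> Bm \<alpha>' y b v
        + D \<alpha>' 0 \<bullet> (A \<alpha> y *v a)))"
    using jacobi_pointwise[OF u(1) ham \<psi>(1,2) \<psi>(1,2), of a b c 0]
    unfolding rhs
    unfolding dQ_def[OF u(1)] w0 \<delta>0 v1[OF 0] pw p\<delta> u0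
    by (simp add: UNIV_bool inner_add_left inner_add_right gA algebra_simps)
  then have "e * (\<Sum>\<alpha>\<in>UNIV. \<Sum>\<alpha>'\<in>UNIV. q \<alpha> \<alpha>' * (\<beta> \<alpha>' y (\<beta> \<alpha> y a b) c \<bullet> v))
    = e * (\<Sum>\<alpha>\<in>UNIV. \<Sum>\<alpha>'\<in>UNIV. q \<alpha> \<alpha>' * (\<beta> \<alpha>' y (\<beta> \<alpha> y a c) b \<bullet> v + D \<alpha>' 0 \<bullet> (A \<alpha> y *v a)))"
    by (simp add: UNIV_bool inner_Bm algebra_simps)
  then have *: "(\<Sum>\<alpha>\<in>UNIV. \<Sum>\<alpha>'\<in>UNIV. q \<alpha> \<alpha>' * (\<beta> \<alpha>' y (\<beta> \<alpha> y a b) c \<bullet> v))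
    = (\<Sum>\<alpha>\<in>UNIV. \<Sum>\<alpha>'\<in>UNIV. q \<alpha> \<alpha>' * (\<beta> \<alpha>' y (\<beta> \<alpha> y a c) b \<bullet> v + D \<alpha>' 0 \<bullet> (A \<alpha> y *v a)))"
    using e by simp
  have D0: "D \<alpha> 0 \<bullet> h = d\<beta> \<alpha> y b c h \<bullet> v - d\<beta> \<alpha> y b c v \<bullet> h" for \<alpha> h
    unfolding D_def u0 inner_diff_left tjac_inner[OF smooth_on_differentiable[OF smooth_\<beta> y]] ..
  show ?thesis
    using * unfolding D0 q_def
    by (cases \<gamma>; cases \<epsilon>) (simp_all add: UNIV_bool algebra_simps)
qed

end

section \<open>The connections of the two metrics\<close>

lemma smooth_on_prod:
  fixes f :: "'i \<Rightarrow> 'a::real_normed_vector \<Rightarrow> real"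
  assumes "open S" and "\<And>i. i \<in> I \<Longrightarrow> smooth_on S (f i)"
  shows "smooth_on S (\<lambda>x. \<Prod>i\<in>I. f i x)"
  using assms(2) by (induction I rule: infinite_finite_induct) (auto intro!: smooth_on_mult assms(1))

lemma smooth_on_det:
  fixes M :: "'a::real_normed_vector \<Rightarrow> real^'n^'n"
  assumes "open S" and "\<And>i j. smooth_on S (\<lambda>x. M x $ i $ j)"
  shows "smooth_on S (\<lambda>x. det (M x))"
  unfolding det_def
  by (intro smooth_on_sum smooth_on_mult smooth_on_prod smooth_on_const assms)

lemma matrix_inv_cancel:
  fixes M :: "real^'n^'n"
  assumes "det M \<noteq> 0"
  shows "M ** matrix_inv M = mat 1" "matrix_inv M ** M = mat 1"
proof -
  have "invertible M" using assms by (simp add: invertible_det_nz)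
  then have "\<exists>M'. M ** M' = mat 1 \<and> M' ** M = mat 1" by (simp add: invertible_def)
  from someI_ex[OF this] show "M ** matrix_inv M = mat 1" "matrix_inv M ** M = mat 1"
    by (simp_all add: matrix_inv_def)
qed

text \<open>By Cramer's rule the entries are determinants in the smooth data divided by
  \<open>det (M x)\<close>.\<close>

lemma smooth_on_matrix_inv_vec:
  fixes M :: "'a::real_normed_vector \<Rightarrow> real^'n^'n"
  assumes S: "open S" and M: "smooth_on S M" and nz: "\<And>x. x \<in> S \<Longrightarrow> det (M x) \<noteq> 0"
    and b: "smooth_on S b"
  shows "smooth_on S (\<lambda>x. matrix_inv (M x) *v b x)"
proof (rule smooth_on_cong[OF S])
  let ?f = "\<lambda>x. \<chi> k. det (\<chi> i j. if j = k then b x $ i else M x $ i $ j) * inverse (det (M x))"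
  have Mij: "smooth_on S (\<lambda>x. M x $ i $ j)" for i j
    by (intro smooth_on_vec_nth S M)
  have "smooth_on S (\<lambda>x. if j = k then b x $ i else M x $ i $ j)" for i j k
    by (cases "j = k") (simp_all add: Mij smooth_on_vec_nth S b)
  then have d: "smooth_on S (\<lambda>x. det (\<chi> i j. if j = k then b x $ i else M x $ i $ j))" for k
    by (intro smooth_on_det[OF S]) simp
  have "smooth_on S (\<lambda>x. det (\<chi> i j. if j = k then b x $ i else M x $ i $ j) * inverse (det (M x)))" for k
    by (intro smooth_on_mult smooth_on_inverse d smooth_on_det Mij S nz)
  then show "smooth_on S ?f"
    by (intro smooth_on_vec S) simp
  fix x assume x: "x \<in> S"
  have "M x *v (matrix_inv (M x) *v b x) = b x"
    using nz[OF x] by (simp add: matrix_vector_mul_assoc matrix_inv_cancel)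
  then show "?f x = matrix_inv (M x) *v b x"
    using cramer[OF nz[OF x], of "matrix_inv (M x) *v b x" "b x"] by (simp add: divide_inverse)
qed

locale hamiltonian_dn_operator = dn_operator U A bc
  for U :: "(real^'n) set" and A bc +
  assumes ham: "hamiltonian U P" and nondeg: "\<And>y. y \<in> U \<Longrightarrow> det (A False y) \<noteq> 0"
begin

abbreviation G :: "real^'n \<Rightarrow> real^'n \<Rightarrow> real^'n" where "G y a \<equiv> A False y *v a"
abbreviation H :: "real^'n \<Rightarrow> real^'n \<Rightarrow> real^'n" where "H y a \<equiv> A True y *v a"
abbreviation Gi :: "real^'n \<Rightarrow> real^'n \<Rightarrow> real^'n" where "Gi y a \<equiv> matrix_inv (A False y) *v a"

text \<open>Minus the Levi-Civita connection of the first metric acting on covectors, and the difference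
  between the connections of the two metrics, with indices raised.\<close>
definition \<Gamma> :: "real^'n \<Rightarrow> real^'n \<Rightarrow> real^'n \<Rightarrow> real^'n" where
  "\<Gamma> y v c = - \<beta> False y (Gi y v) c"

definition T :: "real^'n \<Rightarrow> real^'n \<Rightarrow> real^'n \<Rightarrow> real^'n" where
  "T y a b = \<beta> True y a b + \<Gamma> y (H y a) b"

lemma linear_\<beta>_left: "linear (\<lambda>a. \<beta> \<alpha> y a b)"
  by (simp add: linear_iff \<beta>_add_left \<beta>_scaleR_left)

lemma linear_\<Gamma>_left: "linear (\<lambda>v. \<Gamma> y v c)" and linear_\<Gamma>_right: "linear (\<Gamma> y v)"
  unfolding \<Gamma>_def[abs_def]
  by (simp_all add: linear_iff \<beta>_add_left \<beta>_add_right \<beta>_scaleR_left \<beta>_scaleR_right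
      matrix_vector_right_distrib matrix_vector_mult_scaleR)

lemma linear_T_left: "linear (\<lambda>a. T y a b)" and linear_T_right: "linear (T y a)"
  unfolding T_def[abs_def]
  by (simp_all add: linear_iff \<beta>_add_left \<beta>_add_right \<beta>_scaleR_left \<beta>_scaleR_right
      matrix_vector_right_distrib matrix_vector_mult_scaleR linear_add[OF linear_\<Gamma>_left] linear_scale[OF linear_\<Gamma>_left]
      linear_add[OF linear_\<Gamma>_right] linear_scale[OF linear_\<Gamma>_right] scaleR_add_right)

lemma sum_axis: "(\<Sum>k\<in>UNIV. a $ k *\<^sub>R axis k 1) = (a :: real^'n)"
  by (simp add: basis_expansion flip: scalar_mult_eq_scaleR)

lemma linear_expand:
  assumes "linear f" shows "f a = (\<Sum>k\<in>UNIV. a $ k *\<^sub>R f (axis k 1 :: real^'n))"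
proof -
  have "f a = f (\<Sum>k\<in>UNIV. a $ k *\<^sub>R axis k 1)" by (simp only: sum_axis)
  then show ?thesis by (simp only: linear_sum[OF assms] linear_scale[OF assms])
qed

lemma smooth_\<Gamma>: "smooth_on U (\<lambda>y. \<Gamma> y v c)"
proof -
  have "smooth_on U (\<lambda>y. Gi y v $ k)" for k
    by (intro smooth_on_vec_nth smooth_on_matrix_inv_vec open_U smooth_A nondeg smooth_on_const)
  then have "smooth_on U (\<lambda>y. - (\<Sum>k\<in>UNIV. Gi y v $ k *\<^sub>R \<beta> False y (axis k 1) c))"
    by (intro smooth_on_uminus smooth_on_sum smooth_on_scaleR smooth_\<beta> open_U)
  then show ?thesis
    unfolding \<Gamma>_def by (subst linear_expand[OF linear_\<beta>_left])
qed

lemma \<Gamma>_minus_left: "\<Gamma> y (- v) c = - \<Gamma> y v c" by (rule linear_neg[OF linear_\<Gamma>_left])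
lemma \<Gamma>_diff_left: "\<Gamma> y (v - w) c = \<Gamma> y v c - \<Gamma> y w c" by (rule linear_diff[OF linear_\<Gamma>_left])
lemma T_minus_left: "T y (- a) c = - T y a c" by (rule linear_neg[OF linear_T_left])

lemma A_minus: "A \<alpha> y *v (- v) = - (A \<alpha> y *v v)" and A_diff: "A \<alpha> y *v (v - w) = A \<alpha> y *v v - A \<alpha> y *v w"
  by (simp_all add: linear_neg[OF matrix_vector_mul_linear] linear_diff[OF matrix_vector_mul_linear])

context
  fixes y assumes y: "y \<in> U"
begin

lemma G_Gi: "G y (Gi y v) = v" and Gi_G: "Gi y (G y v) = v"
  using nondeg[OF y] by (simp_all add: matrix_vector_mul_assoc matrix_inv_cancel)

lemma G_sym: "a \<bullet> G y b = b \<bullet> G y a" and H_sym: "a \<bullet> H y b = b \<bullet> H y a"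
  by (rule skew_A[OF ham y])+

lemma \<beta>0: "\<beta> False y a b = - \<Gamma> y (G y a) b"
  by (simp add: \<Gamma>_def Gi_G)

lemma \<beta>1: "\<beta> True y a b = T y a b - \<Gamma> y (H y a) b"
  by (simp add: T_def)

text \<open>Vanishing torsion of the first connection, with covectors turned into vectors by the
  inverse metric. It is the rule by which nearly all \<open>\<Gamma>\<close> terms below
  cancel.\<close>

lemma \<Gamma>_sym: "\<Gamma> y v b \<bullet> w = \<Gamma> y w b \<bullet> v"
  using torsion_identity[OF ham y, of False "Gi y v" b False "Gi y w"] by (simp add: \<Gamma>_def G_Gi)

text \<open>The polarized torsion identity; its \<open>\<Gamma>\<close> contributions cancel by
  \<open>\<Gamma>_sym\<close>, so only the difference tensor remains.\<close>

lemma T_sym: "T y a b \<bullet> G y c = T y c b \<bullet> G y a"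
  using torsion_identity[OF ham y, of False a b True c]
    \<Gamma>_sym[of "G y a" b "H y c"] \<Gamma>_sym[of "H y a" b "G y c"]
  unfolding \<beta>0 \<beta>1 inner_diff_left inner_minus_left by linarith

text \<open>The torsion identity of the second metric. Comparison with \<open>T_sym\<close> says
  that the affinor is self-adjoint for \<open>T\<close>, which is the seed of commutativity in
  \<open>\<kappa>_N_sym\<close>.\<close>

lemma T_sym': "T y a b \<bullet> H y c = T y c b \<bullet> H y a"
  using torsion_identity[OF ham y, of True a b True c] \<Gamma>_sym[of "H y a" b "H y c"]
  unfolding \<beta>1 inner_diff_left by linarith

lemma T_cyclic: "T y a b \<bullet> G y c + T y b c \<bullet> G y a + T y c a \<bullet> G y b = 0"
  using first_order_identity[OF ham y, of a False b True c]
    \<Gamma>_sym[of "G y a" b "H y c"] \<Gamma>_sym[of "G y b" a "H y c"] \<Gamma>_sym[of "H y c" a "G y b"]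
    \<Gamma>_sym[of "H y a" c "G y b"] \<Gamma>_sym[of "H y b" c "G y a"] \<Gamma>_sym[of "H y c" b "G y a"]
    \<Gamma>_sym[of "G y b" c "H y a"] T_sym[of a b c] T_sym[of a c b] T_sym[of c a b] T_sym[of b c a]
  unfolding deriv_A[OF ham y] \<beta>0 \<beta>1 inner_diff_left inner_add_left inner_minus_left
  by linarith

abbreviation d\<Gamma> :: "real^'n \<Rightarrow> real^'n \<Rightarrow> real^'n \<Rightarrow> real^'n" where
  "d\<Gamma> v c w \<equiv> frechet_derivative (\<lambda>y. \<Gamma> y v c) (at y) w"

lemma dAv: "x \<bullet> (frechet_derivative (A \<alpha>) (at y) w *v b) = dA \<alpha> y x b w"
proof -
  have "((\<lambda>y. x \<bullet> (A \<alpha> y *v b)) has_derivative (\<lambda>w. x \<bullet> (frechet_derivative (A \<alpha>) (at y) w *v b))) (at y)"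
    by (intro bounded_linear.has_derivative[OF bounded_linear_inner_right]
        bounded_linear.has_derivative[OF bounded_bilinear.bounded_linear_left[OF bounded_bilinear_matrix_vector_mult]]
        smooth_on_has_derivative[OF smooth_A y])
  then show ?thesis by (simp add: frechet_derivative_eq)
qed

lemma has_derivative_Ab: "((\<lambda>y. A \<alpha> y *v b) has_derivative (\<lambda>w. frechet_derivative (A \<alpha>) (at y) w *v b)) (at y)"
  by (intro bounded_linear.has_derivative[OF bounded_bilinear.bounded_linear_left[OF bounded_bilinear_matrix_vector_mult]]
        smooth_on_has_derivative[OF smooth_A y])

text \<open>By \<open>\<Gamma>_sym\<close>, \<open>\<beta> False y b c \<bullet> v = - (G y b
  \<bullet> \<Gamma> y v c)\<close>. In this form the vector slot of \<open>\<Gamma>\<close> is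
  constant, so it can be differentiated without touching the inverse metric.\<close>

lemma d\<beta>0: "d\<beta> False y b c w \<bullet> v = - (G y b \<bullet> d\<Gamma> v c w) + \<Gamma> y w b \<bullet> G y (\<Gamma> y v c) + \<Gamma> y w (\<Gamma> y v c) \<bullet> G y b"
proof -
  have 1: "((\<lambda>y. \<beta> False y b c \<bullet> v) has_derivative (\<lambda>w. d\<beta> False y b c w \<bullet> v)) (at y)"
    by (intro bounded_linear.has_derivative[OF bounded_linear_inner_left] smooth_on_has_derivative[OF smooth_\<beta> y])
  have "((\<lambda>y. - (G y b \<bullet> \<Gamma> y v c)) has_derivative
      (\<lambda>w. - (G y b \<bullet> d\<Gamma> v c w + (frechet_derivative (A False) (at y) w *v b) \<bullet> \<Gamma> y v c))) (at y)"
    by (intro has_derivative_minus has_derivative_inner has_derivative_Ab smooth_on_has_derivative[OF smooth_\<Gamma> y])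
  then have 2: "((\<lambda>y. \<beta> False y b c \<bullet> v) has_derivative
      (\<lambda>w. - (G y b \<bullet> d\<Gamma> v c w + (frechet_derivative (A False) (at y) w *v b) \<bullet> \<Gamma> y v c))) (at y)"
  proof (rule has_derivative_transform_within_open[OF _ open_U y])
    fix x assume x: "x \<in> U"
    show "- (G x b \<bullet> \<Gamma> x v c) = \<beta> False x b c \<bullet> v"
      using hamiltonian_dn_operator.\<Gamma>_sym[OF hamiltonian_dn_operator_axioms x, of "G x b" c v]
      by (simp add: hamiltonian_dn_operator.\<beta>0[OF hamiltonian_dn_operator_axioms x] inner_commute)
  qed
  have "d\<beta> False y b c w \<bullet> v = - (G y b \<bullet> d\<Gamma> v c w) - dA False y (\<Gamma> y v c) b w"
    using fun_cong[OF has_derivative_unique[OF 1 2], of w] dAv[of "\<Gamma> y v c" False w b]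
    by (simp add: inner_commute)
  then show ?thesis
    using \<Gamma>_sym[of "G y (\<Gamma> y v c)" b w] \<Gamma>_sym[of "G y b" "\<Gamma> y v c" w]
    unfolding deriv_A[OF ham y] \<beta>0 inner_add_left inner_minus_left by linarith
qed

lemma inner_all_zero: "(\<And>b. G y b \<bullet> x = 0) \<Longrightarrow> x = 0"
proof -
  assume *: "\<And>b. G y b \<bullet> x = 0"
  from *[of "Gi y x"] show "x = 0" by (simp add: G_Gi)
qed

text \<open>The second-order identity of the first metric at \<open>a = Gi y w\<close>. All terms
  carry a factor \<open>G y b\<close>, which nondegeneracy removes.\<close>

lemma flatness: "d\<Gamma> v c w - d\<Gamma> w c v = \<Gamma> y w (\<Gamma> y v c) - \<Gamma> y v (\<Gamma> y w c)"
proof -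
  have "G y b \<bullet> (d\<Gamma> v c w - d\<Gamma> w c v - (\<Gamma> y w (\<Gamma> y v c) - \<Gamma> y v (\<Gamma> y w c))) = 0" for b
    using second_order_identity[OF ham y, of False False "Gi y w" b c v]
      \<Gamma>_sym[of "G y (\<Gamma> y w b)" c v] \<Gamma>_sym[of "G y (\<Gamma> y w c)" b v]
      G_sym[of "\<Gamma> y v c" "\<Gamma> y w b"] G_sym[of "\<Gamma> y v b" "\<Gamma> y w c"]
      inner_commute[of "G y b" "\<Gamma> y w (\<Gamma> y v c)"] inner_commute[of "G y b" "\<Gamma> y v (\<Gamma> y w c)"]
    unfolding d\<beta>0 \<beta>0 G_Gi A_minus \<Gamma>_minus_left inner_diff_right inner_minus_left minus_minus
    by linarith
  from inner_all_zero[OF this] show ?thesis by simp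
qed

end

text \<open>Moves the varying vector \<open>H y b\<close> out of the slot of
  \<open>\<Gamma>\<close>; smoothness and derivative of \<open>T\<close> then follow from those of
  \<open>\<Gamma>\<close> at constant vectors.\<close>

lemma T_inner: "y \<in> U \<Longrightarrow> T y b c \<bullet> v = \<beta> True y b c \<bullet> v + \<Gamma> y v c \<bullet> H y b"
  using \<Gamma>_sym[of y "H y b" c v] by (simp add: T_def inner_add_left)

lemma smooth_T: "smooth_on U (\<lambda>y. T y b c)"
proof (rule smooth_on_cong[OF open_U])
  show "smooth_on U (\<lambda>y. \<chi> k. \<beta> True y b c $ k + \<Gamma> y (axis k 1) c \<bullet> H y b)"
    by (rule smooth_on_vec[OF open_U])
      (auto intro!: smooth_on_add smooth_on_vec_nth smooth_on_inner smooth_on_matrix_vector_mult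
        smooth_on_const smooth_\<beta> smooth_\<Gamma> smooth_A open_U)
  show "(\<chi> k. \<beta> True y b c $ k + \<Gamma> y (axis k 1) c \<bullet> H y b) = T y b c" if "y \<in> U" for y
    using T_inner[OF that, of b c "axis k 1" for k] by (simp add: vec_eq_iff inner_axis)
qed

section \<open>Covariant derivative of the difference tensor\<close>

context
  fixes y assumes y: "y \<in> U"
begin

abbreviation dT :: "real^'n \<Rightarrow> real^'n \<Rightarrow> real^'n \<Rightarrow> real^'n" where
  "dT b c w \<equiv> frechet_derivative (\<lambda>y. T y b c) (at y) w"

lemma d\<beta>1: "d\<beta> True y b c w \<bullet> v = dT b c w \<bullet> v - frechet_derivative (\<lambda>y. \<Gamma> y v c) (at y) w \<bullet> H y b
   - (T y (\<Gamma> y v c) b + T y b (\<Gamma> y v c)) \<bullet> w + \<Gamma> y w b \<bullet> H y (\<Gamma> y v c) + \<Gamma> y w (\<Gamma> y v c) \<bullet> H y b"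
proof -
  have 1: "((\<lambda>y. T y b c \<bullet> v) has_derivative (\<lambda>w. dT b c w \<bullet> v)) (at y)"
    by (intro bounded_linear.has_derivative[OF bounded_linear_inner_left] smooth_on_has_derivative[OF smooth_T y])
  have "((\<lambda>y. \<beta> True y b c \<bullet> v + \<Gamma> y v c \<bullet> H y b) has_derivative
      (\<lambda>w. d\<beta> True y b c w \<bullet> v + (\<Gamma> y v c \<bullet> (frechet_derivative (A True) (at y) w *v b)
         + frechet_derivative (\<lambda>y. \<Gamma> y v c) (at y) w \<bullet> H y b))) (at y)"
    by (intro has_derivative_add has_derivative_inner has_derivative_Ab[OF y] smooth_on_has_derivative[OF smooth_\<Gamma> y]
       bounded_linear.has_derivative[OF bounded_linear_inner_left] smooth_on_has_derivative[OF smooth_\<beta> y])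
  then have 2: "((\<lambda>y. T y b c \<bullet> v) has_derivative
      (\<lambda>w. d\<beta> True y b c w \<bullet> v + (\<Gamma> y v c \<bullet> (frechet_derivative (A True) (at y) w *v b)
         + frechet_derivative (\<lambda>y. \<Gamma> y v c) (at y) w \<bullet> H y b))) (at y)"
    by (rule has_derivative_transform_within_open[OF _ open_U y]) (simp add: T_inner)
  have "dT b c w \<bullet> v = d\<beta> True y b c w \<bullet> v + dA True y (\<Gamma> y v c) b w
      + frechet_derivative (\<lambda>y. \<Gamma> y v c) (at y) w \<bullet> H y b"
    using fun_cong[OF has_derivative_unique[OF 1 2], of w] dAv[OF y, of "\<Gamma> y v c" True w b] by simp
  then show ?thesis
    using \<Gamma>_sym[OF y, of "H y (\<Gamma> y v c)" b w] \<Gamma>_sym[OF y, of "H y b" "\<Gamma> y v c" w]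
    unfolding deriv_A[OF ham y] \<beta>1[OF y] inner_add_left inner_diff_left by linarith
qed

text \<open>The second-order identity for the two metrics contains the exterior derivatives of both
  \<open>\<beta>\<close>. That of the first metric, taken in the direction \<open>H y a\<close>, is
  eliminated by the pure identity \<open>0\<close>.\<close>

lemma mixed_identity:
  "d\<beta> True y b c w \<bullet> v - d\<beta> True y b c v \<bullet> w
   = - (T y (\<Gamma> y w b) c \<bullet> v) + T y (\<Gamma> y w c) b \<bullet> v - T y (\<Gamma> y v c) b \<bullet> w + T y (\<Gamma> y v b) c \<bullet> w
     + \<Gamma> y v c \<bullet> H y (\<Gamma> y w b) - \<Gamma> y v b \<bullet> H y (\<Gamma> y w c)"
proof -
  define a where "a = Gi y w"
  have Ga: "G y a = w" by (simp add: a_def G_Gi[OF y])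
  have 0: "d\<beta> False y b c x \<bullet> v - d\<beta> False y b c v \<bullet> x = \<Gamma> y v c \<bullet> G y (\<Gamma> y x b) - \<Gamma> y v b \<bullet> G y (\<Gamma> y x c)" for x
    using second_order_identity[OF ham y, of False False "Gi y x" b c v]
      \<Gamma>_sym[OF y, of "G y (\<Gamma> y x b)" c v] \<Gamma>_sym[OF y, of "G y (\<Gamma> y x c)" b v]
    unfolding \<beta>0[OF y] G_Gi[OF y] A_minus \<Gamma>_minus_left inner_minus_left minus_minus by linarith
  show ?thesis
    using second_order_identity[OF ham y, of True False a b c v] 0[of "H y a"]
      T_sym[OF y, of a b "\<Gamma> y v c"] T_sym[OF y, of a c "\<Gamma> y v b"]
      G_sym[OF y, of "T y a b" "\<Gamma> y v c"] G_sym[OF y, of "T y a c" "\<Gamma> y v b"]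
      \<Gamma>_sym[OF y, of "G y (T y a b)" c v] \<Gamma>_sym[OF y, of "G y (T y a c)" b v]
      \<Gamma>_sym[OF y, of "G y (\<Gamma> y (H y a) b)" c v] \<Gamma>_sym[OF y, of "G y (\<Gamma> y (H y a) c)" b v]
      \<Gamma>_sym[OF y, of "H y (\<Gamma> y w b)" c v] \<Gamma>_sym[OF y, of "H y (\<Gamma> y w c)" b v]
    unfolding \<beta>0[OF y] \<beta>1[OF y] Ga
    unfolding A_minus A_diff \<Gamma>_minus_left \<Gamma>_diff_left T_minus_left
    unfolding inner_diff_left inner_minus_left inner_add_left minus_minus
    by linarith
qed

text \<open>The covariant derivative of \<open>T\<close> is symmetric in the direction
  \<open>w\<close> and the output slot \<open>v\<close>. The omitted term
  \<open>\<Gamma> y w (T y b c) \<bullet> v\<close> is symmetric by itself, and the derivatives of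
  \<open>\<Gamma>\<close> cancel by flatness.\<close>

lemma T_closed:
  "(dT b c w + T y (\<Gamma> y w b) c + T y b (\<Gamma> y w c)) \<bullet> v = (dT b c v + T y (\<Gamma> y v b) c + T y b (\<Gamma> y v c)) \<bullet> w"
proof -
  have "(frechet_derivative (\<lambda>y. \<Gamma> y v c) (at y) w - frechet_derivative (\<lambda>y. \<Gamma> y w c) (at y) v) \<bullet> H y b
     = (\<Gamma> y w (\<Gamma> y v c) - \<Gamma> y v (\<Gamma> y w c)) \<bullet> H y b"
    by (simp only: flatness[OF y])
  then show ?thesis
    using mixed_identity[of b c w v] H_sym[OF y, of "\<Gamma> y v c" "\<Gamma> y w b"] H_sym[OF y, of "\<Gamma> y v b" "\<Gamma> y w c"]
    unfolding d\<beta>1 inner_diff_left inner_add_left by linarith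
qed

end

end

section \<open>Flat sections of a flat connection\<close>

text \<open>Picard iteration along all rays at once: \<open>f y\<close> is \<open>\<xi>\<close> plus
  the integral of \<open>C (t y) y (f (t y))\<close> over \<open>t\<close> in the unit interval. The
  kernel is bounded by \<open>K * r\<close>, so this is a contraction with factor 1/2. Solving for
  all rays together yields continuity in \<open>y\<close>.\<close>

lemma radial_solution:
  fixes C :: "'a::euclidean_space \<Rightarrow> 'a \<Rightarrow>\<^sub>L ('b::euclidean_space \<Rightarrow>\<^sub>L 'b)"
  assumes r: "r > 0" and cont: "continuous_on (cball 0 r) C"
    and K: "\<And>y. y \<in> cball 0 r \<Longrightarrow> norm (C y) \<le> K" and Kr: "K * r \<le> 1 / 2"
  shows "\<exists>f. continuous_on (cball 0 r) f \<and> f 0 = \<xi> \<and> (\<forall>y\<in>cball 0 r. \<forall>t\<in>{0..1}.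
      ((\<lambda>t. f (t *\<^sub>R y)) has_vector_derivative C (t *\<^sub>R y) y (f (t *\<^sub>R y))) (at t within {0..1}))"
proof -
  let ?B = "cball (0::'a) r"
  have K0: "0 \<le> K" using order_trans[OF norm_ge_zero K[of 0]] r by simp
  \<comment> \<open>Bounded continuous functions live on the whole space; the nearest-point
    projection extends the equation beyond the ball.\<close>
  define \<pi> where "\<pi> = closest_point ?B"
  have \<pi>: "\<pi> y \<in> ?B" for y
    unfolding \<pi>_def by (rule closest_point_in_set) (use r in auto)
  have \<pi>_id: "y \<in> ?B \<Longrightarrow> \<pi> y = y" for y
    unfolding \<pi>_def by (rule closest_point_self)
  have \<pi>_cont: "continuous_on UNIV \<pi>"
    unfolding \<pi>_def by (rule continuous_on_closest_point) (use r in auto)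
  have tin: "t *\<^sub>R y \<in> ?B" if "y \<in> ?B" "t \<in> {0..1}" for t y
    using that mult_mono[of t 1 "norm y" r] by auto
  define g where "g F y t = C (t *\<^sub>R \<pi> y) (\<pi> y) (F (t *\<^sub>R \<pi> y))" for F :: "'a \<Rightarrow> 'b" and y t
  have gc: "continuous_on (UNIV \<times> cbox 0 1) (\<lambda>(y, t). g F y t)" if "continuous_on UNIV F" for F
  proof -
    have c: "continuous_on (UNIV \<times> cbox 0 1) (\<lambda>q :: 'a \<times> real. \<pi> (fst q))"
      by (rule continuous_on_compose2[OF \<pi>_cont]) (auto intro!: continuous_intros)
    have s: "continuous_on (UNIV \<times> cbox 0 1) (\<lambda>q :: 'a \<times> real. snd q *\<^sub>R \<pi> (fst q))"
      by (intro continuous_intros c)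
    have "continuous_on (UNIV \<times> cbox 0 1) (\<lambda>q. C (snd q *\<^sub>R \<pi> (fst q)))"
      by (rule continuous_on_compose2[OF cont s]) (use tin[OF \<pi>] in auto)
    moreover have "continuous_on (UNIV \<times> cbox 0 1) (\<lambda>q. F (snd q *\<^sub>R \<pi> (fst q)))"
      by (rule continuous_on_compose2[OF that s]) auto
    ultimately show ?thesis
      unfolding g_def case_prod_unfold by (intro blinfun.continuous_on c)
  qed
  have gn: "norm (g F y t) \<le> 1 / 2 * norm (F (t *\<^sub>R \<pi> y))" if "t \<in> {0..1}" for F y t
  proof -
    have "norm (g F y t) \<le> norm (C (t *\<^sub>R \<pi> y)) * norm (\<pi> y) * norm (F (t *\<^sub>R \<pi> y))"
      unfolding g_def
      by (rule order_trans[OF norm_blinfun mult_right_mono[OF norm_blinfun norm_ge_zero]])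
    also have "\<dots> \<le> K * r * norm (F (t *\<^sub>R \<pi> y))"
      using K[OF tin[OF \<pi> that]] \<pi>[of y] K0 by (intro mult_right_mono mult_mono) auto
    also have "\<dots> \<le> 1 / 2 * norm (F (t *\<^sub>R \<pi> y))" using Kr by (intro mult_right_mono) auto
    finally show ?thesis .
  qed
  have gi: "g F y integrable_on cbox 0 1" if "continuous_on UNIV F" for F y
  proof (rule integrable_continuous)
    show "continuous_on (cbox 0 1) (g F y)"
      using continuous_on_compose2[OF gc[OF that], of "cbox 0 1" "\<lambda>t. (y, t)"]
        continuous_on_Pair[OF continuous_on_const continuous_on_id, of "cbox 0 (1::real)" y] by (auto simp: cbox_interval)
  qed
  define \<Phi> where "\<Phi> F y = \<xi> + integral (cbox 0 1) (g F y)" for F y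
  have \<Phi>: "\<Phi> F \<in> bcontfun" for F :: "'a \<Rightarrow>\<^sub>C 'b"
  proof -
    have F: "continuous_on UNIV F" by simp
    show ?thesis
    proof (rule bcontfun_normI)
      show "continuous_on UNIV (\<Phi> F)"
        unfolding \<Phi>_def by (intro continuous_intros integral_continuous_on_param gc F)
      fix y
      have "norm (integral (cbox 0 1) (g F y)) \<le> integral (cbox 0 1) (\<lambda>t::real. 1 / 2 * norm F)"
      proof (rule integral_norm_bound_integral[OF gi[OF F]])
        show "norm (g F y t) \<le> 1 / 2 * norm F" if "t \<in> cbox 0 1" for t
          using gn[of t F y] norm_bounded[of F "t *\<^sub>R \<pi> y"] that by auto
      qed auto
      then show "norm (\<Phi> F y) \<le> norm \<xi> + 1 / 2 * norm F"
        unfolding \<Phi>_def by (intro order_trans[OF norm_triangle_ineq]) auto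
    qed
  qed
  have "\<exists>!F. Bcontfun (\<Phi> (apply_bcontfun F)) = F"
  proof (rule banach_fix_type[of "1/2"])
    show "\<forall>F F'. dist (Bcontfun (\<Phi> (apply_bcontfun F))) (Bcontfun (\<Phi> (apply_bcontfun F'))) \<le> 1 / 2 * dist F F'"
    proof (intro allI dist_bound)
      fix F F' :: "'a \<Rightarrow>\<^sub>C 'b" and y
      have F: "continuous_on UNIV F" "continuous_on UNIV F'" by simp_all
      have sub: "g F y t - g F' y t = g (\<lambda>x. F x - F' x) y t" for t
        by (simp add: g_def blinfun.diff_right)
      have "\<Phi> F y - \<Phi> F' y = integral (cbox 0 1) (\<lambda>t. g F y t - g F' y t)"
        unfolding \<Phi>_def using integral_diff[OF gi[OF F(1)] gi[OF F(2)]] by simp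
      also have "norm \<dots> \<le> integral (cbox 0 1) (\<lambda>t::real. 1 / 2 * dist F F')"
      proof (rule integral_norm_bound_integral[OF integrable_diff[OF gi[OF F(1)] gi[OF F(2)]]])
        show "norm (g F y t - g F' y t) \<le> 1 / 2 * dist F F'" if "t \<in> cbox 0 1" for t
          using gn[of t "\<lambda>x. F x - F' x" y] dist_bounded[of F "t *\<^sub>R \<pi> y" F'] that
          by (auto simp: sub dist_norm)
      qed auto
      finally show "dist (Bcontfun (\<Phi> F) y) (Bcontfun (\<Phi> F') y) \<le> 1 / 2 * dist F F'"
        by (simp add: Bcontfun_inverse[OF \<Phi>] dist_norm)
    qed
  qed auto
  then obtain F where F: "Bcontfun (\<Phi> (apply_bcontfun F)) = F" by blast
  define f where "f = apply_bcontfun F"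
  have fc: "continuous_on UNIV f" by (simp add: f_def)
  have fp: "f = \<Phi> f"
    using Bcontfun_inverse[OF \<Phi>, of F] unfolding F f_def .
  have f: "f y = \<xi> + integral {0..1} (\<lambda>t. C (t *\<^sub>R y) y (f (t *\<^sub>R y)))" if "y \<in> ?B" for y
    using fun_cong[OF fp, of y] unfolding \<Phi>_def g_def \<pi>_id[OF that] cbox_interval .
  show ?thesis
  proof (intro exI[of _ f] conjI ballI)
    show "continuous_on ?B f" using fc continuous_on_subset by blast
    show "f 0 = \<xi>" by (subst f) (use r in \<open>simp_all add: blinfun.zero_right blinfun.zero_left\<close>)
    fix y t assume y: "y \<in> ?B" and t: "t \<in> {0..1::real}"
    define k where "k t = C (t *\<^sub>R y) y (f (t *\<^sub>R y))" for t :: real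
    have kc: "continuous_on {0..1} k"
    proof -
      have "k = (\<lambda>t. g f y t)" using y by (simp add: k_def g_def \<pi>_id fun_eq_iff)
      then show ?thesis
        using continuous_on_compose2[OF gc[OF fc], of "cbox 0 1" "\<lambda>t. (y, t)"]
          continuous_on_Pair[OF continuous_on_const continuous_on_id, of "cbox 0 (1::real)" y] by (auto simp: cbox_interval)
    qed
    define h where "h s = integral {0..s} k" for s :: real
    have h: "(h has_vector_derivative k s) (at s within {0..1})" if "s \<in> {0..1}" for s
      unfolding h_def by (rule integral_has_vector_derivative[OF kc that])
    \<comment> \<open>The integral equation at \<open>s y\<close> runs over the unit interval; the
      substitution of \<open>s * t\<close> for \<open>t\<close> turns it into an integral from 0 to
      \<open>s\<close>, which can be differentiated in \<open>s\<close>.\<close>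
    have fs: "f (s *\<^sub>R y) = \<xi> + h s" if s: "s \<in> {0..1}" for s
    proof -
      have "((\<lambda>t. h (s * t)) has_vector_derivative s *\<^sub>R k (s * t)) (at t within {0..1})" if t: "t \<in> {0..1}" for t
      proof -
        have 1: "((\<lambda>t. s * t) has_vector_derivative s) (at t within {0..1})"
          by (auto intro!: derivative_eq_intros simp: has_vector_derivative_def)
        have st: "s * t \<in> {0..1}" using s t mult_mono[of s 1 t 1] by auto
        have im: "(\<lambda>t. s * t) ` {0..1} \<subseteq> {0..1}" using s mult_mono[of s 1 _ 1] by auto
        have 2: "(h has_vector_derivative k (s * t)) (at (s * t) within (\<lambda>t. s * t) ` {0..1})"
          by (rule has_vector_derivative_within_subset[OF h[OF st] im])
        show ?thesis using vector_diff_chain_within[OF 1 2] by (simp add: o_def)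
      qed
      then have "((\<lambda>t. s *\<^sub>R k (s * t)) has_integral (h (s * 1) - h (s * 0))) {0..1}"
        by (intro fundamental_theorem_of_calculus) auto
      from integral_unique[OF this] have "integral {0..1} (\<lambda>t. s *\<^sub>R k (s * t)) = h s"
        by (simp only: mult_1_right mult_zero_right) (simp add: h_def)
      moreover have "s *\<^sub>R k (s * t) = C (t *\<^sub>R (s *\<^sub>R y)) (s *\<^sub>R y) (f (t *\<^sub>R (s *\<^sub>R y)))" for t
        by (simp add: k_def blinfun.scaleR_right blinfun.scaleR_left mult.commute)
      ultimately show ?thesis using f[OF tin[OF y s]] by simp
    qed
    have "((\<lambda>s. \<xi> + h s) has_vector_derivative k t) (at t within {0..1})"
      using h[OF t] by (auto intro!: derivative_eq_intros)
    then show "((\<lambda>t. f (t *\<^sub>R y)) has_vector_derivative C (t *\<^sub>R y) y (f (t *\<^sub>R y))) (at t within {0..1})"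
      unfolding k_def[symmetric]
      by (rule has_vector_derivative_transform[OF t, rotated]) (simp add: fs)
  qed
qed

text \<open>If \<open>f\<close> solves the radial equation, then \<open>\<delta>(t) = f(tz) - f(ty) - t C(ty)(z - y) f(ty)\<close> satisfies
  \<open>\<delta>' = C(tz)(z) \<delta> + o(|z - y|)\<close> by flatness, whence \<open>\<delta>(1) = o(|z - y|)\<close>.\<close>
lemma flat_section_at_0:
  fixes C :: "'a::euclidean_space \<Rightarrow> 'a \<Rightarrow>\<^sub>L ('b::euclidean_space \<Rightarrow>\<^sub>L 'b)"
    and DC :: "'a \<Rightarrow> 'a \<Rightarrow>\<^sub>L ('a \<Rightarrow>\<^sub>L ('b \<Rightarrow>\<^sub>L 'b))"
  assumes U: "open U" "0 \<in> U" and D: "\<And>y. y \<in> U \<Longrightarrow> (C has_derivative DC y) (at y)"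
    and DCc: "continuous_on U DC"
    and flat: "\<And>y v w \<xi>. y \<in> U \<Longrightarrow> DC y v w \<xi> + C y w (C y v \<xi>) = DC y w v \<xi> + C y v (C y w \<xi>)"
  obtains r where "r > 0" "ball 0 r \<subseteq> U"
    "\<And>\<xi>. \<exists>f. f 0 = \<xi> \<and> (\<forall>y\<in>ball 0 r. (f has_derivative (\<lambda>v. C y v (f y))) (at y))"
proof -
  obtain r0 where r0: "r0 > 0" "cball 0 r0 \<subseteq> U" using U open_contains_cball by blast
  have Cc: "continuous_on U C"
    by (rule has_derivative_continuous_on) (use D has_derivative_at_withinI in blast)
  have "compact (C ` cball 0 r0)" "compact (DC ` cball 0 r0)"
    by (intro compact_continuous_image continuous_on_subset[OF Cc r0(2)] continuous_on_subset[OF DCc r0(2)] compact_cball)+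
  then have "bounded (C ` cball 0 r0 )" "bounded (DC ` cball 0 r0)" by (auto intro: compact_imp_bounded)
  then obtain K1 K2 where K1: "K1 > 0" "\<And>y. y \<in> cball 0 r0 \<Longrightarrow> norm (C y) \<le> K1"
    and K2: "K2 > 0" "\<And>y. y \<in> cball 0 r0 \<Longrightarrow> norm (DC y) \<le> K2"
    unfolding bounded_pos by blast
  define K where "K = max K1 K2"
  have K: "K > 0" "\<And>y. y \<in> cball 0 r0 \<Longrightarrow> norm (C y) \<le> K" "\<And>y. y \<in> cball 0 r0 \<Longrightarrow> norm (DC y) \<le> K"
    using K1 K2 unfolding K_def by (auto simp: less_max_iff_disj le_max_iff_disj)
  \<comment> \<open>Chosen for \<open>K * r \<le> 1 / 2\<close>: the contraction factor of the
    radial equation, and the factor that lets the error be absorbed further below.\<close>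
  define r where "r = min r0 (1 / (2 * K))"
  have r: "r > 0" "r \<le> r0" "K * r \<le> 1 / 2"
    using r0 K unfolding r_def by (auto simp: min_def field_simps)
  let ?B = "cball (0::'a) r"
  have BU: "?B \<subseteq> U" and B0: "?B \<subseteq> cball 0 r0" using r r0 by auto
  have KC: "norm (C y) \<le> K" and KD: "norm (DC y) \<le> K" if "y \<in> ?B" for y using K B0 that by blast+
  have tin: "t *\<^sub>R y \<in> ?B" if "y \<in> ?B" "t \<in> {0..1}" for t y
    using that mult_mono[of t 1 "norm y" r] by auto
  have DB: "(C has_derivative DC y) (at y within X)" if "y \<in> ?B" for y X
    using D that BU has_derivative_at_withinI by blast
  have lip: "norm (C a - C b) \<le> K * norm (a - b)" if "a \<in> ?B" "b \<in> ?B" for a b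
    by (rule differentiable_bound[of ?B C "\<lambda>y. blinfun_apply (DC y)"])
      (use that DB KD in \<open>auto simp: norm_blinfun.rep_eq[symmetric]\<close>)
  have ucont: "uniformly_continuous_on ?B DC"
    by (rule compact_uniformly_continuous[OF continuous_on_subset[OF DCc BU] compact_cball])
  \<comment> \<open>The first-order expansion of \<open>C\<close> has to be uniform in the base
    point, since it is used at \<open>t *\<^sub>R y\<close> for all \<open>t\<close>
    simultaneously.\<close>
  have udiff: "\<exists>d>0. \<forall>a\<in>?B. \<forall>b\<in>?B. norm (a - b) < d \<longrightarrow> norm (C a - C b - DC b (a - b)) \<le> e * norm (a - b)"
    if e: "e > 0" for e
  proof -
    obtain d where d: "d > 0" "\<And>a b. a \<in> ?B \<Longrightarrow> b \<in> ?B \<Longrightarrow> dist a b < d \<Longrightarrow> dist (DC a) (DC b) < e"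
      using ucont e unfolding uniformly_continuous_on_def by metis
    have "norm (C a - C b - DC b (a - b)) \<le> e * norm (a - b)" if ab: "a \<in> ?B" "b \<in> ?B" "norm (a - b) < d" for a b
    proof -
      let ?S = "?B \<inter> ball b d"
      have "norm (C a - C b - DC b (a - b)) \<le> norm (a - b) * e"
      proof (rule differentiable_bound_linearization[where S = ?S and f' = "\<lambda>y. blinfun_apply (DC y)"])
        show "b + t *\<^sub>R (a - b) \<in> ?S" if t: "t \<in> {0..1}" for t
        proof -
          have "convex ?S" by (intro convex_Int convex_cball convex_ball)
          moreover have "a \<in> ?S" "b \<in> ?S" using ab d by (auto simp: dist_norm norm_minus_commute)
          ultimately have "(1 - t) *\<^sub>R b + t *\<^sub>R a \<in> ?S" using t by (intro convexD_alt) auto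
          then show ?thesis by (simp add: algebra_simps)
        qed
        show "(C has_derivative DC x) (at x within ?S)" if "x \<in> ?S" for x using DB that by auto
        show "onorm (blinfun_apply (DC x) - blinfun_apply (DC b)) \<le> e" if "x \<in> ?S" for x
        proof -
          have "blinfun_apply (DC x) - blinfun_apply (DC b) = blinfun_apply (DC x - DC b)"
            by (auto simp: fun_eq_iff blinfun.diff_left)
          then show ?thesis using d(2)[of x b] that ab
            by (simp add: norm_blinfun.rep_eq[symmetric] dist_norm norm_minus_commute)
        qed
        show "b \<in> ?S" using ab d by auto
      qed
      then show ?thesis by (simp add: mult.commute)
    qed
    then show ?thesis using d(1) by blast
  qed
  have "\<exists>f. f 0 = \<xi> \<and> (\<forall>y\<in>ball 0 r. (f has_derivative (\<lambda>v. C y v (f y))) (at y))" for \<xi>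
  proof -
    have "\<exists>f. continuous_on ?B f \<and> f 0 = \<xi> \<and> (\<forall>y\<in>?B. \<forall>t\<in>{0..1}.
      ((\<lambda>t. f (t *\<^sub>R y)) has_vector_derivative C (t *\<^sub>R y) y (f (t *\<^sub>R y))) (at t within {0..1}))"
      by (rule radial_solution[OF r(1) continuous_on_subset[OF Cc BU] KC r(3)])
    then obtain f where F: "continuous_on ?B f \<and> f 0 = \<xi> \<and> (\<forall>y\<in>?B. \<forall>t\<in>{0..1}.
      ((\<lambda>t. f (t *\<^sub>R y)) has_vector_derivative C (t *\<^sub>R y) y (f (t *\<^sub>R y))) (at t within {0..1}))"
      by (rule exE)
    note fc = conjunct1[OF F] and f0 = conjunct1[OF conjunct2[OF F]]
      and ode = bspec[OF bspec[OF conjunct2[OF conjunct2[OF F]]]]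
    have "bounded (f ` ?B)" by (intro compact_imp_bounded compact_continuous_image fc compact_cball)
    then obtain M where M: "M > 0" "\<And>y. y \<in> ?B \<Longrightarrow> norm (f y) \<le> M" unfolding bounded_pos by blast
    have "(f has_derivative (\<lambda>v. C y v (f y))) (at y)" if y: "y \<in> ball 0 r" for y
    proof -
      have yB: "y \<in> ?B" using y by simp
      have main: "\<exists>d>0. \<forall>z\<in>ball 0 r. norm (z - y) < d \<longrightarrow> norm (f z - f y - C y (z - y) (f y)) \<le> e * norm (z - y)"
        if e: "e > 0" for e
      proof -
        \<comment> \<open>\<open>e1\<close> controls the error linear in \<open>n\<close>
          (\<open>a2\<close>), \<open>L\<close> collects the quadratic ones (\<open>a3\<close>,
          \<open>a4\<close>); together with \<open>d2\<close> each kind contributes at most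
          \<open>e / 2 * n\<close> to \<open>2 * E\<close>.\<close>
        define e1 where "e1 = e / (4 * M * r)"
        have e1: "e1 > 0" using e M r by (simp add: e1_def)
        obtain d1 where d1: "d1 > 0" "\<And>a b. a \<in> ?B \<Longrightarrow> b \<in> ?B \<Longrightarrow> norm (a - b) < d1 \<Longrightarrow>
          norm (C a - C b - DC b (a - b)) \<le> e1 * norm (a - b)"
          using udiff[OF e1] by blast
        define L where "L = K + (K * r + K) * K"
        have L: "L > 0" using K r unfolding L_def by (intro add_pos_pos mult_pos_pos) auto
        define d2 where "d2 = e / (4 * M * L)"
        have d2: "d2 > 0" using e M L by (simp add: d2_def)
        have "norm (f z - f y - C y (z - y) (f y)) \<le> e * norm (z - y)"
          if z: "z \<in> ball 0 r" "norm (z - y) < min d1 d2" for z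
        proof -
          have zB: "z \<in> ?B" using z by simp
          define v where "v = z - y"
          define n where "n = norm v"
          have n0: "n \<ge> 0" by (simp add: n_def)
          define \<delta> where "\<delta> t = f (t *\<^sub>R z) - f (t *\<^sub>R y) - t *\<^sub>R C (t *\<^sub>R y) v (f (t *\<^sub>R y))" for t
          define \<delta>' where "\<delta>' t = C (t *\<^sub>R z) z (f (t *\<^sub>R z)) - C (t *\<^sub>R y) y (f (t *\<^sub>R y))
             - (t *\<^sub>R (C (t *\<^sub>R y) v (C (t *\<^sub>R y) y (f (t *\<^sub>R y))) + DC (t *\<^sub>R y) y v (f (t *\<^sub>R y)))
                 + 1 *\<^sub>R C (t *\<^sub>R y) v (f (t *\<^sub>R y)))" for t
          have der: "(\<delta> has_vector_derivative \<delta>' t) (at t within {0..1})" if t: "t \<in> {0..1}" for t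
          proof -
            have 1: "((\<lambda>t. t *\<^sub>R y) has_derivative (\<lambda>h. h *\<^sub>R y)) (at t within {0..1})"
              by (auto intro!: derivative_eq_intros)
            have "((\<lambda>t. C (t *\<^sub>R y)) has_derivative (\<lambda>h. DC (t *\<^sub>R y) (h *\<^sub>R y))) (at t within {0..1})"
              using diff_chain_within[OF 1 DB[OF tin[OF yB t]]] by (simp add: o_def)
            then have 2: "((\<lambda>t. C (t *\<^sub>R y)) has_vector_derivative DC (t *\<^sub>R y) y) (at t within {0..1})"
              by (simp add: has_vector_derivative_def blinfun.scaleR_right)
            have 3: "((\<lambda>t. C (t *\<^sub>R y) v) has_vector_derivative DC (t *\<^sub>R y) y v) (at t within {0..1})"
              using bounded_linear.has_vector_derivative[OF blinfun.bounded_linear_left 2, of v] .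
            have 4: "((\<lambda>t. C (t *\<^sub>R y) v (f (t *\<^sub>R y))) has_vector_derivative
                (C (t *\<^sub>R y) v (C (t *\<^sub>R y) y (f (t *\<^sub>R y))) + DC (t *\<^sub>R y) y v (f (t *\<^sub>R y)))) (at t within {0..1})"
              by (rule bounded_bilinear.has_vector_derivative[OF bounded_bilinear_blinfun_apply 3 ode[OF yB t]])
            have 5: "((\<lambda>t. t *\<^sub>R C (t *\<^sub>R y) v (f (t *\<^sub>R y))) has_vector_derivative
                (t *\<^sub>R (C (t *\<^sub>R y) v (C (t *\<^sub>R y) y (f (t *\<^sub>R y))) + DC (t *\<^sub>R y) y v (f (t *\<^sub>R y)))
                 + 1 *\<^sub>R C (t *\<^sub>R y) v (f (t *\<^sub>R y)))) (at t within {0..1})"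
              by (rule bounded_bilinear.has_vector_derivative[OF bounded_bilinear_scaleR has_vector_derivative_id 4])
            show ?thesis unfolding \<delta>_def[abs_def] \<delta>'_def
              by (intro has_vector_derivative_diff ode[OF yB t] ode[OF zB t] 5)
          qed
          define E where "E = M * (e1 * r * n + L * n\<^sup>2)"
          have bound: "norm (\<delta>' t) \<le> 1 / 2 * norm (\<delta> t) + E" if t: "t \<in> {0..1}" for t
          proof -
            let ?Y = "C (t *\<^sub>R y)" and ?Z = "C (t *\<^sub>R z)" and ?f = "f (t *\<^sub>R y)"
            have ty: "t *\<^sub>R y \<in> ?B" and tz: "t *\<^sub>R z \<in> ?B" using tin yB zB t by auto
            \<comment> \<open>Flatness exchanges the directions \<open>y\<close> and
              \<open>v\<close>; the derivative term then fits the expansion of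
              \<open>C (t *\<^sub>R z)\<close> about \<open>t *\<^sub>R y\<close>.\<close>
            have fl: "DC (t *\<^sub>R y) y v ?f = DC (t *\<^sub>R y) v y ?f + ?Y y (?Y v ?f) - ?Y v (?Y y ?f)"
              using flat[of "t *\<^sub>R y" y v ?f] ty BU by (simp add: algebra_simps subset_eq)
            have fz: "f (t *\<^sub>R z) = \<delta> t + ?f + t *\<^sub>R ?Y v ?f" by (simp add: \<delta>_def)
            have zy: "z = y + v" by (simp add: v_def)
            have dec: "\<delta>' t = ?Z z (\<delta> t) + ((?Z - ?Y - DC (t *\<^sub>R y) (t *\<^sub>R v)) z ?f + t *\<^sub>R DC (t *\<^sub>R y) v v ?f)
                + t *\<^sub>R ((?Z - ?Y) z (?Y v ?f) + ?Y v (?Y v ?f))"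
              unfolding \<delta>'_def fl fz
              by (simp add: blinfun.bilinear_simps scaleR_add_right scaleR_diff_right zy)
            have tv: "t *\<^sub>R z - t *\<^sub>R y = t *\<^sub>R v" by (simp add: v_def scaleR_diff_right)
            have tn: "norm (t *\<^sub>R v) \<le> n" using t by (simp add: n_def mult_left_le_one_le)
            have app: "norm (X a b) \<le> norm X * norm a * norm b" for X :: "'a \<Rightarrow>\<^sub>L ('b \<Rightarrow>\<^sub>L 'b)" and a b
              by (rule order_trans[OF norm_blinfun mult_right_mono[OF norm_blinfun norm_ge_zero]])
            have fM: "norm ?f \<le> M" by (rule M(2)[OF ty])
            have nz: "norm z \<le> r" using zB by simp
            have a1: "norm (?Z z (\<delta> t)) \<le> 1 / 2 * norm (\<delta> t)"
            proof -
              have "norm (?Z z (\<delta> t)) \<le> norm ?Z * norm z * norm (\<delta> t)" by (rule app)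
              also have "\<dots> \<le> K * r * norm (\<delta> t)"
                by (intro mult_right_mono mult_mono KC[OF tz] nz) (use K in auto)
              also have "\<dots> \<le> 1 / 2 * norm (\<delta> t)" by (intro mult_right_mono r) auto
              finally show ?thesis .
            qed
            have a2: "norm ((?Z - ?Y - DC (t *\<^sub>R y) (t *\<^sub>R v)) z ?f) \<le> e1 * n * r * M"
            proof -
              have "norm (t *\<^sub>R z - t *\<^sub>R y) < d1" using tn z(2) unfolding tv by (simp add: n_def v_def)
              then have "norm (?Z - ?Y - DC (t *\<^sub>R y) (t *\<^sub>R v)) \<le> e1 * norm (t *\<^sub>R v)"
                using d1(2)[OF tz ty] unfolding tv by blast
              also have "\<dots> \<le> e1 * n" using tn e1 by (intro mult_left_mono) auto
              finally have "norm (?Z - ?Y - DC (t *\<^sub>R y) (t *\<^sub>R v)) * norm z * norm ?f \<le> e1 * n * r * M"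
                by (intro mult_mono nz fM) (use e1 n0 r in auto)
              then show ?thesis using app order_trans by blast
            qed
            have a3: "norm (t *\<^sub>R DC (t *\<^sub>R y) v v ?f) \<le> K * n * n * M"
            proof -
              have "norm (t *\<^sub>R DC (t *\<^sub>R y) v v ?f) \<le> norm (DC (t *\<^sub>R y) v v ?f)"
                using t by (simp add: mult_left_le_one_le)
              also have "\<dots> \<le> norm (DC (t *\<^sub>R y) v) * norm v * norm ?f" by (rule app)
              also have "\<dots> \<le> (norm (DC (t *\<^sub>R y)) * norm v) * norm v * norm ?f"
                by (intro mult_right_mono norm_blinfun) auto
              also have "\<dots> \<le> (K * n) * n * M"
                unfolding n_def by (intro mult_mono KD[OF ty] fM order_refl) (use K in auto)
              finally show ?thesis .
            qed
            have a4: "norm (t *\<^sub>R ((?Z - ?Y) z (?Y v ?f) + ?Y v (?Y v ?f))) \<le> (K * r + K) * n * (K * n * M)"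
            proof -
              have Yv: "norm (?Y v ?f) \<le> K * n * M"
              proof -
                have "norm (?Y v ?f) \<le> norm ?Y * norm v * norm ?f" by (rule app)
                also have "\<dots> \<le> K * n * M"
                  unfolding n_def by (intro mult_mono KC[OF ty] fM order_refl) (use K in auto)
                finally show ?thesis .
              qed
              have "norm ((?Z - ?Y) z (?Y v ?f)) \<le> norm (?Z - ?Y) * norm z * norm (?Y v ?f)" by (rule app)
              also have "\<dots> \<le> (K * n) * r * (K * n * M)"
              proof -
                have "norm (?Z - ?Y) \<le> K * norm (t *\<^sub>R v)" using lip[OF tz ty] unfolding tv .
                also have "\<dots> \<le> K * n" using tn K by (intro mult_left_mono) auto
                finally show ?thesis by (intro mult_mono nz Yv) (use K n0 r M in auto)
              qed
              finally have b1: "norm ((?Z - ?Y) z (?Y v ?f)) \<le> (K * n) * r * (K * n * M)" .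
              have "norm (?Y v (?Y v ?f)) \<le> norm ?Y * norm v * norm (?Y v ?f)" by (rule app)
              also have "\<dots> \<le> K * n * (K * n * M)"
                unfolding n_def by (intro mult_mono KC[OF ty] Yv[unfolded n_def] order_refl) (use K in auto)
              finally have b2: "norm (?Y v (?Y v ?f)) \<le> K * n * (K * n * M)" .
              have "norm (t *\<^sub>R ((?Z - ?Y) z (?Y v ?f) + ?Y v (?Y v ?f))) \<le> norm ((?Z - ?Y) z (?Y v ?f) + ?Y v (?Y v ?f))"
                using t by (simp add: mult_left_le_one_le)
              also have "\<dots> \<le> (K * n) * r * (K * n * M) + K * n * (K * n * M)"
                by (intro order_trans[OF norm_triangle_ineq] add_mono b1 b2)
              finally show ?thesis by (simp add: algebra_simps)
            qed
            have "norm (\<delta>' t) \<le> 1 / 2 * norm (\<delta> t) + (e1 * n * r * M + K * n * n * M) + (K * r + K) * n * (K * n * M)"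
              unfolding dec by (intro order_trans[OF norm_triangle_ineq] add_mono a1 a2 a3 a4)
            also have "\<dots> = 1 / 2 * norm (\<delta> t) + E"
              by (simp add: E_def L_def algebra_simps power2_eq_square)
            finally show ?thesis .
          qed
          have dcont: "continuous_on {0..1} \<delta>"
            by (rule continuous_on_vector_derivative[OF der])
          \<comment> \<open>Replaces a Gronwall argument: at a maximum of
            \<open>norm (\<delta> t)\<close> the mean value inequality bounds the maximum by half of
            itself plus \<open>E\<close>.\<close>
          obtain t0 where t0: "t0 \<in> {0..1}" "\<And>t. t \<in> {0..1} \<Longrightarrow> norm (\<delta> t) \<le> norm (\<delta> t0)"
            using continuous_attains_sup[OF _ _ continuous_on_norm[OF dcont]] by auto
          have "norm (\<delta> t0 - \<delta> 0) \<le> (1 / 2 * norm (\<delta> t0) + E) * norm (t0 - 0)"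
          proof (rule differentiable_bound[of "{0..1}" \<delta> "\<lambda>t h. h *\<^sub>R \<delta>' t"])
            show "(\<delta> has_derivative (\<lambda>h. h *\<^sub>R \<delta>' t)) (at t within {0..1})" if "t \<in> {0..1}" for t
              using der[OF that] by (simp add: has_vector_derivative_def)
            show "onorm (\<lambda>h. h *\<^sub>R \<delta>' t) \<le> 1 / 2 * norm (\<delta> t0) + E" if "t \<in> {0..1}" for t
            proof (rule onorm_le)
              show "norm (h *\<^sub>R \<delta>' t) \<le> (1 / 2 * norm (\<delta> t0) + E) * norm h" for h
                using bound[OF that] t0(2)[OF that] by (auto simp: mult.commute intro!: mult_left_mono)
            qed
          qed (use t0 in auto)
          also have "\<dots> \<le> (1 / 2 * norm (\<delta> t0) + E) * 1"
            using t0(1) e1 r n0 M L by (intro mult_left_mono) (auto simp: E_def)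
          finally have "norm (\<delta> t0) \<le> 2 * E" by (simp add: \<delta>_def)
          then have "norm (\<delta> 1) \<le> 2 * E" using t0(2)[of 1] by simp
          also have "2 * E \<le> e * n"
          proof -
            have "2 * M * (e1 * r * n) = e / 2 * n" using M r by (simp add: e1_def field_simps)
            moreover have "2 * M * (L * n\<^sup>2) \<le> e / 2 * n"
            proof -
              have "2 * M * L * n \<le> 2 * M * L * d2" using z(2) M L by (intro mult_left_mono) (auto simp: n_def v_def)
              also have "\<dots> = e / 2" using M L by (simp add: d2_def field_simps)
              finally have "2 * M * L * n * n \<le> e / 2 * n" using n0 by (intro mult_right_mono) auto
              then show ?thesis by (simp add: power2_eq_square mult.assoc)
            qed
            moreover have "2 * E = 2 * M * (e1 * r * n) + 2 * M * (L * n\<^sup>2)"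
              by (simp add: E_def distrib_left mult.assoc)
            moreover have "e / 2 * n + e / 2 * n = e * n" by simp
            ultimately show ?thesis by linarith
          qed
          finally show ?thesis by (simp add: \<delta>_def n_def v_def)
        qed
        moreover have "min d1 d2 > 0" using d1(1) d2 by simp
        ultimately show ?thesis by (intro exI[of _ "min d1 d2"] conjI ballI impI)
      qed
      have "(f has_derivative (\<lambda>v. C y v (f y))) (at y within ball 0 r)"
        unfolding has_derivative_within_alt
      proof (intro conjI allI impI)
        show "bounded_linear (\<lambda>v. C y v (f y))"
          using bounded_linear_compose[OF blinfun.bounded_linear_left[of "f y"] blinfun.bounded_linear_right[of "C y"]] .
        show "\<exists>d>0. \<forall>z\<in>ball 0 r. norm (z - y) < d \<longrightarrow> norm (f z - f y - C y (z - y) (f y)) \<le> e * norm (z - y)"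
          if "e > 0" for e by (rule main[OF that])
      qed
      then show ?thesis unfolding at_within_open[OF y open_ball] .
    qed
    then show ?thesis by (intro exI[of _ f] conjI ballI f0)
  qed
  then show ?thesis by (rule that[OF r(1) order_trans[OF ball_subset_cball BU]])
qed

section \<open>Flat sections for bilinear coefficients at an arbitrary base point\<close>

lemma smooth_on_blinfun:
  fixes F :: "'c::real_normed_vector \<Rightarrow> 'a::euclidean_space \<Rightarrow>\<^sub>L 'b::real_normed_vector"
  assumes S: "open S" and F: "\<And>e. e \<in> Basis \<Longrightarrow> smooth_on S (\<lambda>y. F y e)"
  shows "smooth_on S F"
proof -
  define L where "L e c = blinfun_scaleR_left c o\<^sub>L blinfun_inner_left e" for e :: 'a and c :: 'b
  have L: "bounded_linear (L e)" for e
    unfolding L_def[abs_def]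
    by (rule bounded_linear_compose[OF bounded_bilinear.bounded_linear_left[OF bounded_bilinear_blinfun_compose] bounded_linear_blinfun_scaleR_left])
  have "F y = (\<Sum>e\<in>Basis. L e (F y e))" for y
  proof (rule blinfun_eqI)
    fix x
    have "(\<Sum>e\<in>Basis. L e (F y e)) x = (\<Sum>e\<in>Basis. (x \<bullet> e) *\<^sub>R F y e)"
      by (simp add: blinfun.sum_left L_def)
    also have "\<dots> = F y (\<Sum>e\<in>Basis. (x \<bullet> e) *\<^sub>R e)"
      by (simp only: blinfun.sum_right blinfun.scaleR_right)
    finally show "F y x = (\<Sum>e\<in>Basis. L e (F y e)) x" by (simp add: euclidean_representation)
  qed
  moreover have "smooth_on S (\<lambda>y. \<Sum>e\<in>Basis. L e (F y e))"
    by (intro smooth_on_sum S smooth_on_linear_image[OF S L] F)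
  ultimately show ?thesis by presburger
qed

text \<open>The estimates for flat sections use operator norms, hence bilinear families are
  repackaged as nested bounded linear maps.\<close>

definition bilinear_blinfun :: "('a::euclidean_space \<Rightarrow> 'b::euclidean_space \<Rightarrow> 'c::real_normed_vector) \<Rightarrow> 'a \<Rightarrow>\<^sub>L ('b \<Rightarrow>\<^sub>L 'c)" where
  "bilinear_blinfun b = Blinfun (\<lambda>v. Blinfun (b v))"

lemma bilinear_blinfun_apply:
  assumes 1: "\<And>x. linear (\<lambda>v. b v x)" and 2: "\<And>v. linear (b v)"
  shows "bilinear_blinfun b v x = b v x"
proof -
  have 3: "blinfun_apply (Blinfun (b v)) = b v" for v
    by (rule bounded_linear_Blinfun_apply) (use 2 linear_conv_bounded_linear in blast)
  have "linear (\<lambda>v. Blinfun (b v))"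
    by (rule linearI; rule blinfun_eqI)
      (simp_all add: 3 blinfun.add_left blinfun.scaleR_left linear_add[OF 1] linear_scale[OF 1])
  then have "bounded_linear (\<lambda>v. Blinfun (b v))" by (simp add: linear_conv_bounded_linear)
  then have "blinfun_apply (bilinear_blinfun b) v = Blinfun (b v)"
    by (simp add: bilinear_blinfun_def bounded_linear_Blinfun_apply)
  then show ?thesis by (simp add: 3)
qed

text \<open>The ball is chosen before the initial value, so that a whole basis of sections exists on
  a common domain.\<close>

theorem flat_section:
  fixes b :: "'a::euclidean_space \<Rightarrow> 'a \<Rightarrow> 'b::euclidean_space \<Rightarrow> 'b"
  assumes U: "open U" "y0 \<in> U"
    and lin: "\<And>y x. linear (\<lambda>v. b y v x)" "\<And>y v. linear (b y v)"
    and sm: "\<And>v x. smooth_on U (\<lambda>y. b y v x)"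
    and flat: "\<And>y v w x. y \<in> U \<Longrightarrow>
      frechet_derivative (\<lambda>y. b y w x) (at y) v + b y w (b y v x)
      = frechet_derivative (\<lambda>y. b y v x) (at y) w + b y v (b y w x)"
  obtains r where "r > 0" "ball y0 r \<subseteq> U"
    "\<And>\<xi>. \<exists>f. f y0 = \<xi> \<and> (\<forall>y\<in>ball y0 r. (f has_derivative (\<lambda>v. b y v (f y))) (at y))"
proof -
  define C where "C y = bilinear_blinfun (b (y0 + y))" for y
  have Cb: "C y v x = b (y0 + y) v x" for y v x
    unfolding C_def by (rule bilinear_blinfun_apply[OF lin])
  define U' where "U' = (\<lambda>y. y0 + y) -` U"
  have U': "open U'" "0 \<in> U'"
    using U by (auto simp: U'_def intro!: open_vimage continuous_intros)
  have sh: "smooth_on U' (\<lambda>y. y0 + y)"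
    by (intro smooth_on_add smooth_on_const smooth_on_bounded_linear bounded_linear_ident U')
  have smC: "smooth_on U' C"
  proof (intro smooth_on_blinfun U')
    fix e :: 'a and d :: 'b
    show "smooth_on U' (\<lambda>y. C y e d)"
      unfolding Cb by (rule smooth_on_compose[OF U'(1) sm sh]) (auto simp: U'_def)
  qed
  define DC where "DC y = Blinfun (frechet_derivative C (at y))" for y
  have DC: "blinfun_apply (DC y) = frechet_derivative C (at y)" if "y \<in> U'" for y
    unfolding DC_def
    by (rule bounded_linear_Blinfun_apply[OF has_derivative_bounded_linear[OF smooth_on_has_derivative[OF smC that]]])
  have D: "(C has_derivative DC y) (at y)" if "y \<in> U'" for y
    unfolding DC[OF that] by (rule smooth_on_has_derivative[OF smC that])
  have DCc: "continuous_on U' DC"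
  proof (rule continuous_on_blinfun_componentwise)
    fix i :: 'a
    have "continuous_on U' (\<lambda>y. frechet_derivative C (at y) i)"
      by (rule smooth_on_continuous[OF smooth_on_dderiv[OF smC]])
    then show "continuous_on U' (\<lambda>y. DC y i)"
      by (rule continuous_on_cong[THEN iffD1, rotated -1]) (auto simp: DC)
  qed
  have fd: "DC y v w x = frechet_derivative (\<lambda>y. b y w x) (at (y0 + y)) v" if y: "y \<in> U'" for y v w x
  proof -
    have 1: "((\<lambda>y. C y w x) has_derivative (\<lambda>v. DC y v w x)) (at y)"
      by (intro bounded_linear.has_derivative[OF blinfun.bounded_linear_left] D y)
    have yU: "y0 + y \<in> U" using y by (simp add: U'_def)
    have "((\<lambda>y. y0 + y) has_derivative (\<lambda>v. v)) (at y)" by (auto intro!: derivative_eq_intros)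
    from diff_chain_at[OF this smooth_on_has_derivative[OF sm yU], of w x]
    have 2: "((\<lambda>y. C y w x) has_derivative frechet_derivative (\<lambda>y. b y w x) (at (y0 + y))) (at y)"
      by (simp add: o_def Cb)
    show ?thesis using fun_cong[OF has_derivative_unique[OF 1 2]] .
  qed
  obtain r where r: "r > 0" "ball 0 r \<subseteq> U'"
    "\<And>\<xi>. \<exists>f. f 0 = \<xi> \<and> (\<forall>y\<in>ball 0 r. (f has_derivative (\<lambda>v. C y v (f y))) (at y))"
  proof (rule flat_section_at_0[OF U' D DCc])
    fix y v w x assume y: "y \<in> U'"
    then have "y0 + y \<in> U" by (simp add: U'_def)
    from flat[OF this, of w x v]
    show "DC y v w x + C y w (C y v x) = DC y w v x + C y v (C y w x)"
      unfolding fd[OF y] Cb .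
  qed blast+
  show ?thesis
  proof (rule that[OF r(1)])
    show "ball y0 r \<subseteq> U"
    proof
      fix y assume "y \<in> ball y0 r"
      then have "y - y0 \<in> ball 0 r" by (simp add: dist_norm norm_minus_commute)
      then have "y - y0 \<in> U'" using r(2) by blast
      then show "y \<in> U" by (simp add: U'_def)
    qed
    fix \<xi>
    obtain f where f: "f 0 = \<xi>" "\<And>y. y \<in> ball 0 r \<Longrightarrow> (f has_derivative (\<lambda>v. C y v (f y))) (at y)"
      using r(3)[of \<xi>] by blast
    show "\<exists>f. f y0 = \<xi> \<and> (\<forall>y\<in>ball y0 r. (f has_derivative (\<lambda>v. b y v (f y))) (at y))"
    proof (intro exI[of _ "\<lambda>y. f (y - y0)"] conjI ballI)
      show "f (y0 - y0) = \<xi>" using f(1) by simp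
      fix y assume "y \<in> ball y0 r"
      then have yb: "y - y0 \<in> ball 0 r" by (simp add: dist_norm norm_minus_commute)
      have "((\<lambda>y. y - y0) has_derivative (\<lambda>v. v)) (at y)" by (auto intro!: derivative_eq_intros)
      from diff_chain_at[OF this f(2)[OF yb]]
      show "((\<lambda>y. f (y - y0)) has_derivative (\<lambda>v. b y v (f (y - y0)))) (at y)"
        by (simp add: o_def Cb)
    qed
  qed
qed

section \<open>Joint eigenvectors\<close>

definition cmat :: "real^'n^'m \<Rightarrow> complex^'n^'m" where
  "cmat M = (\<chi> i j. complex_of_real (M $ i $ j))"

lemma cmat_mult: "cmat (M ** N) = cmat M ** cmat N"
  by (simp add: cmat_def matrix_matrix_mult_def vec_eq_iff)

lemma cmat_transpose: "cmat (transpose M) = transpose (cmat M)"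
  by (simp add: cmat_def transpose_def vec_eq_iff)

lemma cmat_one: "cmat (mat 1) = mat 1"
  by (simp add: cmat_def mat_def vec_eq_iff)

lemma cmat_add: "cmat (M + N) = cmat M + cmat N"
  by (simp add: cmat_def vec_eq_iff)

lemma cmat_scaleR: "cmat (r *\<^sub>R M) = r *\<^sub>R cmat M"
  by (simp add: cmat_def vec_eq_iff scaleR_conv_of_real[where 'a = complex])

lemma cmat_inj: "cmat M = 0 \<Longrightarrow> M = 0"
  by (simp add: cmat_def vec_eq_iff)

lemma diagonalizable_cmat:
  fixes L :: "real^'n^'n"
  shows "diagonalizable L \<longleftrightarrow> (\<exists>(S :: complex^'n^'n) d. invertible S \<and> cmat L ** S = S ** cdiag d)"
  by (simp add: diagonalizable_def cmat_def)

lemma diagonalizable_conj: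
  fixes L X Y :: "real^'n^'n"
  assumes "diagonalizable L" and XY: "X ** Y = mat 1" "Y ** X = mat 1"
  shows "diagonalizable (Y ** L ** X)"
proof -
  obtain S :: "complex^'n^'n" and d where S: "invertible S" "cmat L ** S = S ** cdiag d"
    using assms(1) diagonalizable_cmat by blast
  have i: "cmat X ** cmat Y = mat 1" "cmat Y ** cmat X = mat 1"
    using XY by (simp_all flip: cmat_mult add: cmat_one)
  have "invertible (cmat Y)" using i unfolding invertible_def by blast
  then have "invertible (cmat Y ** S)" using S(1) by (rule invertible_mult)
  moreover have "cmat (Y ** L ** X) ** (cmat Y ** S) = (cmat Y ** S) ** cdiag d"
  proof -
    have "cmat (Y ** L ** X) ** (cmat Y ** S) = cmat Y ** cmat L ** (cmat X ** cmat Y) ** S"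
      by (simp only: cmat_mult matrix_mul_assoc)
    also have "\<dots> = cmat Y ** (cmat L ** S)" by (simp only: i matrix_mul_rid matrix_mul_assoc)
    also have "\<dots> = cmat Y ** S ** cdiag d" by (simp only: S matrix_mul_assoc)
    finally show ?thesis .
  qed
  ultimately show ?thesis using diagonalizable_cmat by blast
qed

lemma transpose_cdiag: "transpose (cdiag d) = cdiag d"
  by (auto simp: cdiag_def transpose_def vec_eq_iff)

lemma diagonalizable_transpose:
  assumes "diagonalizable (L :: real^'n^'n)"
  shows "diagonalizable (transpose L)"
proof -
  obtain S :: "complex^'n^'n" and d where S: "invertible S" "cmat L ** S = S ** cdiag d"
    using assms diagonalizable_cmat by blast
  then obtain S' where S': "S ** S' = mat 1" "S' ** S = mat 1" unfolding invertible_def by blast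
  define W where "W = transpose S'"
  have W: "W ** transpose S = mat 1" "transpose S ** W = mat 1"
    using S' by (simp_all add: W_def transpose_mat flip: matrix_transpose_mul)
  have "transpose S ** cmat (transpose L) = cdiag d ** transpose S"
    using arg_cong[OF S(2), of transpose] by (simp add: matrix_transpose_mul cmat_transpose transpose_cdiag)
  then have "W ** (transpose S ** cmat (transpose L)) ** W = W ** (cdiag d ** transpose S) ** W" by simp
  then have "cmat (transpose L) ** W = W ** cdiag d"
    by (metis W matrix_mul_assoc matrix_mul_lid matrix_mul_rid)
  moreover have "invertible W" using W unfolding invertible_def by blast
  ultimately show ?thesis using diagonalizable_cmat by blast
qed

lemma scaleR_matrix_vector_complex: "(c *\<^sub>R M) *v y = c *\<^sub>R (M *v (y :: complex^'n))"
  and matrix_vector_scaleR_complex: "M *v (c *\<^sub>R y) = c *\<^sub>R (M *v (y :: complex^'n))"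
  by (simp_all add: vec_eq_iff matrix_vector_mult_def scaleR_sum_right)

text \<open>Contains 0, and the eigenvalue may depend on the matrix. The set is closed under complex
  scalars, so taking its real \<open>span\<close> below loses nothing.\<close>

definition joint_eigenvectors :: "(complex^'n^'n) set \<Rightarrow> (complex^'n) set" where
  "joint_eigenvectors Ms = {x. \<forall>M\<in>Ms. \<exists>\<nu>. M *v x = \<nu> *s x}"

text \<open>In a basis diagonalizing \<open>M\<close>, whatever commutes with \<open>M\<close> commutes with the spectral projections.\<close>
lemma span_joint_eigenvectors_step:
  fixes M S :: "complex^'n^'n"
  assumes S: "invertible S" "M ** S = S ** cdiag d"
    and comm: "\<And>N. N \<in> Ms \<Longrightarrow> N ** M = M ** N"
    and x: "x \<in> joint_eigenvectors Ms"
  shows "x \<in> span (joint_eigenvectors (insert M Ms))"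
proof -
  obtain S' where S': "S ** S' = mat 1" "S' ** S = mat 1" using S(1) unfolding invertible_def by blast
  \<comment> \<open>Projects onto the coordinates with eigenvalue \<open>e\<close> in the
    diagonalizing basis; \<open>Q e\<close> is the spectral projection in the original
    basis.\<close>
  define Z where "Z e = cdiag (\<chi> i. if d $ i = e then 1 else 0)" for e
  define Q where "Q e = S ** Z e ** S'" for e
  have Zd: "cdiag d ** Z e = mat e ** Z e" for e
    by (auto simp: Z_def cdiag_def mat_def matrix_matrix_mult_def vec_eq_iff if_distrib[of "\<lambda>x. x * _"] sum.If_cases
        intro!: sum.cong)
  have MQ: "M *v (Q e *v x) = e *s (Q e *v x)" for e
  proof -
    have "M ** Q e = S ** (cdiag d ** Z e) ** S'" unfolding Q_def by (simp only: matrix_mul_assoc S)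
    also have "\<dots> = S ** mat e ** Z e ** S'" by (simp only: Zd matrix_mul_assoc)
    also have "S ** mat e = mat e ** S"
      by (auto simp: mat_def matrix_matrix_mult_def vec_eq_iff if_distrib[of "\<lambda>x. x * _"] if_distrib[of "\<lambda>x. _ * x"] cong: if_cong)
    finally have "M ** Q e = mat e ** Q e" unfolding Q_def by (simp only: matrix_mul_assoc)
    then have "M *v (Q e *v x) = mat e *v (Q e *v x)" by (simp add: matrix_vector_mul_assoc)
    also have "\<dots> = e *s (Q e *v x)"
      by (auto simp: mat_def matrix_vector_mult_def vec_eq_iff if_distrib[of "\<lambda>x. x * _"] cong: if_cong)
    finally show ?thesis .
  qed
  have NQ: "N ** Q e = Q e ** N" if "N \<in> Ms" for N e
  proof -
    define N' where "N' = S' ** N ** S"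
    have "N' ** cdiag d = S' ** N ** (S ** cdiag d)" by (simp only: N'_def matrix_mul_assoc)
    also have "\<dots> = S' ** (N ** M) ** S" by (simp only: S(2)[symmetric] matrix_mul_assoc)
    also have "\<dots> = S' ** M ** (S ** S') ** N ** S" by (simp only: comm[OF that] S' matrix_mul_rid matrix_mul_assoc)
    also have "\<dots> = S' ** (M ** S) ** S' ** N ** S" by (simp only: matrix_mul_assoc)
    also have "\<dots> = (S' ** S) ** cdiag d ** N'" by (simp only: S N'_def matrix_mul_assoc)
    finally have "N' ** cdiag d = cdiag d ** N'" by (simp only: S' matrix_mul_lid)
    then have "(N' ** cdiag d) $ i $ j = (cdiag d ** N') $ i $ j" for i j by simp
    then have e: "N' $ i $ j * d $ j = d $ i * N' $ i $ j" for i j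
      by (simp add: cdiag_def matrix_matrix_mult_def if_distrib[of "\<lambda>x. x * _"] if_distrib[of "\<lambda>x. _ * x"] cong: if_cong)
    \<comment> \<open>Nonzero entries of \<open>N'\<close> occur only between equal eigenvalues of
      \<open>M\<close>, so \<open>N'\<close> respects the blocks selected by
      \<open>Z e\<close>.\<close>
    have "N' $ i $ j * (if d $ j = e then 1 else 0) = (if d $ i = e then 1 else 0) * N' $ i $ j" for i j
      using e[of i j] by (cases "N' $ i $ j = 0") auto
    then have "N' ** Z e = Z e ** N'"
      by (simp add: Z_def cdiag_def matrix_matrix_mult_def vec_eq_iff
          if_distrib[of "\<lambda>x. x * _"] if_distrib[of "\<lambda>x. _ * x"] cong: if_cong)
    then have "S ** (N' ** Z e) ** S' = S ** (Z e ** N') ** S'" by simp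
    moreover have "S ** (N' ** Z e) ** S' = (S ** S') ** N ** Q e" by (simp only: N'_def Q_def matrix_mul_assoc)
    moreover have "S ** (Z e ** N') ** S' = Q e ** N ** (S ** S')" by (simp only: N'_def Q_def matrix_mul_assoc)
    ultimately show ?thesis by (simp only: S' matrix_mul_lid matrix_mul_rid)
  qed
  have "(\<Sum>e\<in>range (\<lambda>i. d $ i). Z e) = mat 1"
  proof -
    have Zij: "Z e $ i $ j = (if i = j then if d $ i = e then 1 else 0 else 0)" for e i j
      by (simp add: Z_def cdiag_def)
    have "(\<Sum>e\<in>range (\<lambda>i. d $ i). Z e $ i $ j) = (mat 1 :: complex^'n^'n) $ i $ j" for i j
      unfolding Zij by (cases "i = j") (simp_all add: mat_def)
    then show ?thesis by (simp add: vec_eq_iff sum_component)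
  qed
  moreover have "(\<Sum>e\<in>range (\<lambda>i. d $ i). Q e *v x) = S *v ((\<Sum>e\<in>range (\<lambda>i. d $ i). Z e) *v (S' *v x))"
  proof -
    have l: "linear (\<lambda>Z. S *v (Z *v (S' *v x)))"
      by (simp add: linear_iff matrix_vector_mult_add_rdistrib matrix_vector_right_distrib
          scaleR_matrix_vector_complex matrix_vector_scaleR_complex)
    have "Q e *v x = S *v (Z e *v (S' *v x))" for e
      by (simp only: Q_def matrix_vector_mul_assoc[symmetric])
    then show ?thesis by (simp only: linear_sum[OF l])
  qed
  ultimately have sumQ: "(\<Sum>e\<in>range (\<lambda>i. d $ i). Q e *v x) = x"
    by (simp add: matrix_vector_mul_assoc S')
  have "Q e *v x \<in> joint_eigenvectors (insert M Ms)" for e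
    unfolding joint_eigenvectors_def
  proof (rule CollectI, rule ballI)
    fix N assume "N \<in> insert M Ms"
    then consider "N = M" | "N \<in> Ms" by auto
    then show "\<exists>\<nu>. N *v (Q e *v x) = \<nu> *s (Q e *v x)"
    proof cases
      case 1 then show ?thesis using MQ by blast
    next
      case 2
      then obtain \<nu> where \<nu>: "N *v x = \<nu> *s x" using x unfolding joint_eigenvectors_def by blast
      have "N *v (Q e *v x) = Q e *v (N *v x)" by (simp add: matrix_vector_mul_assoc NQ[OF 2])
      also have "\<dots> = \<nu> *s (Q e *v x)" by (simp add: \<nu> matrix_vector_mult_scaleR vector_scalar_commute)
      finally show ?thesis by blast
    qed
  qed
  then have "(\<Sum>e\<in>range (\<lambda>i. d $ i). Q e *v x) \<in> span (joint_eigenvectors (insert M Ms))"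
    by (intro span_sum span_base)
  then show ?thesis unfolding sumQ .
qed

lemma span_joint_eigenvectors:
  fixes Ms :: "(complex^'n^'n) set"
  assumes "finite Ms"
    and "\<And>M. M \<in> Ms \<Longrightarrow> \<exists>(S :: complex^'n^'n) d. invertible S \<and> M ** S = S ** cdiag d"
    and "\<And>M N. M \<in> Ms \<Longrightarrow> N \<in> Ms \<Longrightarrow> M ** N = N ** M"
  shows "span (joint_eigenvectors Ms) = UNIV"
  using assms
proof (induction Ms rule: finite_induct)
  case empty
  then show ?case by (simp add: joint_eigenvectors_def)
next
  case (insert M Ms)
  obtain S :: "complex^'n^'n" and d where S: "invertible S" "M ** S = S ** cdiag d" using insert.prems(1)[of M] by blast
  have IH: "span (joint_eigenvectors Ms) = UNIV" using insert.IH insert.prems by simp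
  have "joint_eigenvectors Ms \<subseteq> span (joint_eigenvectors (insert M Ms))"
  proof
    fix x assume "x \<in> joint_eigenvectors Ms"
    then show "x \<in> span (joint_eigenvectors (insert M Ms))"
      by (rule span_joint_eigenvectors_step[OF S, rotated]) (use insert.prems(2) in simp)
  qed
  then have "span (joint_eigenvectors Ms) \<subseteq> span (joint_eigenvectors (insert M Ms))"
    by (rule span_minimal) (rule subspace_span)
  then show ?case using IH by blast
qed

text \<open>An infinite commuting family reduces to a finite one: a basis of its span may be taken
  from the family, and joint eigenvectors of the basis remain so for every real combination. The
  span is included because the derivatives of \<open>N\<close> will be found there.\<close>

lemma span_joint_eigenvectors_cmat:
  fixes Ns :: "(real^'n^'n) set"
  assumes diag: "\<And>N. N \<in> Ns \<Longrightarrow> diagonalizable N"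
    and comm: "\<And>M N. M \<in> Ns \<Longrightarrow> N \<in> Ns \<Longrightarrow> M ** N = N ** M"
  shows "span (joint_eigenvectors (cmat ` span Ns)) = UNIV"
proof -
  obtain B where B: "B \<subseteq> Ns" "independent B" "Ns \<subseteq> span B"
    by (rule basis_exists[of Ns])
  have fin: "finite B" by (rule independent_imp_finite[OF B(2)])
  have 1: "span (joint_eigenvectors (cmat ` B)) = UNIV"
  proof (rule span_joint_eigenvectors)
    show "finite (cmat ` B)" using fin by simp
    show "\<exists>(S :: complex^'n^'n) d. invertible S \<and> M ** S = S ** cdiag d" if "M \<in> cmat ` B" for M
    proof -
      obtain M' where M': "M = cmat M'" "M' \<in> B" using \<open>M \<in> cmat ` B\<close> by (rule imageE)
      have "M' \<in> Ns" using M'(2) B(1) by (rule subsetD[rotated])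
      from diag[OF this] show ?thesis unfolding diagonalizable_cmat M'(1) .
    qed
    show "M ** N = N ** M" if M: "M \<in> cmat ` B" "N \<in> cmat ` B" for M N
    proof -
      obtain M' where M': "M = cmat M'" "M' \<in> B" using M(1) by (rule imageE)
      obtain N' where N': "N = cmat N'" "N' \<in> B" using M(2) by (rule imageE)
      have "M' ** N' = N' ** M'" using M'(2) N'(2) B(1) by (intro comm) (rule subsetD, assumption+)+
      then show ?thesis unfolding M'(1) N'(1) cmat_mult[symmetric] by (rule arg_cong)
    qed
  qed
  have "joint_eigenvectors (cmat ` B) \<subseteq> joint_eigenvectors (cmat ` span Ns)"
  proof
    fix x assume x: "x \<in> joint_eigenvectors (cmat ` B)"
    have "\<exists>\<nu>. cmat N *v x = \<nu> *s x" if "N \<in> span B" for N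
      using that
    proof (induction rule: span_induct_alt)
      case base
      show ?case
        by (rule exI[of _ 0]) (simp add: cmat_def matrix_vector_mult_def vec_eq_iff)
    next
      case (step c M N)
      obtain \<mu> where \<mu>: "cmat M *v x = \<mu> *s x" using x step(1) unfolding joint_eigenvectors_def by blast
      obtain \<nu> where \<nu>: "cmat N *v x = \<nu> *s x" using step(2) by blast
      have "cmat (c *\<^sub>R M + N) *v x = c *\<^sub>R (cmat M *v x) + cmat N *v x"
        by (simp add: cmat_add cmat_scaleR matrix_vector_mult_add_rdistrib scaleR_matrix_vector_complex)
      also have "\<dots> = (of_real c * \<mu> + \<nu>) *s x"
        unfolding \<mu> \<nu> by (simp add: vec_eq_iff algebra_simps scaleR_conv_of_real[where 'a = complex])
      finally show ?case by (rule exI)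
    qed
    moreover have "span Ns \<subseteq> span B" by (rule span_minimal[OF B(3) subspace_span])
    ultimately show "x \<in> joint_eigenvectors (cmat ` span Ns)" unfolding joint_eigenvectors_def by auto
  qed
  from span_mono[OF this] show ?thesis unfolding 1 by (rule top.extremum_uniqueI)
qed

text \<open>The complex bilinear, not Hermitian, extension: symmetry and the cyclic identity of the
  real entries carry over to complex eigenvectors.\<close>

definition cbil :: "real^'n^'n \<Rightarrow> complex^'n \<Rightarrow> complex^'n \<Rightarrow> complex" where
  "cbil M x y = (\<Sum>i\<in>UNIV. x $ i * (cmat M *v y) $ i)"

lemma cbil_alt: "cbil M x y = (\<Sum>i\<in>UNIV. \<Sum>j\<in>UNIV. x $ i * y $ j * of_real (M $ i $ j))"
  by (simp add: cbil_def cmat_def matrix_vector_mult_def sum_distrib_left ac_simps)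

lemma cbil_sym: "transpose M = M \<Longrightarrow> cbil M x y = cbil M y x"
  unfolding cbil_alt
  by (subst sum.swap) (auto simp: transpose_def vec_eq_iff ac_simps intro!: sum.cong)

lemma linear_cbil: "linear (\<lambda>x. cbil M x y)"
  by (simp add: linear_iff cbil_def sum.distrib distrib_right scaleR_sum_right)

text \<open>Weights \<open>\<lambda>\<close> of the commuting family \<open>R k\<close> on joint eigenvectors: the cyclic identity reads
  \<open>\<lambda>\<^sub>y(z)\<eta>(x,y) + \<lambda>\<^sub>z(x)\<eta>(y,z) + \<lambda>\<^sub>x(y)\<eta>(z,x) = 0\<close>, and eigenvectors of different weight are orthogonal.\<close>
lemma obstruction_zero:
  fixes \<eta> :: "real^'n^'n" and R :: "'n \<Rightarrow> real^'n^'n"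
  assumes \<eta>: "transpose \<eta> = \<eta>" "det \<eta> \<noteq> 0"
    and sym: "\<And>k. transpose (\<eta> ** R k) = \<eta> ** R k"
    and cyc: "\<And>i j k. (\<eta> ** R k) $ i $ j + (\<eta> ** R i) $ j $ k + (\<eta> ** R j) $ k $ i = 0"
    and span: "span (joint_eigenvectors (cmat ` Ns)) = UNIV" and R: "\<And>k. R k \<in> Ns"
  shows "R k = 0"
proof -
  define EV where "EV = joint_eigenvectors (cmat ` Ns)"
  have "\<exists>l. \<forall>k. cmat (R k) *v x = l k *s x" if "x \<in> EV" for x
  proof -
    have "\<exists>\<nu>. cmat (R k) *v x = \<nu> *s x" for k
      using that R[of k] unfolding EV_def joint_eigenvectors_def by auto
    then show ?thesis by (intro choice) simp
  qed
  then obtain l where l: "\<And>x k. x \<in> EV \<Longrightarrow> cmat (R k) *v x = l x k *s x" by metis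
  \<comment> \<open>The index of \<open>R\<close> is made a vector slot of its own; the cyclic
    identity permutes it with the other two, so eigenvectors are inserted there too.\<close>
  define w where "w x z = (\<Sum>k\<in>UNIV. z $ k * l x k)" for x z
  define t where "t x y z = (\<Sum>k\<in>UNIV. z $ k * cbil (\<eta> ** R k) x y)" for x y z
  have t: "t x y z = w y z * cbil \<eta> x y" if "y \<in> EV" for x y z
  proof -
    have "cbil (\<eta> ** R k) x y = l y k * cbil \<eta> x y" for k
    proof -
      have "cmat (\<eta> ** R k) *v y = cmat \<eta> *v (l y k *s y)"
        by (simp add: cmat_mult l[OF that] flip: matrix_vector_mul_assoc)
      also have "\<dots> = l y k *s (cmat \<eta> *v y)" by (simp add: vector_scalar_commute)
      finally show ?thesis by (simp add: cbil_def sum_distrib_left ac_simps)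
    qed
    then show ?thesis by (simp add: t_def w_def sum_distrib_right mult.assoc)
  qed
  have t_sym: "t x y z = t y x z" for x y z
    unfolding t_def by (simp add: cbil_sym[OF sym])
  define T where "T i j k = complex_of_real ((\<eta> ** R k) $ i $ j)" for i j k
  have t_alt: "t x y z = (\<Sum>k\<in>UNIV. \<Sum>i\<in>UNIV. \<Sum>j\<in>UNIV. x $ i * y $ j * z $ k * T i j k)" for x y z
    by (simp add: t_def cbil_alt T_def sum_distrib_left ac_simps)
  have t_cyc: "t x y z + t y z x + t z x y = 0" for x y z
  proof -
    have 1: "t y z x = (\<Sum>k\<in>UNIV. \<Sum>i\<in>UNIV. \<Sum>j\<in>UNIV. x $ i * y $ j * z $ k * T j k i)"
    proof -
      have "t y z x = (\<Sum>i\<in>UNIV. \<Sum>j\<in>UNIV. \<Sum>k\<in>UNIV. x $ i * y $ j * z $ k * T j k i)"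
        unfolding t_alt by (simp add: ac_simps)
      also have "\<dots> = (\<Sum>i\<in>UNIV. \<Sum>k\<in>UNIV. \<Sum>j\<in>UNIV. x $ i * y $ j * z $ k * T j k i)"
        by (rule sum.cong[OF refl]) (rule sum.swap)
      also have "\<dots> = (\<Sum>k\<in>UNIV. \<Sum>i\<in>UNIV. \<Sum>j\<in>UNIV. x $ i * y $ j * z $ k * T j k i)"
        by (rule sum.swap)
      finally show ?thesis .
    qed
    have 2: "t z x y = (\<Sum>k\<in>UNIV. \<Sum>i\<in>UNIV. \<Sum>j\<in>UNIV. x $ i * y $ j * z $ k * T k i j)"
    proof -
      have "t z x y = (\<Sum>j\<in>UNIV. \<Sum>k\<in>UNIV. \<Sum>i\<in>UNIV. x $ i * y $ j * z $ k * T k i j)"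
        unfolding t_alt by (simp add: ac_simps)
      also have "\<dots> = (\<Sum>k\<in>UNIV. \<Sum>j\<in>UNIV. \<Sum>i\<in>UNIV. x $ i * y $ j * z $ k * T k i j)"
        by (rule sum.swap)
      also have "\<dots> = (\<Sum>k\<in>UNIV. \<Sum>i\<in>UNIV. \<Sum>j\<in>UNIV. x $ i * y $ j * z $ k * T k i j)"
        by (rule sum.cong[OF refl]) (rule sum.swap)
      finally show ?thesis .
    qed
    have T: "T i j k + T j k i + T k i j = 0" for i j k
      unfolding T_def of_real_add[symmetric] cyc by simp
    have "t x y z + t y z x + t z x y
      = (\<Sum>k\<in>UNIV. \<Sum>i\<in>UNIV. \<Sum>j\<in>UNIV. x $ i * y $ j * z $ k * (T i j k + T j k i + T k i j))"
      unfolding 1 2 by (simp only: t_alt sum.distrib distrib_left)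
    then show ?thesis by (simp only: T) simp
  qed
  have c: "w y z * cbil \<eta> x y + w z x * cbil \<eta> y z + w x y * cbil \<eta> z x = 0"
    if "x \<in> EV" "y \<in> EV" "z \<in> EV" for x y z
    using t_cyc[of x y z] that by (simp add: t)
  have s: "cbil \<eta> x y = cbil \<eta> y x" for x y by (rule cbil_sym[OF \<eta>(1)])
  have orth: "w x z = w y z" if "x \<in> EV" "y \<in> EV" "cbil \<eta> x y \<noteq> 0" for x y z
    using t_sym[of x y z] that t[of y x z] t[of x y z] s[of x y] by simp
  have nd: "\<exists>y\<in>EV. cbil \<eta> y x \<noteq> 0" if x: "x \<noteq> 0" for x
  proof (rule ccontr)
    assume "\<not> (\<exists>y\<in>EV. cbil \<eta> y x \<noteq> 0)"
    then have z: "cbil \<eta> y x = 0" if "y \<in> EV" for y using that by blast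
    have "cbil \<eta> y x = 0" for y
      by (rule linear_eq_0_on_span[OF linear_cbil z]) (use span EV_def in auto)
    from this[of "axis i 1" for i] have "(cmat \<eta> *v x) $ i = 0" for i
      by (simp add: cbil_def axis_def if_distrib[of "\<lambda>x. x * _"] cong: if_cong)
    then have 0: "cmat \<eta> *v x = 0" by (simp add: vec_eq_iff)
    have "cmat (matrix_inv \<eta>) ** cmat \<eta> = mat 1"
      by (simp flip: cmat_mult add: matrix_inv_cancel[OF \<eta>(2)] cmat_one)
    then have "x = cmat (matrix_inv \<eta>) *v (cmat \<eta> *v x)" by (simp add: matrix_vector_mul_assoc)
    then show False using x 0 by simp
  qed
  \<comment> \<open>Otherwise the cyclic identity at \<open>a, a, a\<close> makes \<open>a\<close>
    isotropic. A partner \<open>b\<close> not orthogonal to \<open>a\<close> has the same weight,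
    and the identity at \<open>a, a, b\<close> leaves
    \<open>2 * w a a * cbil \<eta> b a = 0\<close>.\<close>
  have w0: "w a a = 0" if a: "a \<in> EV" for a
  proof (rule ccontr)
    assume nz: "w a a \<noteq> 0"
    then have "a \<noteq> 0" by (auto simp: w_def)
    then obtain b where b: "b \<in> EV" "cbil \<eta> b a \<noteq> 0" using nd by blast
    have 0: "cbil \<eta> a a = 0" using c[OF a a a] nz by simp
    have "w b a = w a a" by (rule orth[OF b(1) a b(2)])
    then have "2 * w a a * cbil \<eta> b a = 0"
      using c[OF a a b(1)] 0 s[of a b] by (simp add: algebra_simps)
    then show False using nz b(2) by simp
  qed
  have zero: "w x z = 0" if x: "x \<in> EV" "x \<noteq> 0" for x z
  proof -
    \<comment> \<open>If \<open>z\<close> has the weight of \<open>x\<close>, this is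
      \<open>w0\<close>. Otherwise \<open>z\<close> is orthogonal to \<open>x\<close> and also to a
      partner \<open>y\<close> of \<open>x\<close>, which shares the weight of \<open>x\<close>; the
      cyclic identity keeps only the term \<open>w y z * cbil \<eta> x y\<close>.\<close>
    have *: "w x z = 0" if z: "z \<in> EV" for z
    proof (cases "\<forall>v. w z v = w x v")
      case True
      then show ?thesis using w0[OF z] by simp
    next
      case False
      then obtain v where v: "w z v \<noteq> w x v" by blast
      obtain y where y: "y \<in> EV" "cbil \<eta> y x \<noteq> 0" using nd[OF x(2)] by blast
      have yx: "w y v = w x v" for v by (rule orth[OF y(1) x(1) y(2)])
      have 1: "cbil \<eta> z x = 0" using orth[OF z x(1)] v by blast
      have 2: "cbil \<eta> y z = 0" using orth[OF y(1) z] v yx by metis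
      show ?thesis using c[OF x(1) y(1) z] y(2) s[of x y] yx[of z] 1 2 by simp
    qed
    have "linear (w x)"
      by (simp add: linear_iff w_def sum.distrib distrib_right scaleR_sum_right)
    then show ?thesis
      by (rule linear_eq_0_on_span[where b = EV]) (use * span EV_def in auto)
  qed
  have "cmat (R k) *v x = 0" if x: "x \<in> EV" for x
  proof (cases "x = 0")
    case False
    have "l x k = w x (axis k 1)"
      by (simp add: w_def axis_def if_distrib[of "\<lambda>x. x * _"] cong: if_cong)
    then show ?thesis using zero[OF x False, of "axis k 1"] by (simp add: l[OF x])
  qed simp
  then have "cmat (R k) *v x = 0" for x
    by (rule linear_eq_0_on_span[where b = EV, rotated])
      (use span EV_def in \<open>auto simp: linear_iff matrix_vector_right_distrib matrix_vector_scaleR_complex\<close>)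
  then have "cmat (R k) = 0" by (metis matrix_eq matrix_vector_mult_0)
  then show ?thesis by (rule cmat_inj)
qed

section \<open>Flat coframes\<close>

lemma smooth_on_Pair:
  assumes "open S" "smooth_on S f" "smooth_on S g"
  shows "smooth_on S (\<lambda>x. (f x, g x))"
proof -
  have "smooth_on S (\<lambda>x. (f x, 0) + (0, g x))"
    by (intro smooth_on_add smooth_on_linear_image[where L = "\<lambda>a. (a, 0)"] smooth_on_linear_image[where L = "\<lambda>a. (0, a)"]
        assms bounded_linear_Pair bounded_linear_ident bounded_linear_zero)
  then show ?thesis by simp
qed

text \<open>Differentiability of \<open>b\<close> is known only for constant arguments. Expansion in
  components reduces the moving arguments to finitely many products with such functions.\<close>

lemma has_derivative_bilinear_family:
  fixes b :: "'a::real_normed_vector \<Rightarrow> real^'n \<Rightarrow> real^'m \<Rightarrow> 'd::real_normed_vector"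
  assumes lin: "\<And>y z. linear (\<lambda>x. b y x z)" "\<And>y x. linear (b y x)"
    and b: "\<And>e f. (\<lambda>y. b y e f) differentiable at y"
    and x: "(x has_derivative x') (at y)" and z: "(z has_derivative z') (at y)"
  shows "((\<lambda>y. b y (x y) (z y)) has_derivative
      (\<lambda>w. frechet_derivative (\<lambda>y'. b y' (x y) (z y)) (at y) w + b y (x' w) (z y) + b y (x y) (z' w))) (at y)"
proof -
  have exp: "b y c d = (\<Sum>i\<in>UNIV. \<Sum>j\<in>UNIV. (c $ i * d $ j) *\<^sub>R b y (axis i 1) (axis j 1))" for y c d
  proof -
    have "b y c d = b y (\<Sum>i\<in>UNIV. c $ i *\<^sub>R axis i 1) (\<Sum>j\<in>UNIV. d $ j *\<^sub>R axis j 1)"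
      by (simp add: basis_expansion flip: scalar_mult_eq_scaleR)
    also have "\<dots> = (\<Sum>i\<in>UNIV. c $ i *\<^sub>R b y (axis i 1) (\<Sum>j\<in>UNIV. d $ j *\<^sub>R axis j 1))"
      by (simp only: linear_sum[OF lin(1)] linear_scale[OF lin(1)])
    also have "\<dots> = (\<Sum>i\<in>UNIV. c $ i *\<^sub>R (\<Sum>j\<in>UNIV. d $ j *\<^sub>R b y (axis i 1) (axis j 1)))"
      by (simp only: linear_sum[OF lin(2)] linear_scale[OF lin(2)])
    also have "\<dots> = (\<Sum>i\<in>UNIV. \<Sum>j\<in>UNIV. (c $ i * d $ j) *\<^sub>R b y (axis i 1) (axis j 1))"
      by (simp only: scaleR_sum_right scaleR_scaleR)
    finally show ?thesis .
  qed
  let ?B = "\<lambda>i j w. frechet_derivative (\<lambda>y. b y (axis i 1) (axis j 1)) (at y) w"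
  have D: "((\<lambda>y. b y (axis i 1) (axis j 1)) has_derivative ?B i j) (at y)" for i j
    by (rule iffD1[OF frechet_derivative_works b])
  have xi: "((\<lambda>y. x y $ i) has_derivative (\<lambda>w. x' w $ i)) (at y)" for i
    by (rule bounded_linear.has_derivative[OF bounded_linear_vec_nth x])
  have zi: "((\<lambda>y. z y $ i) has_derivative (\<lambda>w. z' w $ i)) (at y)" for i
    by (rule bounded_linear.has_derivative[OF bounded_linear_vec_nth z])
  have "((\<lambda>y'. \<Sum>i\<in>UNIV. \<Sum>j\<in>UNIV. (x y $ i * z y $ j) *\<^sub>R b y' (axis i 1) (axis j 1)) has_derivative
      (\<lambda>w. \<Sum>i\<in>UNIV. \<Sum>j\<in>UNIV. (x y $ i * z y $ j) *\<^sub>R ?B i j w)) (at y)"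
    by (intro has_derivative_sum has_derivative_scaleR_right D)
  then have 1: "frechet_derivative (\<lambda>y'. b y' (x y) (z y)) (at y)
      = (\<lambda>w. \<Sum>i\<in>UNIV. \<Sum>j\<in>UNIV. (x y $ i * z y $ j) *\<^sub>R ?B i j w)"
    unfolding exp[symmetric] by (rule frechet_derivative_eq)
  have "((\<lambda>y. \<Sum>i\<in>UNIV. \<Sum>j\<in>UNIV. (x y $ i * z y $ j) *\<^sub>R b y (axis i 1) (axis j 1)) has_derivative
      (\<lambda>w. \<Sum>i\<in>UNIV. \<Sum>j\<in>UNIV. (x y $ i * z y $ j) *\<^sub>R ?B i j w
         + (x y $ i * z' w $ j + x' w $ i * z y $ j) *\<^sub>R b y (axis i 1) (axis j 1))) (at y)"
    by (intro has_derivative_sum has_derivative_scaleR has_derivative_mult D xi zi)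
  then show ?thesis
    unfolding exp[symmetric]
    by (rule has_derivative_eq_rhs)
      (simp add: fun_eq_iff 1 exp[of y "x' w" for w] exp[of y "x y" "z' w" for w] scaleR_add_left sum.distrib add.assoc)
qed

text \<open>By symmetry in the first three slots the value depends only on which of the four
  arguments comes last. The cyclic identities say that any three of these four values add up to 0,
  hence all are equal and vanish.\<close>

lemma sum_sym_cyclic_zero:
  fixes f :: "'a \<Rightarrow> 'a \<Rightarrow> 'a \<Rightarrow> 'a \<Rightarrow> real"
  assumes 1: "\<And>d a b c. f d a b c = f a d b c" and 2: "\<And>d a b c. f d a b c = f d b a c"
    and 3: "\<And>d a b c. f d a b c + f d b c a + f d c a b = 0"
  shows "f d a b c = 0"
proof -
  have "f d a b c + f d b c a + f d c a b = 0" "f a d b c + f a b c d + f a c d b = 0"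
    "f b d a c + f b a c d + f b c d a = 0" "f c d a b + f c a b d + f c b d a = 0"
    by (rule 3)+
  moreover have "f a d b c = f d a b c" "f b d a c = f d a b c" "f a c d b = f d c a b" "f b c d a = f d b c a"
    "f b a c d = f a b c d" "f c d a b = f d c a b" "f c a b d = f a b c d" "f c b d a = f d b c a"
    by (metis 1 2)+
  ultimately show ?thesis by linarith
qed

context hamiltonian_dn_operator
begin

text \<open>A parallel covector and its potential are found together, as a parallel section of the
  connection that sends \<open>(\<xi>, s)\<close> to
  \<open>(\<Gamma> y v \<xi>, \<xi> \<bullet> v)\<close>. Its flatness is \<open>flatness\<close> in
  the first component and \<open>\<Gamma>_sym\<close>, closedness of parallel covectors, in the
  second. The potentials \<open>s\<close> are the flat coordinates.\<close>

lemma flat_coframe: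
  assumes u0: "u0 \<in> U"
  obtains r \<xi> s where "r > 0" "ball u0 r \<subseteq> U"
    "\<And>a. \<xi> a u0 = axis a 1"
    "\<And>a y. y \<in> ball u0 r \<Longrightarrow> (\<xi> a has_derivative (\<lambda>v. \<Gamma> y v (\<xi> a y))) (at y)"
    "\<And>a y. y \<in> ball u0 r \<Longrightarrow> (s a has_derivative (\<lambda>v. \<xi> a y \<bullet> v)) (at y)"
proof -
  define b where "b y v q = (\<Gamma> y v (fst q), fst q \<bullet> v)" for y v and q :: "(real^'n) \<times> real"
  have lin: "linear (\<lambda>v. b y v q)" "linear (b y v)" for y v q
    unfolding b_def[abs_def]
    by (simp_all add: linear_iff linear_add[OF linear_\<Gamma>_left] linear_scale[OF linear_\<Gamma>_left]
        linear_add[OF linear_\<Gamma>_right] linear_scale[OF linear_\<Gamma>_right] inner_add_right inner_add_left)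
  have sm: "smooth_on U (\<lambda>y. b y v q)" for v q
    unfolding b_def by (intro smooth_on_Pair smooth_\<Gamma> smooth_on_const open_U)
  have fd: "frechet_derivative (\<lambda>y. b y w q) (at y) v = (frechet_derivative (\<lambda>y. \<Gamma> y w (fst q)) (at y) v, 0)"
    if y: "y \<in> U" for y w q v
  proof -
    have "((\<lambda>y. b y w q) has_derivative (\<lambda>v. (frechet_derivative (\<lambda>y. \<Gamma> y w (fst q)) (at y) v, 0))) (at y)"
      unfolding b_def by (intro has_derivative_Pair smooth_on_has_derivative[OF smooth_\<Gamma> y] has_derivative_const)
    then show ?thesis by (simp add: frechet_derivative_eq)
  qed
  obtain r where r: "r > 0" "ball u0 r \<subseteq> U"
    "\<And>q. \<exists>f. f u0 = q \<and> (\<forall>y\<in>ball u0 r. (f has_derivative (\<lambda>v. b y v (f y))) (at y))"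
  proof (rule flat_section[OF open_U u0 lin sm])
    fix y v w q assume y: "y \<in> U"
    show "frechet_derivative (\<lambda>y. b y w q) (at y) v + b y w (b y v q)
        = frechet_derivative (\<lambda>y. b y v q) (at y) w + b y v (b y w q)"
      unfolding fd[OF y] using flatness[OF y, of v "fst q" w] \<Gamma>_sym[OF y, of v "fst q" w]
      by (simp add: b_def algebra_simps)
  qed blast+
  have "\<exists>f. \<forall>a. f a u0 = (axis a 1, 0) \<and> (\<forall>y\<in>ball u0 r. (f a has_derivative (\<lambda>v. b y v (f a y))) (at y))"
    by (intro choice allI r(3))
  then obtain f where f: "\<And>a. f a u0 = (axis a 1, 0)"
    "\<And>a y. y \<in> ball u0 r \<Longrightarrow> (f a has_derivative (\<lambda>v. b y v (f a y))) (at y)"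
    by blast
  show ?thesis
  proof (rule that[OF r(1,2)])
    show "fst (f a u0) = axis a 1" for a by (simp add: f)
    show "((\<lambda>y. fst (f a y)) has_derivative (\<lambda>v. \<Gamma> y v (fst (f a y)))) (at y)" if "y \<in> ball u0 r" for a y
      using has_derivative_fst[OF f(2)[OF that]] by (simp add: b_def)
    show "((\<lambda>y. snd (f a y)) has_derivative (\<lambda>v. fst (f a y) \<bullet> v)) (at y)" if "y \<in> ball u0 r" for a y
      using has_derivative_snd[OF f(2)[OF that]] by (simp add: b_def)
  qed
qed

text \<open>Initially a section is only once differentiable. The functions
  \<open>c \<bullet> \<xi>\<close> with smooth \<open>c\<close> are closed under differentiation,
  since transposition moves \<open>\<Gamma>\<close> from \<open>\<xi>\<close> to
  \<open>c\<close>.\<close>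

lemma smooth_flat_section:
  assumes V: "open V" "V \<subseteq> U"
    and \<xi>: "\<And>y. y \<in> V \<Longrightarrow> (\<xi> has_derivative (\<lambda>v. \<Gamma> y v (\<xi> y))) (at y)"
  shows "smooth_on V \<xi>"
proof (rule smooth_on_vec[OF V(1)])
  fix i
  define tr where "tr v c y = (\<chi> k. \<Gamma> y v (axis k 1) \<bullet> c y)" for v and c :: "real^'n \<Rightarrow> real^'n" and y
  have tr: "c y \<bullet> \<Gamma> y v x = tr v c y \<bullet> x" for c v y x
    unfolding tr_def
    by (subst linear_as_inner[of "\<lambda>x. c y \<bullet> \<Gamma> y v x"])
      (simp_all add: linear_iff linear_add[OF linear_\<Gamma>_right] linear_scale[OF linear_\<Gamma>_right] inner_add_right inner_commute)
  have "smooth_on V (\<lambda>y. axis i 1 \<bullet> \<xi> y)"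
  proof (rule smooth_on_family[where Fam = "{\<lambda>y. c y \<bullet> \<xi> y | c. smooth_on V c}"
      and D = "\<lambda>h y. frechet_derivative h (at y)"])
    show "(\<lambda>y. axis i 1 \<bullet> \<xi> y) \<in> {\<lambda>y. c y \<bullet> \<xi> y | c. smooth_on V c}"
      by (rule CollectI, rule exI[of _ "\<lambda>y. axis i 1"]) (simp add: V)
    fix h assume "h \<in> {\<lambda>y. c y \<bullet> \<xi> y | c. smooth_on V c}"
    then obtain c where h: "h = (\<lambda>y. c y \<bullet> \<xi> y)" and c: "smooth_on V c" by blast
    have D: "(h has_derivative (\<lambda>v. c y \<bullet> \<Gamma> y v (\<xi> y) + frechet_derivative c (at y) v \<bullet> \<xi> y)) (at y)" if "y \<in> V" for y
      unfolding h by (intro has_derivative_inner smooth_on_has_derivative[OF c that] \<xi> that)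
    show "(h has_derivative frechet_derivative h (at y)) (at y)" if "y \<in> V" for y
      using D[OF that] frechet_derivative_at by fastforce
    fix v
    have "smooth_on V (tr v c)"
      by (rule smooth_on_vec[OF V(1)])
        (auto simp: tr_def intro!: smooth_on_inner smooth_on_subset[OF smooth_\<Gamma>] V c)
    then have "smooth_on V (\<lambda>y. tr v c y + frechet_derivative c (at y) v)"
      by (intro smooth_on_add smooth_on_dderiv c V)
    then have "(\<lambda>y. (tr v c y + frechet_derivative c (at y) v) \<bullet> \<xi> y) \<in> {\<lambda>y. c y \<bullet> \<xi> y | c. smooth_on V c}"
      by (intro CollectI exI[of _ "\<lambda>y. tr v c y + frechet_derivative c (at y) v"] conjI refl)
    moreover have "frechet_derivative h (at y) v = (tr v c y + frechet_derivative c (at y) v) \<bullet> \<xi> y" if "y \<in> V" for y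
      by (simp add: frechet_derivative_eq[OF D[OF that]] tr inner_add_left)
    ultimately show "\<exists>hs. set hs \<subseteq> {\<lambda>y. c y \<bullet> \<xi> y | c. smooth_on V c} \<and>
        (\<forall>y\<in>V. frechet_derivative h (at y) v = (\<Sum>k\<leftarrow>hs. k y))"
      by (intro exI[of _ "[\<lambda>y. (tr v c y + frechet_derivative c (at y) v) \<bullet> \<xi> y]"]) simp
  qed (rule V)
  then show "smooth_on V (\<lambda>y. \<xi> y $ i)" by (simp add: inner_axis inner_commute)
qed

end

section \<open>Vanishing of the obstruction\<close>

locale flat_frame = hamiltonian_dn_operator U A bc
  for U :: "(real^'n) set" and A bc +
  fixes u0 :: "real^'n" and r :: real and \<xi> :: "'n \<Rightarrow> real^'n \<Rightarrow> real^'n"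
  assumes r: "r > 0" and ball: "ball u0 r \<subseteq> U"
    and \<xi>0: "\<And>a. \<xi> a u0 = axis a 1"
    and d\<xi>: "\<And>a y. y \<in> ball u0 r \<Longrightarrow> (\<xi> a has_derivative (\<lambda>v. \<Gamma> y v (\<xi> a y))) (at y)"
    and det_\<xi>: "\<And>y. y \<in> ball u0 r \<Longrightarrow> det (\<chi> a. \<xi> a y) \<noteq> 0"
    and diag: "\<And>y. y \<in> ball u0 r \<Longrightarrow> diagonalizable (affinor (A False y) (A True y))"
begin

text \<open>The columns are the parallel covectors, so \<open>X y c\<close> is the parallel covector
  field with constant components \<open>c\<close>, and it equals \<open>c\<close> at
  \<open>u0\<close>.\<close>

definition M :: "real^'n \<Rightarrow> real^'n^'n" where "M y = transpose (\<chi> a. \<xi> a y)"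

abbreviation X :: "real^'n \<Rightarrow> real^'n \<Rightarrow> real^'n" where "X y c \<equiv> M y *v c"

lemma X_alt: "X y c = (\<Sum>a\<in>UNIV. c $ a *\<^sub>R \<xi> a y)"
  by (simp add: M_def transpose_def matrix_vector_mult_def vec_eq_iff sum_component mult.commute)

lemma inU: "y \<in> ball u0 r \<Longrightarrow> y \<in> U" using ball by blast

lemma u0_ball: "u0 \<in> ball u0 r" using r by simp

lemma X_u0: "X u0 c = c" by (simp add: X_alt \<xi>0 sum_axis)

lemma det_M: "y \<in> ball u0 r \<Longrightarrow> det (M y) \<noteq> 0"
  unfolding M_def det_transpose by (rule det_\<xi>)

lemma X_inv: "y \<in> ball u0 r \<Longrightarrow> X y (matrix_inv (M y) *v z) = z"
  by (simp add: matrix_vector_mul_assoc matrix_inv_cancel[OF det_M])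

lemma dX: "y \<in> ball u0 r \<Longrightarrow> ((\<lambda>y. X y c) has_derivative (\<lambda>v. \<Gamma> y v (X y c))) (at y)"
proof -
  assume y: "y \<in> ball u0 r"
  have "((\<lambda>y. \<Sum>a\<in>UNIV. c $ a *\<^sub>R \<xi> a y) has_derivative (\<lambda>v. \<Sum>a\<in>UNIV. c $ a *\<^sub>R \<Gamma> y v (\<xi> a y))) (at y)"
    by (intro has_derivative_sum has_derivative_scaleR_right d\<xi> y)
  then show ?thesis
    unfolding X_alt by (simp add: linear_sum[OF linear_\<Gamma>_right] linear_scale[OF linear_\<Gamma>_right])
qed

lemma const_on_ball:
  fixes f :: "real^'n \<Rightarrow> real"
  assumes "\<And>y. y \<in> ball u0 r \<Longrightarrow> (f has_derivative (\<lambda>w. 0)) (at y)" and y: "y \<in> ball u0 r" "y' \<in> ball u0 r"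
  shows "f y = f y'"
proof -
  have "\<exists>c. \<forall>x\<in>ball u0 r. f x = c"
    by (rule has_derivative_zero_constant[OF convex_ball]) (rule has_derivative_at_withinI, rule assms(1))
  then show ?thesis using y by force
qed

lemma dAX: "y \<in> ball u0 r \<Longrightarrow> ((\<lambda>y. A \<alpha> y *v X y d) has_derivative
    (\<lambda>w. A \<alpha> y *v \<Gamma> y w (X y d) + frechet_derivative (A \<alpha>) (at y) w *v X y d)) (at y)"
  by (rule bounded_bilinear.FDERIV[OF bounded_bilinear_matrix_vector_mult smooth_on_has_derivative[OF smooth_A inU] dX])

lemma dXAX:
  assumes y: "y \<in> ball u0 r"
  shows "((\<lambda>y. X y c \<bullet> (A \<alpha> y *v X y d)) has_derivative
    (\<lambda>w. X y c \<bullet> (A \<alpha> y *v \<Gamma> y w (X y d)) + (\<beta> \<alpha> y (X y c) (X y d) + \<beta> \<alpha> y (X y d) (X y c)) \<bullet> w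
       + \<Gamma> y w (X y c) \<bullet> (A \<alpha> y *v X y d))) (at y)"
  by (rule has_derivative_eq_rhs[OF has_derivative_inner[OF dX[OF y] dAX[OF y]]])
    (simp add: fun_eq_iff inner_add_right dAv[OF inU[OF y]] deriv_A[OF ham inU[OF y]])

text \<open>A metric connection preserves inner products of parallel covectors: the derivative of
  the metric cancels the two terms from moving the frame.\<close>

lemma \<eta>_const:
  assumes y: "y \<in> ball u0 r"
  shows "X y c \<bullet> G y (X y d) = c \<bullet> G u0 d"
proof -
  have "X y c \<bullet> G y (X y d) = X u0 c \<bullet> G u0 (X u0 d)"
  proof (rule const_on_ball[of "\<lambda>y. X y c \<bullet> G y (X y d)", OF _ y u0_ball])
    fix y assume y: "y \<in> ball u0 r"
    note yU = inU[OF y]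
    have "X y c \<bullet> G y (\<Gamma> y w (X y d)) + (\<beta> False y (X y c) (X y d) + \<beta> False y (X y d) (X y c)) \<bullet> w
       + \<Gamma> y w (X y c) \<bullet> G y (X y d) = 0" for w
      using \<Gamma>_sym[OF yU, of "G y (X y c)" "X y d" w] \<Gamma>_sym[OF yU, of "G y (X y d)" "X y c" w]
        G_sym[OF yU, of "X y c" "\<Gamma> y w (X y d)"]
      unfolding \<beta>0[OF yU] inner_add_left inner_minus_left by linarith
    then show "((\<lambda>y. X y c \<bullet> G y (X y d)) has_derivative (\<lambda>w. 0)) (at y)"
      using dXAX[OF y, of c False d] by simp
  qed
  then show ?thesis by (simp add: X_u0)
qed

abbreviation \<kappa> :: "real^'n \<Rightarrow> real^'n \<Rightarrow> real^'n \<Rightarrow> real" where "\<kappa> y c d \<equiv> X y c \<bullet> H y (X y d)"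

definition t :: "real^'n \<Rightarrow> real^'n \<Rightarrow> real^'n \<Rightarrow> real^'n \<Rightarrow> real" where
  "t y a b c = G y (X y a) \<bullet> T y (X y b) (X y c)"

lemma t_sym: "y \<in> ball u0 r \<Longrightarrow> t y a b c = t y b a c"
  using T_sym[OF inU, of y "X y b" "X y c" "X y a"] by (simp add: t_def inner_commute)

lemma t_cyc: "y \<in> ball u0 r \<Longrightarrow> t y a b c + t y b c a + t y c a b = 0"
  using T_cyclic[OF inU, of y "X y a" "X y b" "X y c"]
    inner_commute[of "G y (X y a)" "T y (X y b) (X y c)"] inner_commute[of "G y (X y b)" "T y (X y c) (X y a)"]
    inner_commute[of "G y (X y c)" "T y (X y a) (X y b)"]
  unfolding t_def by linarith

lemma d\<kappa>:
  assumes y: "y \<in> ball u0 r"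
  shows "((\<lambda>y. \<kappa> y c d) has_derivative (\<lambda>w. (T y (X y c) (X y d) + T y (X y d) (X y c)) \<bullet> w)) (at y)"
proof (rule has_derivative_eq_rhs[OF dXAX[OF y]], rule ext)
  fix w
  note yU = inU[OF y]
  show "X y c \<bullet> H y (\<Gamma> y w (X y d)) + (\<beta> True y (X y c) (X y d) + \<beta> True y (X y d) (X y c)) \<bullet> w
       + \<Gamma> y w (X y c) \<bullet> H y (X y d) = (T y (X y c) (X y d) + T y (X y d) (X y c)) \<bullet> w"
    using \<Gamma>_sym[OF yU, of "H y (X y c)" "X y d" w] \<Gamma>_sym[OF yU, of "H y (X y d)" "X y c" w]
      H_sym[OF yU, of "X y c" "\<Gamma> y w (X y d)"]
    unfolding \<beta>1[OF yU] inner_add_left inner_diff_left by linarith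
qed

text \<open>The vectors \<open>G y (X y e)\<close> exhaust all directions, so \<open>- t\<close>
  comprises all first derivatives of the second metric in the parallel frame.\<close>

lemma d\<kappa>_direction:
  assumes y: "y \<in> ball u0 r"
  shows "(T y (X y c) (X y d) + T y (X y d) (X y c)) \<bullet> G y (X y e) = - t y c d e"
  using T_cyclic[OF inU[OF y], of "X y c" "X y d" "X y e"] T_sym[OF inU[OF y], of "X y d" "X y c" "X y e"]
    inner_commute[of "G y (X y c)" "T y (X y d) (X y e)"]
  unfolding t_def inner_add_left by linarith

text \<open>The derivative of \<open>t\<close> along \<open>G(X d)\<close> is symmetric in its first three arguments and cyclic in
  the last three, hence zero.\<close>
lemma t_const:
  assumes y: "y \<in> ball u0 r" "y' \<in> ball u0 r"
  shows "t y a b c = t y' a b c"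
proof -
  define Dt where "Dt y w a b c = G y (X y a) \<bullet> (frechet_derivative (\<lambda>y'. T y' (X y b) (X y c)) (at y) w
      + T y (\<Gamma> y w (X y b)) (X y c) + T y (X y b) (\<Gamma> y w (X y c)))
     - \<Gamma> y w (T y (X y b) (X y c)) \<bullet> G y (X y a)" for y w a b c
  have D: "((\<lambda>y. t y a b c) has_derivative (\<lambda>w. Dt y w a b c)) (at y)" if y: "y \<in> ball u0 r" for y a b c
  proof -
    note yU = inU[OF y]
    have 1: "((\<lambda>y. T y (X y b) (X y c)) has_derivative (\<lambda>w. frechet_derivative (\<lambda>y'. T y' (X y b) (X y c)) (at y) w
      + T y (\<Gamma> y w (X y b)) (X y c) + T y (X y b) (\<Gamma> y w (X y c)))) (at y)"
      by (rule has_derivative_bilinear_family[OF linear_T_left linear_T_right smooth_on_differentiable[OF smooth_T yU] dX[OF y] dX[OF y]])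
    show ?thesis
      unfolding t_def
    proof (rule has_derivative_eq_rhs[OF has_derivative_inner[OF dAX[OF y] 1]], rule ext)
      fix w
      let ?\<tau> = "T y (X y b) (X y c)"
      have "(frechet_derivative (A False) (at y) w *v X y a) \<bullet> ?\<tau> = dA False y ?\<tau> (X y a) w"
        unfolding dAv[OF yU, symmetric] by (rule inner_commute)
      then have "(G y (\<Gamma> y w (X y a)) + frechet_derivative (A False) (at y) w *v X y a) \<bullet> ?\<tau>
          = - (\<Gamma> y w ?\<tau> \<bullet> G y (X y a))"
        using G_sym[OF yU, of ?\<tau> "\<Gamma> y w (X y a)"] inner_commute[of "G y (\<Gamma> y w (X y a))" ?\<tau>]
          \<Gamma>_sym[OF yU, of "G y ?\<tau>" "X y a" w] \<Gamma>_sym[OF yU, of "G y (X y a)" ?\<tau> w]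
        unfolding deriv_A[OF ham yU] \<beta>0[OF yU] inner_add_left inner_minus_left by linarith
      then show "G y (X y a) \<bullet> (frechet_derivative (\<lambda>y'. T y' (X y b) (X y c)) (at y) w
        + T y (\<Gamma> y w (X y b)) (X y c) + T y (X y b) (\<Gamma> y w (X y c)))
        + (G y (\<Gamma> y w (X y a)) + frechet_derivative (A False) (at y) w *v X y a) \<bullet> ?\<tau> = Dt y w a b c"
        unfolding Dt_def by linarith
    qed
  qed
  have Dt0: "Dt y w a b c = 0" if y: "y \<in> ball u0 r" for y w a b c
  proof -
    note yU = inU[OF y]
    define f where "f d a b c = Dt y (G y (X y d)) a b c" for d a b c
    \<comment> \<open>This symmetry is \<open>T_closed\<close>; the additional term with
      \<open>\<Gamma>\<close> is symmetric by \<open>\<Gamma>_sym\<close>.\<close>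
    have "f d a b c = f a d b c" for d a b c
      using T_closed[OF yU, of "X y b" "X y c" "G y (X y d)" "G y (X y a)"]
        \<Gamma>_sym[OF yU, of "G y (X y d)" "T y (X y b) (X y c)" "G y (X y a)"]
      unfolding f_def Dt_def by (simp add: inner_commute)
    moreover have "f d a b c = f d b a c" for d a b c
    proof -
      have "((\<lambda>y. t y a b c) has_derivative (\<lambda>w. Dt y w b a c)) (at y)"
        by (rule has_derivative_transform_within_open[OF D[OF y] open_ball y]) (rule t_sym)
      from fun_cong[OF has_derivative_unique[OF D[OF y] this]] show ?thesis unfolding f_def .
    qed
    moreover have "f d a b c + f d b c a + f d c a b = 0" for d a b c
    proof -
      have 1: "((\<lambda>y. t y a b c + t y b c a + t y c a b) has_derivative (\<lambda>w. Dt y w a b c + Dt y w b c a + Dt y w c a b)) (at y)"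
        by (intro has_derivative_add D y)
      have "((\<lambda>y. t y a b c + t y b c a + t y c a b) has_derivative (\<lambda>w. 0)) (at y)"
        by (rule has_derivative_transform_within_open[OF has_derivative_const open_ball y]) (rule t_cyc[symmetric])
      from fun_cong[OF has_derivative_unique[OF 1 this]] show ?thesis unfolding f_def .
    qed
    ultimately have "f d a b c = 0" for d a b c by (rule sum_sym_cyclic_zero)
    from this[of "matrix_inv (M y) *v Gi y w" a b c] show ?thesis
      by (simp add: f_def X_inv[OF y] G_Gi[OF yU])
  qed
  show ?thesis
    by (rule const_on_ball[of "\<lambda>y. t y a b c", OF _ y]) (use D Dt0 in simp)
qed

text \<open>The transposed affinor \<open>G^-1 H\<close>, which acts on covectors, written in the
  parallel frame.\<close>

definition N :: "real^'n \<Rightarrow> real^'n^'n" where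
  "N y = matrix_inv (M y) ** (matrix_inv (A False y) ** A True y) ** M y"

lemma GXN: "y \<in> ball u0 r \<Longrightarrow> G y (X y (N y *v b)) = H y (X y b)"
  by (simp add: N_def X_inv G_Gi[OF inU] flip: matrix_vector_mul_assoc)

lemma \<eta>_N: "y \<in> ball u0 r \<Longrightarrow> c \<bullet> G u0 (N y *v b) = \<kappa> y c b"
  by (simp add: GXN flip: \<eta>_const)

lemma transpose_A: "y \<in> U \<Longrightarrow> transpose (A \<alpha> y) = A \<alpha> y"
proof -
  assume y: "y \<in> U"
  have "A \<alpha> y $ j $ i = A \<alpha> y $ i $ j" for i j
    using skew_A[OF ham y, of "axis i 1" \<alpha> "axis j 1"]
    by (simp add: inner_axis' matrix_vector_mult_basis column_def)
  then show ?thesis by (simp add: transpose_def vec_eq_iff)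
qed

lemma diagonalizable_N:
  assumes y: "y \<in> ball u0 r" shows "diagonalizable (N y)"
proof -
  note yU = inU[OF y]
  have "transpose (matrix_inv (A False y)) = matrix_inv (A False y)"
  proof -
    let ?I = "matrix_inv (A False y)"
    have I: "A False y ** ?I = mat 1" "?I ** A False y = mat 1"
      by (rule matrix_inv_cancel[OF nondeg[OF yU]])+
    have "transpose ?I ** A False y = mat 1"
      using arg_cong[OF I(1), of transpose] by (simp add: matrix_transpose_mul transpose_mat transpose_A[OF yU])
    then have "(transpose ?I ** A False y) ** ?I = ?I" by simp
    then show ?thesis by (simp only: matrix_mul_assoc[symmetric] I matrix_mul_rid)
  qed
  then have "transpose (affinor (A False y) (A True y)) = matrix_inv (A False y) ** A True y"
    by (simp add: affinor_def matrix_transpose_mul transpose_A[OF yU])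
  then have "diagonalizable (matrix_inv (A False y) ** A True y)"
    using diagonalizable_transpose[OF diag[OF y]] by simp
  then show ?thesis
    unfolding N_def by (rule diagonalizable_conj) (rule matrix_inv_cancel[OF det_M[OF y]])+
qed

text \<open>At \<open>y1\<close> itself this is symmetry of the two metrics. The derivatives of both
  sides are values of \<open>t\<close>, which are constant and may be compared at \<open>y1\<close>;
  there \<open>G y1 (X y1 (N y1 *v b)) = H y1 (X y1 b)\<close> turns the claim into
  \<open>T_sym'\<close>.\<close>

lemma \<kappa>_N_sym:
  assumes y: "y \<in> ball u0 r" and y1: "y1 \<in> ball u0 r"
  shows "\<kappa> y c (N y1 *v b) = \<kappa> y (N y1 *v c) b"
proof -
  let ?f = "\<lambda>y. \<kappa> y c (N y1 *v b) - \<kappa> y (N y1 *v c) b"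
  have t: "t y c (N y1 *v b) e = t y (N y1 *v c) b e" if y: "y \<in> ball u0 r" for y e
  proof -
    have "t y1 c (N y1 *v b) e = t y1 (N y1 *v c) b e"
      unfolding t_sym[OF y1, of c] unfolding t_def GXN[OF y1]
      using T_sym'[OF inU[OF y1], of "X y1 c" "X y1 e" "X y1 b"] by (simp add: inner_commute)
    then show ?thesis using t_const[OF y y1] by simp
  qed
  have "?f y = ?f y1"
  proof (rule const_on_ball[OF _ y y1])
    fix y assume y: "y \<in> ball u0 r"
    show "(?f has_derivative (\<lambda>w. 0)) (at y)"
    proof (rule has_derivative_eq_rhs[OF has_derivative_diff[OF d\<kappa>[OF y] d\<kappa>[OF y]]], rule ext)
      fix w
      define e where "e = matrix_inv (M y) *v Gi y w"
      have w: "w = G y (X y e)" by (simp add: e_def X_inv[OF y] G_Gi[OF inU[OF y]])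
      show "(T y (X y c) (X y (N y1 *v b)) + T y (X y (N y1 *v b)) (X y c)) \<bullet> w
         - (T y (X y (N y1 *v c)) (X y b) + T y (X y b) (X y (N y1 *v c))) \<bullet> w = 0"
        unfolding w d\<kappa>_direction[OF y] by (simp add: t[OF y])
    qed
  qed
  moreover have "?f y1 = 0"
    using H_sym[OF inU[OF y1], of "X y1 c" "X y1 (N y1 *v b)"] G_sym[OF inU[OF y1], of "X y1 (N y1 *v b)" "X y1 (N y1 *v c)"]
    by (simp flip: GXN[OF y1])
  ultimately show ?thesis by simp
qed

text \<open>\<open>N y1\<close> is self-adjoint for the constant metric and, by
  \<open>\<kappa>_N_sym\<close>, for the second metric at \<open>y\<close>; \<open>N y\<close>
  converts one metric into the other, so the two matrices commute.\<close>

lemma N_commute: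
  assumes y: "y \<in> ball u0 r" and y1: "y1 \<in> ball u0 r"
  shows "N y ** N y1 = N y1 ** N y"
proof -
  note u0U = inU[OF u0_ball]
  have "N y *v (N y1 *v b) = N y1 *v (N y *v b)" for b
  proof -
    have "c \<bullet> G u0 (N y *v (N y1 *v b)) = c \<bullet> G u0 (N y1 *v (N y *v b))" for c
    proof -
      have "c \<bullet> G u0 (N y1 *v (N y *v b)) = \<kappa> y1 (N y *v b) c"
        unfolding \<eta>_N[OF y1] by (rule H_sym[OF inU[OF y1]])
      also have "\<dots> = (N y1 *v c) \<bullet> G u0 (N y *v b)"
        unfolding \<eta>_N[OF y1, symmetric] by (rule G_sym[OF u0U])
      also have "\<dots> = \<kappa> y (N y1 *v c) b" by (rule \<eta>_N[OF y])
      also have "\<dots> = c \<bullet> G u0 (N y *v (N y1 *v b))"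
        unfolding \<eta>_N[OF y] by (rule \<kappa>_N_sym[OF y y1, symmetric])
      finally show ?thesis ..
    qed
    then have "G u0 (N y *v (N y1 *v b)) = G u0 (N y1 *v (N y *v b))"
      using vector_eq_ldot by blast
    then have "Gi u0 (G u0 (N y *v (N y1 *v b))) = Gi u0 (G u0 (N y1 *v (N y *v b)))" by simp
    then show ?thesis by (simp only: Gi_G[OF u0U])
  qed
  then show ?thesis by (simp add: matrix_eq flip: matrix_vector_mul_assoc)
qed

section \<open>Derivatives of the affinor matrix and their vanishing\<close>

definition tk :: "'n \<Rightarrow> real^'n^'n" where
  "tk k = (\<chi> i j. t u0 (axis i 1) (axis j 1) (axis k 1))"

text \<open>The matrix of \<open>T u0\<close> in its first argument, with second argument
  \<open>axis k 1\<close>: the index lowered in \<open>tk\<close> is raised again.\<close>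

definition R :: "'n \<Rightarrow> real^'n^'n" where "R k = matrix_inv (A False u0) ** tk k"

lemma \<eta>_R: "A False u0 ** R k = tk k"
  using matrix_inv_cancel(1)[OF nondeg[OF inU[OF u0_ball]]]
  by (simp add: R_def matrix_mul_assoc)

text \<open>Along \<open>G u0 (axis k 1)\<close> the derivative of \<open>N\<close> is
  \<open>- R k\<close>. Its difference quotients lie in the span of the values of \<open>N\<close>,
  and a finite-dimensional subspace is closed. Thus \<open>R k\<close> acquires the joint
  eigenvectors of \<open>N\<close> although none of them is differentiated.\<close>

lemma R_in_span: "R k \<in> span (N ` ball u0 r)"
proof -
  note u0U = inU[OF u0_ball]
  define n where "n = G u0 (axis k 1)"
  define K where "K y = (\<chi> i j. \<kappa> y (axis i 1) (axis j 1))" for y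
  have NK: "N y = matrix_inv (A False u0) ** K y" if y: "y \<in> ball u0 r" for y
  proof -
    have "(A False u0 ** N y) $ i $ j = axis i 1 \<bullet> ((A False u0 ** N y) *v axis j 1)" for i j
      by (simp add: inner_axis' matrix_vector_mult_basis column_def)
    then have "(A False u0 ** N y) $ i $ j = K y $ i $ j" for i j
      unfolding matrix_vector_mul_assoc[symmetric] \<eta>_N[OF y] by (simp only: K_def vec_lambda_beta)
    then have "A False u0 ** N y = K y" by (simp add: vec_eq_iff)
    then have "matrix_inv (A False u0) ** (A False u0 ** N y) = matrix_inv (A False u0) ** K y" by simp
    then show ?thesis by (simp add: matrix_mul_assoc matrix_inv_cancel[OF nondeg[OF u0U]])
  qed
  have d: "((\<lambda>h. \<kappa> (u0 + h *\<^sub>R n) (axis i 1) (axis j 1)) has_real_derivative - (tk k $ i $ j)) (at 0)" for i j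
  proof -
    have 1: "((\<lambda>h. u0 + h *\<^sub>R n) has_derivative (\<lambda>h. h *\<^sub>R n)) (at 0)"
      by (auto intro!: derivative_eq_intros)
    have "((\<lambda>y. \<kappa> y (axis i 1) (axis j 1)) has_derivative (\<lambda>w. (T u0 (X u0 (axis i 1)) (X u0 (axis j 1))
        + T u0 (X u0 (axis j 1)) (X u0 (axis i 1))) \<bullet> w)) (at (u0 + 0 *\<^sub>R n))"
      using d\<kappa>[OF u0_ball] by simp
    from diff_chain_at[OF 1 this]
    have 2: "((\<lambda>h. \<kappa> (u0 + h *\<^sub>R n) (axis i 1) (axis j 1)) has_derivative (\<lambda>h. h * ((T u0 (X u0 (axis i 1)) (X u0 (axis j 1))
        + T u0 (X u0 (axis j 1)) (X u0 (axis i 1))) \<bullet> n))) (at 0)" by (simp add: o_def)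
    have 3: "(T u0 (X u0 (axis i 1)) (X u0 (axis j 1)) + T u0 (X u0 (axis j 1)) (X u0 (axis i 1))) \<bullet> n
        = - (tk k $ i $ j)"
      using d\<kappa>_direction[OF u0_ball, of "axis i 1" "axis j 1" "axis k 1"] by (simp add: X_u0 n_def tk_def)
    show ?thesis
      unfolding has_field_derivative_def
      by (rule has_derivative_eq_rhs[OF 2]) (simp add: fun_eq_iff 3)
  qed
  have "((\<lambda>h. inverse h *\<^sub>R (K (u0 + h *\<^sub>R n) - K u0)) \<longlongrightarrow> - tk k) (at 0)"
  proof (intro vec_tendstoI)
    fix i j
    show "((\<lambda>h. (inverse h *\<^sub>R (K (u0 + h *\<^sub>R n) - K u0)) $ i $ j) \<longlongrightarrow> (- tk k) $ i $ j) (at 0)"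
      using d[of i j] by (simp add: has_field_derivative_iff K_def divide_inverse mult.commute)
  qed
  then have lim: "((\<lambda>h. matrix_inv (A False u0) ** (inverse h *\<^sub>R (K (u0 + h *\<^sub>R n) - K u0))) \<longlongrightarrow> matrix_inv (A False u0) ** (- tk k)) (at 0)"
  proof (rule tendsto_compose[rotated])
    have "linear (\<lambda>K :: real^'n^'n. matrix_inv (A False u0) ** K)"
      by (simp add: linear_iff matrix_add_ldistrib matrix_scaleR[symmetric] matrix_scalar_ac scalar_matrix_assoc)
    then show "((\<lambda>K. matrix_inv (A False u0) ** K) \<longlongrightarrow> matrix_inv (A False u0) ** (- tk k)) (at (- tk k))"
      using linear_continuous_at linear_conv_bounded_linear isCont_def by blast
  qed
  have ev: "\<forall>\<^sub>F h in at 0. matrix_inv (A False u0) ** (inverse h *\<^sub>R (K (u0 + h *\<^sub>R n) - K u0)) \<in> span (N ` ball u0 r)"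
  proof -
    have "((\<lambda>h. u0 + h *\<^sub>R n) \<longlongrightarrow> u0 + 0 *\<^sub>R n) (at 0)" by (intro tendsto_intros)
    then have "\<forall>\<^sub>F h in at 0. u0 + h *\<^sub>R n \<in> ball u0 r"
      by (rule topological_tendstoD) (use r in auto)
    then show ?thesis
    proof (rule eventually_mono)
      fix h assume h: "u0 + h *\<^sub>R n \<in> ball u0 r"
      have "matrix_inv (A False u0) ** (inverse h *\<^sub>R (K (u0 + h *\<^sub>R n) - K u0)) = inverse h *\<^sub>R (N (u0 + h *\<^sub>R n) - N u0)"
        unfolding NK[OF h] NK[OF u0_ball]
        by (simp add: matrix_matrix_mult_def vec_eq_iff sum_distrib_left algebra_simps sum_subtractf)
      also have "\<dots> \<in> span (N ` ball u0 r)"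
        by (intro span_mul span_diff span_base imageI h u0_ball)
      finally show "matrix_inv (A False u0) ** (inverse h *\<^sub>R (K (u0 + h *\<^sub>R n) - K u0)) \<in> span (N ` ball u0 r)" .
    qed
  qed
  have "matrix_inv (A False u0) ** (- tk k) \<in> span (N ` ball u0 r)"
    by (rule Lim_in_closed_set[OF closed_subspace[OF subspace_span] ev _ lim]) simp
  moreover have "matrix_inv (A False u0) ** (- tk k) = - R k"
    by (simp add: R_def matrix_matrix_mult_def vec_eq_iff sum_negf)
  ultimately show ?thesis using span_neg[of "- R k"] by simp
qed

lemma R_zero: "R k = 0"
proof (rule obstruction_zero[where \<eta> = "A False u0" and Ns = "span (N ` ball u0 r)" and R = R])
  note u0U = inU[OF u0_ball]
  show "transpose (A False u0) = A False u0" by (rule transpose_A[OF u0U])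
  show "det (A False u0) \<noteq> 0" by (rule nondeg[OF u0U])
  show "transpose (A False u0 ** R k) = A False u0 ** R k" for k
    unfolding \<eta>_R by (simp add: tk_def transpose_def vec_eq_iff t_sym[OF u0_ball, of "axis _ 1" "axis _ 1"])
  show "(A False u0 ** R k) $ i $ j + (A False u0 ** R i) $ j $ k + (A False u0 ** R j) $ k $ i = 0" for i j k
    unfolding \<eta>_R by (simp add: tk_def t_cyc[OF u0_ball])
  show "R k \<in> span (N ` ball u0 r)" for k by (rule R_in_span)
  show "span (joint_eigenvectors (cmat ` span (N ` ball u0 r))) = UNIV"
    by (rule span_joint_eigenvectors_cmat) (auto intro: diagonalizable_N N_commute simp del: mem_ball)
qed

text \<open>\<open>R_zero\<close> settles the point \<open>u0\<close>; \<open>t_const\<close>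
  carries the vanishing to the whole ball.\<close>

lemma T_zero:
  assumes y: "y \<in> ball u0 r" shows "T y b c = 0"
proof -
  note u0U = inU[OF u0_ball]
  have nz: "x = 0" if "y \<in> ball u0 r" "\<And>a. G y (X y a) \<bullet> x = 0" for x y
    using that(2)[of "matrix_inv (M y) *v Gi y x"] by (simp add: X_inv[OF that(1)] G_Gi[OF inU[OF that(1)]])
  have "t u0 (axis i 1) (axis j 1) (axis k 1) = 0" for i j k
    using \<eta>_R[of k] by (simp add: R_zero tk_def vec_eq_iff matrix_matrix_mult_def)
  then have "axis i 1 \<bullet> G u0 (T u0 (axis j 1) (axis k 1)) = 0" for i j k
    unfolding t_def X_u0 by (subst G_sym[OF u0U]) (simp add: inner_commute)
  then have "G u0 (T u0 (axis j 1) (axis k 1)) = 0" for j k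
    by (simp add: vec_eq_iff inner_axis')
  then have "Gi u0 (G u0 (T u0 (axis j 1) (axis k 1))) = 0" for j k by simp
  then have 0: "T u0 (axis j 1) (axis k 1) = 0" for j k by (simp only: Gi_G[OF u0U])
  have "T u0 (axis j 1) c = 0" for j c
    by (subst linear_expand[OF linear_T_right]) (simp add: 0)
  then have T0: "T u0 b c = 0" for b c
    by (subst linear_expand[OF linear_T_left]) simp
  have "T y (X y b) (X y c) = 0" for b c
  proof (rule nz[OF y])
    show "G y (X y a) \<bullet> T y (X y b) (X y c) = 0" for a
      using t_const[OF y u0_ball, of a b c] by (simp add: t_def T0)
  qed
  from this[of "matrix_inv (M y) *v b" "matrix_inv (M y) *v c"] show ?thesis by (simp add: X_inv[OF y])
qed

end

section \<open>Reduction to constant form\<close>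

lemma has_derivative_vec_lambda:
  fixes f :: "'n::finite \<Rightarrow> 'a::real_normed_vector \<Rightarrow> real"
  assumes "\<And>i. (f i has_derivative f' i) (at x)"
  shows "((\<lambda>y. \<chi> i. f i y) has_derivative (\<lambda>v. \<chi> i. f' i v)) (at x)"
proof -
  have e: "(\<chi> i. g i) = (\<Sum>i\<in>UNIV. g i *\<^sub>R axis i 1)" for g :: "'n \<Rightarrow> real"
    by (simp add: vec_eq_iff sum_component axis_def if_distrib[of "\<lambda>x. _ * x"] cong: if_cong)
  show ?thesis
    unfolding e by (intro has_derivative_sum has_derivative_scaleR_left assms)
qed

text \<open>The Jacobian has the covectors \<open>\<xi> a\<close> as rows and is the identity at
  \<open>u0\<close>. On a smaller ball its determinant stays nonzero by continuity, and the map is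
  injective because its derivative is continuous and invertible at \<open>u0\<close>.\<close>

lemma local_diffeo_flat_coordinates:
  fixes \<xi> :: "'n::finite \<Rightarrow> real^'n \<Rightarrow> real^'n" and s :: "'n \<Rightarrow> real^'n \<Rightarrow> real"
  assumes r: "r > 0" and \<xi>0: "\<And>a. \<xi> a u0 = axis a 1"
    and \<xi>: "\<And>a. smooth_on (ball u0 r) (\<xi> a)"
    and s: "\<And>a y. y \<in> ball u0 r \<Longrightarrow> (s a has_derivative (\<lambda>v. \<xi> a y \<bullet> v)) (at y)"
  shows "\<exists>r'>0. r' \<le> r \<and> local_diffeo (ball u0 r') (\<lambda>y. \<chi> a. s a y) \<and>
    (\<forall>y\<in>ball u0 r'. jacobian (\<lambda>y. \<chi> a. s a y) y = (\<chi> a. \<xi> a y) \<and> det (\<chi> a. \<xi> a y) \<noteq> 0)"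
proof -
  let ?\<Phi> = "\<lambda>y. \<chi> a. s a y"
  let ?J = "\<lambda>y. (\<chi> a. \<xi> a y) :: real^'n^'n"
  have D: "(?\<Phi> has_derivative (\<lambda>v. ?J y *v v)) (at y)" if "y \<in> ball u0 r" for y
  proof -
    have "?J y *v v = (\<chi> a. \<xi> a y \<bullet> v)" for v
      by (simp add: matrix_vector_mult_def inner_vec_def)
    then show ?thesis using has_derivative_vec_lambda[of s "\<lambda>a v. \<xi> a y \<bullet> v", OF s[OF that]] by simp
  qed
  have jac: "jacobian ?\<Phi> y = ?J y" if "y \<in> ball u0 r" for y
    unfolding jacobian_def frechet_derivative_eq[OF D[OF that]] by (rule matrix_of_matrix_vector_mul)
  have sm: "smooth_on (ball u0 r) ?\<Phi>"
  proof (rule smooth_onI_deriv[OF open_ball D])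
    show "smooth_on (ball u0 r) (\<lambda>y. ?J y *v v)" for v
      by (intro smooth_on_matrix_vector_mult smooth_on_const open_ball)
        (rule smooth_on_vec[OF open_ball], simp add: \<xi>)
  qed
  have Jc: "continuous_on (ball u0 r) ?J"
    by (intro continuous_on_vec_lambda smooth_on_continuous \<xi>)
  have J0: "?J u0 = mat 1" by (simp add: \<xi>0 vec_eq_iff mat_def axis_def)
  have u0: "u0 \<in> ball u0 r" using r by simp
  have "smooth_on (ball u0 r) (\<lambda>y. det (?J y))"
    by (intro smooth_on_det open_ball) (simp add: smooth_on_vec_nth[OF open_ball \<xi>])
  then have "isCont (\<lambda>y. det (?J y)) u0" by (rule smooth_on_isCont[OF _ u0])
  moreover have "det (?J u0) \<noteq> 0" by (simp add: J0)
  ultimately obtain r1 where r1: "r1 > 0" "\<And>y. dist u0 y < r1 \<Longrightarrow> det (?J y) \<noteq> 0"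
    using continuous_at_avoid[of u0 "\<lambda>y. det (?J y)" 0] by auto
  obtain r2 where r2: "r2 > 0" "inj_on ?\<Phi> (ball u0 r2)"
  proof (rule has_derivative_locally_injective[OF u0 open_ball bounded_linear_ident _ D])
    show "(\<lambda>x. x) \<circ> (\<lambda>v. ?J u0 *v v) = id" by (simp add: J0 fun_eq_iff)
    fix e :: real assume e: "e > 0"
    have "isCont ?J u0" using Jc u0 by (simp add: continuous_on_eq_continuous_at)
    moreover have "e / (2 * (real CARD('n) * real CARD('n))) > 0" using e by simp
    \<comment> \<open>The operator norm is at most the number of entries times a bound for them, so
      this bound on the entries gives \<open>e / 2\<close>.\<close>
    ultimately obtain d where d: "d > 0" "\<And>x. dist x u0 < d \<Longrightarrow> dist (?J x) (?J u0) < e / (2 * (real CARD('n) * real CARD('n)))"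
      unfolding continuous_at_eps_delta by blast
    have "onorm (\<lambda>v. ?J x *v v - ?J u0 *v v) < e" if "dist u0 x < d" for x
    proof -
      let ?M = "?J x - ?J u0"
      have "\<bar>?M $ i $ j\<bar> \<le> e / (2 * (real CARD('n) * real CARD('n)))" for i j
      proof -
        have "\<bar>?M $ i $ j\<bar> \<le> norm (?M $ i)" by (rule component_le_norm_cart)
        also have "\<dots> \<le> norm ?M" by (rule Finite_Cartesian_Product.norm_nth_le)
        also have "\<dots> \<le> e / (2 * (real CARD('n) * real CARD('n)))"
          using d(2)[of x] that by (simp add: dist_norm norm_minus_commute less_imp_le dist_commute)
        finally show ?thesis .
      qed
      then have "onorm ((*v) ?M) \<le> real CARD('n) * real CARD('n) * (e / (2 * (real CARD('n) * real CARD('n))))"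
        by (rule onorm_le_matrix_component)
      also have "\<dots> = e / 2" by simp
      also have "\<dots> < e" using e by simp
      finally have "onorm ((*v) ?M) < e" .
      moreover have "(*v) ?M = (\<lambda>v. ?J x *v v - ?J u0 *v v)"
        by (rule ext) (rule matrix_vector_mult_diff_rdistrib)
      ultimately show ?thesis by (simp only:)
    qed
    then show "\<exists>d>0. \<forall>x. dist u0 x < d \<longrightarrow> onorm (\<lambda>v. ?J x *v v - ?J u0 *v v) < e" using d(1) by blast
  qed (assumption, rule that)
  define r' where "r' = min r (min r1 r2)"
  have r': "r' > 0" "ball u0 r' \<subseteq> ball u0 r" "ball u0 r' \<subseteq> ball u0 r1" "ball u0 r' \<subseteq> ball u0 r2"
    using r r1 r2 unfolding r'_def by auto
  have det: "det (?J y) \<noteq> 0" if "y \<in> ball u0 r'" for y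
    using r1(2)[of y] subsetD[OF r'(3) that] by simp
  have j: "jacobian ?\<Phi> y = ?J y" if "y \<in> ball u0 r'" for y
    by (rule jac[OF subsetD[OF r'(2) that]])
  have "local_diffeo (ball u0 r') ?\<Phi>"
    unfolding local_diffeo_def
    using smooth_on_subset[OF sm r'(2)] inj_on_subset[OF r2(2) r'(4)] det j by simp
  moreover have "r' \<le> r" by (simp add: r'_def)
  ultimately show ?thesis using r'(1) det j by blast
qed

context flat_frame
begin

text \<open>Paired with \<open>c\<close>, the transformed operator is
  \<open>X y c \<bullet> P u \<zeta> p\<close> with \<open>\<zeta>\<close> the covector field with
  components \<open>\<psi>\<close>. Differentiating the frame produces \<open>\<Gamma>\<close>
  terms, which cancel the \<open>\<beta>\<close> terms of both metrics once \<open>T = 0\<close>;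
  what remains are the two metrics in the parallel frame, both constant.\<close>

lemma reduces:
  assumes J: "\<And>y. y \<in> ball u0 r \<Longrightarrow> jacobian \<Phi> y = (\<chi> a. \<xi> a y)"
  shows "reduces_to_constant_form (ball u0 r) \<Phi> P"
  unfolding reduces_to_constant_form_def
proof (rule exI[of _ "A False u0"], rule exI[of _ "A True u0"], intro allI impI)
  fix u \<psi> :: "plane \<Rightarrow> real^'n" and p assume "config (ball u0 r) u \<and> smooth_on UNIV \<psi>"
  then have u: "smooth_on UNIV u" "\<And>q. u q \<in> ball u0 r" and \<psi>: "smooth_on UNIV \<psi>"
    unfolding config_def by blast+
  define y where "y = u p"
  have y: "y \<in> ball u0 r" and yU: "y \<in> U" using u(2) inU by (auto simp: y_def simp del: mem_ball)
  have du: "u differentiable at p" and d\<psi>: "\<psi> differentiable at p"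
    using smooth_on_differentiable[OF u(1)] smooth_on_differentiable[OF \<psi>] by auto
  have JM: "transpose (jacobian \<Phi> (u q)) = M (u q)" for q by (simp add: J[OF u(2)] M_def)
  have d\<psi>a: "(\<lambda>q. \<psi> q $ a) differentiable at p" for a
    by (rule smooth_on_differentiable[OF smooth_on_vec_nth[OF open_UNIV \<psi>]]) simp
  have d\<xi>a: "\<xi> a differentiable at (u p)" for a
    using d\<xi>[OF u(2)] unfolding differentiable_def by blast
  have d\<xi>u: "(\<lambda>q. \<xi> a (u q)) differentiable at p" for a
    using differentiable_chain_at[OF du d\<xi>a] by (simp add: o_def)
  have d\<psi>\<xi>: "(\<lambda>q. \<psi> q $ a *\<^sub>R \<xi> a (u q)) differentiable at p" for a
    by (intro differentiable_scaleR d\<psi>a d\<xi>u)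
  define \<zeta> where "\<zeta> q = X (u q) (\<psi> q)" for q
  have \<zeta>: "\<zeta> = (\<lambda>q. \<Sum>a\<in>UNIV. \<psi> q $ a *\<^sub>R \<xi> a (u q))" by (simp add: \<zeta>_def fun_eq_iff X_alt)
  have d\<zeta>: "\<zeta> differentiable at p" unfolding \<zeta> by (rule differentiable_sum) (simp_all add: d\<psi>\<xi>)
  have p\<zeta>: "pd \<alpha> \<zeta> p = X y (pd \<alpha> \<psi> p) + \<Gamma> y (pd \<alpha> u p) (X y (\<psi> p))" for \<alpha>
  proof -
    have 1: "pd \<alpha> (\<lambda>q. \<xi> a (u q)) p = \<Gamma> y (pd \<alpha> u p) (\<xi> a y)" for a
      using pd_compose[OF d\<xi>a du] by (simp add: frechet_derivative_eq[OF d\<xi>[OF u(2)]] y_def)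
    have 2: "pd \<alpha> (\<lambda>q. \<psi> q $ a) p = pd \<alpha> \<psi> p $ a" for a
      by (rule pd_linear[OF bounded_linear_vec_nth d\<psi>])
    show ?thesis
      unfolding \<zeta> pd_sum[OF d\<psi>\<xi>] pd_scaleR[OF d\<psi>a d\<xi>u] 1 2 X_alt
        linear_sum[OF linear_\<Gamma>_right] linear_scale[OF linear_\<Gamma>_right]
      by (simp add: y_def sum.distrib add.commute)
  qed
  have const: "X y c \<bullet> (A \<alpha> y *v X y d) = c \<bullet> (A \<alpha> u0 *v d)" for \<alpha> c d
  proof (cases \<alpha>)
    case True
    have "\<kappa> y c d = \<kappa> u0 c d"
    proof (rule const_on_ball[of "\<lambda>y. \<kappa> y c d", OF _ y u0_ball])
      fix y assume y: "y \<in> ball u0 r"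
      show "((\<lambda>y. \<kappa> y c d) has_derivative (\<lambda>w. 0)) (at y)"
        using d\<kappa>[OF y] by (simp add: T_zero[OF y])
    qed
    then show ?thesis using True by (simp add: X_u0)
  qed (use \<eta>_const[OF y] in simp)
  have canc: "X y c \<bullet> (A \<alpha> y *v \<Gamma> y v z) + \<beta> \<alpha> y (X y c) z \<bullet> v = 0" for \<alpha> c v z
  proof -
    have "\<beta> \<alpha> y a z = - \<Gamma> y (A \<alpha> y *v a) z" for a
      by (cases \<alpha>) (simp_all add: \<beta>0[OF yU] \<beta>1[OF yU] T_zero[OF y])
    then show ?thesis
      using skew_A[OF ham yU, of "X y c" \<alpha> "\<Gamma> y v z"] \<Gamma>_sym[OF yU, of "A \<alpha> y *v X y c" z v] by simp
  qed
  have "c \<bullet> (jacobian \<Phi> y *v P u \<zeta> p) = c \<bullet> (A False u0 *v pd False \<psi> p + A True u0 *v pd True \<psi> p)" for c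
  proof -
    have "c \<bullet> (jacobian \<Phi> y *v P u \<zeta> p) = X y c \<bullet> P u \<zeta> p"
      using JM[of p] by (simp add: y_def dot_lmul_matrix[symmetric] flip: transpose_matrix_vector)
    also have "\<dots> = (\<Sum>\<alpha>\<in>UNIV. X y c \<bullet> (A \<alpha> y *v X y (pd \<alpha> \<psi> p)))"
      unfolding P_eq[OF du d\<zeta>] y_def[symmetric] inner_sum_right
    proof (rule sum.cong[OF refl])
      fix \<alpha>
      show "X y c \<bullet> (A \<alpha> y *v pd \<alpha> \<zeta> p + Bm \<alpha> y (\<zeta> p) (pd \<alpha> u p)) = X y c \<bullet> (A \<alpha> y *v X y (pd \<alpha> \<psi> p))"
        using canc[of c \<alpha> "pd \<alpha> u p" "\<zeta> p"]
        by (simp add: p\<zeta> \<zeta>_def y_def[symmetric] matrix_vector_right_distrib inner_add_right inner_Bm)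
    qed
    also have "\<dots> = c \<bullet> (A False u0 *v pd False \<psi> p + A True u0 *v pd True \<psi> p)"
      by (simp add: const UNIV_bool inner_add_right)
    finally show ?thesis .
  qed
  then have "jacobian \<Phi> y *v P u \<zeta> p = A False u0 *v pd False \<psi> p + A True u0 *v pd True \<psi> p"
    using vector_eq_ldot by blast
  then show "jacobian \<Phi> (u p) *v P u (\<lambda>q. transpose (jacobian \<Phi> (u q)) *v \<psi> q) p
      = A False u0 *v pdx \<psi> p + A True u0 *v pdy \<psi> p"
    unfolding JM \<zeta>_def[abs_def] pdx_eq_pd[OF d\<psi>] pdy_eq_pd[OF d\<psi>] y_def .
qed

end

theorem theorem6:
  fixes U :: "(real^'n) set"
    and g gt :: "real^'n \<Rightarrow> real^'n^'n"
    and b bt :: "real^'n \<Rightarrow> 'n \<Rightarrow> 'n \<Rightarrow> 'n \<Rightarrow> real"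
  assumes "open U"
    and "smooth_on U g" and "smooth_on U gt"
    and "\<And>i j k. smooth_on U (\<lambda>y. b y i j k)"
    and "\<And>i j k. smooth_on U (\<lambda>y. bt y i j k)"
    and "hamiltonian U (hop g b gt bt)"
    and "\<And>y. y \<in> U \<Longrightarrow> det (g y) \<noteq> 0 \<and> det (gt y) \<noteq> 0"
    and "\<And>y. y \<in> U \<Longrightarrow> diagonalizable (affinor (g y) (gt y))"
    and "u0 \<in> U"
  shows "\<exists>V \<Phi>. u0 \<in> V \<and> V \<subseteq> U \<and> local_diffeo V \<Phi> \<and>
           reduces_to_constant_form V \<Phi> (hop g b gt bt)"
proof -
  define A where "A \<alpha> = (if \<alpha> then gt else g)" for \<alpha>
  define bc where "bc \<alpha> = (if \<alpha> then bt else b)" for \<alpha>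
  interpret dn_operator U A bc
    by unfold_locales (use assms in \<open>auto simp: A_def bc_def\<close>)
  have P: "P = hop g b gt bt" by (simp add: P_def A_def bc_def)
  interpret hamiltonian_dn_operator U A bc
    by unfold_locales (use assms in \<open>auto simp: P A_def\<close>)
  obtain r \<xi> s where r: "r > 0" "ball u0 r \<subseteq> U" and \<xi>0: "\<And>a. \<xi> a u0 = axis a 1"
    and d\<xi>: "\<And>a y. y \<in> ball u0 r \<Longrightarrow> (\<xi> a has_derivative (\<lambda>v. \<Gamma> y v (\<xi> a y))) (at y)"
    and ds: "\<And>a y. y \<in> ball u0 r \<Longrightarrow> (s a has_derivative (\<lambda>v. \<xi> a y \<bullet> v)) (at y)"
    by (rule flat_coframe[OF assms(9)]) blast
  have sm: "smooth_on (ball u0 r) (\<xi> a)" for a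
    by (rule smooth_flat_section[OF open_ball r(2) d\<xi>])
  let ?\<Phi> = "\<lambda>y. \<chi> a. s a y"
  \<comment> \<open>The smaller ball serves two purposes: injectivity of the coordinates, and linear
    independence of the coframe as \<open>flat_frame\<close> demands.\<close>
  obtain r' where r': "r' > 0" "r' \<le> r" "local_diffeo (ball u0 r') ?\<Phi>"
    and J: "\<forall>y\<in>ball u0 r'. jacobian ?\<Phi> y = (\<chi> a. \<xi> a y) \<and> det (\<chi> a. \<xi> a y) \<noteq> 0"
    using local_diffeo_flat_coordinates[OF r(1) \<xi>0 sm ds] by blast
  have sub: "ball u0 r' \<subseteq> ball u0 r" using r'(2) by (rule subset_ball)
  interpret flat_frame U A bc u0 r' \<xi>
  proof unfold_locales
    show "diagonalizable (affinor (A False y) (A True y))" if "y \<in> ball u0 r'" for y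
      using assms(8)[OF subsetD[OF r(2) subsetD[OF sub that]]] by (simp add: A_def)
  qed (use r' sub r(2) \<xi>0 d\<xi> J in blast)+
  have "reduces_to_constant_form (ball u0 r') ?\<Phi> (hop g b gt bt)"
    using reduces[of ?\<Phi>] J unfolding P by blast
  then show ?thesis using r'(3) u0_ball ball by blast
qed

end
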